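(* Let $p=f(x,y)u+g(x,y,z)\in\mathbb{C}[x,y,z,u]$ be a residual $x$-variable written in the form $$p=q\,[\,r\tilde fu+\tilde g_0y^2+\tilde g_1z+\tilde f^{\rm red}\tilde g_2z^2\,]+a_0+a_1y,$$ where $q,r,a_0,a_1\in\mathbb{C}[x]$; $\tilde f,\tilde g_0,\tilde g_1\in\mathbb{C}[x,y]$ with $\tilde f\ne0$; $\tilde g_2\in\mathbb{C}[x,y,z]$; $\tilde f^{-1}(0)\cap\tilde g_1^{-1}(0)$ is a finite subset of $q^{-1}(0)\times\mathbb{C}_y$; and for every root $x_0$ of $r$, $q(x_0)\tilde f(x_0,y)\in\mathbb{C}$. If $\tilde g_1\in\mathbb{C}[x]$ and $\tilde g_2z^2\in\mathbb{C}[x][y,\tilde g_1z]$ (i.e. $\tilde g_2z^2=\hat g_2(x,y,\tilde g_1(x)z)$ for some polynomial $\hat g_2$), then $p$ is an $x$-variable.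
   Context: A variable of $\mathbb{C}^{[m]}$ is a coordinate function of a $\mathbb{C}$-automorphism. $p\in\mathbb{C}[x][y,z,u]$ is an $x$-variable if it is a coordinate function of a $\mathbb{C}[x]$-automorphism of $\mathbb{C}[x][y,z,u]$; it is a residual $x$-variable if for every $\lambda\in\mathbb{C}$ the specialization $p(\lambda,y,z,u)$ is a variable of $\mathbb{C}[y,z,u]$. $\tilde f^{\rm red}$ denotes the product of the distinct irreducible factors of $\tilde f$. $\mathbb{C}_y$ is the affine line with coordinate $y$. *)

theory Defs
  imports
    "HOL-Computational_Algebra.Computational_Algebra"
    "HOL-Computational_Algebra.Field_as_Ring"
begin

text \<open>
  The type \<open>'a poly poly poly\<close> stands for \<open>A[y,z,u] = A[y][z][u]\<close>, the outermost
  polynomial variable being \<open>u\<close>. It is used with \<open>A = \<complex>\<close> and with \<open>A = \<complex>[x]\<close>, so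
  that \<open>\<complex>[x]\<close>, \<open>\<complex>[x,y]\<close>, \<open>\<complex>[x,y,z]\<close> and \<open>\<complex>[x,y,z,u]\<close> are \<open>complex poly\<close> through
  \<open>complex poly poly poly poly\<close>.
\<close>

definition var_y :: "'a::comm_ring_1 poly poly poly"
  where "var_y = [:[:[:0, 1:]:]:]"

definition var_z :: "'a::comm_ring_1 poly poly poly"
  where "var_z = [:[:0, 1:]:]"

definition var_u :: "'a::comm_ring_1 poly poly poly"
  where "var_u = [:0, 1:]"

definition emb_base :: "'a::comm_ring_1 \<Rightarrow> 'a poly poly poly"
  where "emb_base a = [:[:[:a:]:]:]"

definition emb_y :: "'a::comm_ring_1 poly \<Rightarrow> 'a poly poly poly"
  where "emb_y a = [:[:a:]:]"

definition emb_yz :: "'a::comm_ring_1 poly poly \<Rightarrow> 'a poly poly poly"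
  where "emb_yz a = [:a:]"

text \<open>
  The \<open>A\<close>-automorphisms of \<open>A[y,z,u]\<close>; preservation of \<open>1\<close> is the last condition at \<open>c = 1\<close>.
\<close>

definition base_automorphism ::
    "('a::comm_ring_1 poly poly poly \<Rightarrow> 'a poly poly poly) \<Rightarrow> bool"
  where "base_automorphism \<phi> \<longleftrightarrow>
    bij \<phi> \<and>
    (\<forall>a b. \<phi> (a + b) = \<phi> a + \<phi> b) \<and>
    (\<forall>a b. \<phi> (a * b) = \<phi> a * \<phi> b) \<and>
    (\<forall>c. \<phi> (emb_base c) = emb_base c)"

definition is_variable :: "'a::comm_ring_1 poly poly poly \<Rightarrow> bool"
  where "is_variable p \<longleftrightarrow>
    (\<exists>\<phi>. base_automorphism \<phi> \<and> p \<in> {\<phi> var_y, \<phi> var_z, \<phi> var_u})"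

definition x_variable :: "complex poly poly poly poly \<Rightarrow> bool"
  where "x_variable p \<longleftrightarrow> is_variable p"

definition specialize_x :: "complex \<Rightarrow> complex poly poly poly poly \<Rightarrow> complex poly poly poly"
  where "specialize_x l p = map_poly (map_poly (map_poly (\<lambda>c. poly c l))) p"

definition residual_x_variable :: "complex poly poly poly poly \<Rightarrow> bool"
  where "residual_x_variable p \<longleftrightarrow> (\<forall>l. is_variable (specialize_x l p))"

text \<open>Below, the inner variable of \<open>complex poly poly\<close> is \<open>x\<close> and the outer one is \<open>y\<close>.\<close>

definition specialize_xy :: "complex \<Rightarrow> complex poly poly \<Rightarrow> complex poly"
  where "specialize_xy l f = map_poly (\<lambda>c. poly c l) f"

definition zero_set_xy :: "complex poly poly \<Rightarrow> (complex \<times> complex) set"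
  where "zero_set_xy f = {(x0, y0). poly (specialize_xy x0 f) y0 = 0}"

text \<open>
  The product of the distinct irreducible factors is determined up to a factor in \<open>\<complex>\<^sup>*\<close>;
  taking the normalized factors fixes that constant.
\<close>

definition red_poly :: "complex poly poly \<Rightarrow> complex poly poly"
  where "red_poly f = \<Prod>(prime_factors f)"

text \<open>
  The subalgebra \<open>A[y, h z]\<close> of \<open>A[y,z]\<close>, for \<open>h \<in> A[y]\<close>: its elements are \<open>P(y, h z)\<close>, the
  composition in the outer variable \<open>z\<close> of some \<open>P \<in> A[y][z]\<close> with \<open>h z\<close>.
\<close>

definition subalgebra_y_hz :: "'a::comm_ring_1 poly \<Rightarrow> 'a poly poly set"
  where "subalgebra_y_hz h = range (\<lambda>P. pcompose P [:0, h:])"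

end

theory Submission
  imports Defs "HOL-Analysis.Analysis"
begin

text \<open>
  Write \<open>A = \<complex>[x]\<close>, \<open>h\<close> for \<open>g1 \<in> A\<close>, \<open>\<eta>\<close> for the reduced polynomial of \<open>ft\<close>, and
  \<open>g2 z\<^sup>2 = \<kappa>(y, h z)\<close>. To show that \<open>p\<close> is an \<open>x\<close>-variable it is enough to find \<open>w1\<close>, \<open>w2\<close> with
  \<open>A[p, w1, w2] = A[y, z, u]\<close> (\<open>variable_if_generating\<close>). Such generators are built by
  \<^emph>\<open>dilations\<close>. If \<open>D t = b + a v + m K(v)\<close> with coefficients in a ring \<open>B\<close>, where \<open>a\<close> is a unit
  and \<open>m\<close> is nilpotent modulo \<open>D\<close>, then Hensel's lemma gives \<open>S \<in> B\<close> with \<open>v \<equiv> S\<close> modulo \<open>D\<close>, and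
  \<open>B[v, t] = B[w]\<close> for \<open>w = (v - S)/D\<close> (\<open>dilation\<close>). Hence adjoining the fraction \<open>t\<close> to a
  polynomial ring leaves a polynomial ring. When \<open>D \<in> A\<close>, the hypothesis means that for every root
  \<open>l\<close> of \<open>D\<close> the element \<open>D t\<close> is, on the fibre \<open>x = l\<close>, linear in \<open>v\<close> with constant nonzero leading
  coefficient (\<open>gen_dilation\<close>); the problem is to choose \<open>v\<close> so that this holds.

  \<^bold>\<open>The main case\<close> is \<open>q h r \<noteq> 0\<close>. Put \<open>s = h z\<close>, \<open>t = r u\<close>, and let
  \<open>W = ft t + s + \<eta> \<kappa>(y, s) + g0 y\<^sup>2\<close>, so that \<open>p = q W + a0 + a1 y\<close>. As \<open>\<eta>\<close> is nilpotent
  modulo \<open>ft\<close>, a dilation along \<open>ft\<close> gives \<open>A[y, s, t] = A[y, W, V]\<close> with \<open>s = S + ft V\<close>. On the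
  fibres with \<open>q = 0\<close> the variable \<open>p\<close> is \<open>a0 + a1 y\<close>, so \<open>a1\<close> and \<open>q\<close> are coprime and
  \<open>A[y, W, V] = A[p, y2, V]\<close>. What is left is to adjoin \<open>z = s/h\<close> and \<open>u = t/r\<close>, which concerns
  only the finitely many fibres over roots \<open>l\<close> of \<open>h r\<close>:

  \<^item> if \<open>h(l) = 0 \<noteq> q(l)\<close>, then \<open>ft(l, y)\<close> has no zeros, so it is constant and \<open>s = S + ft V\<close> is
    linear in \<open>V\<close>;
  \<^item> if \<open>ft(l, y) = 0\<close>, then \<open>\<eta>\<close> vanishes on the fibre too and \<open>t\<close> is an element of
    \<open>A[p, y2]\<close> minus \<open>V\<close>;
  \<^item> if \<open>r(l) = 0\<close> and \<open>q(l) h(l) ft(l, y) \<noteq> 0\<close>, then \<open>ft(l, y)\<close> is constant and \<open>p\<close> restricts to a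
    variable in \<open>y\<close> and \<open>z\<close> whose coefficient of \<open>z\<close> is a nonzero constant. By \<open>variable_shape\<close> it has the form
    \<open>c z + G(y - R(z))\<close>, and \<open>t\<close> becomes linear after the shear by \<open>R\<close>;
  \<^item> if \<open>q(l) = 0\<close> and \<open>ft(l, y) \<noteq> 0\<close>, then \<open>y\<close> is congruent to an element of \<open>A[p]\<close>. Over \<open>A[p]\<close> the
    passage from \<open>(W, V)\<close> to \<open>(s, t)\<close> is again a dilation, so it lifts to \<open>A\<close>
    (\<open>congruent_coordinates\<close>).

  The shears and constants needed at different roots are combined by the Chinese remainder theorem.
  A common root \<open>l\<close> of \<open>h\<close> and \<open>r\<close> with \<open>q(l) \<noteq> 0\<close> is excluded beforehand: there \<open>p\<close> restricts to a
  polynomial in \<open>y\<close>, which is linear, so \<open>g0(l, y) = 0\<close> and the factor \<open>x - l\<close> can be moved from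
  \<open>h\<close>, \<open>r\<close>, \<open>g0\<close> and \<open>\<kappa>\<close> into \<open>q\<close> (\<open>residual_nonzero\<close>). If \<open>q h = 0\<close>, then \<open>p = c u + G(y)\<close>, and one
  dilation over \<open>A[p, z]\<close> suffices. If \<open>r = 0\<close>, then \<open>p\<close> does not involve \<open>u\<close>, its generic fibre has
  the form \<open>c z + G(y - R(z))\<close> over \<open>\<complex>(x)\<close>, and two dilations clear the denominators
  (\<open>residual_plane\<close>).

  \<^bold>\<open>The shape of plane variables.\<close> Let \<open>g(y, z)\<close> be a variable of \<open>\<complex>[y, z, u]\<close>. Translating a
  coordinate of the automorphism moves the points of \<open>\<complex>\<^sup>2\<close> along polynomial curves inside the level
  sets of \<open>g\<close> (\<open>variable_level_curves\<close>). A scaling limit turns them into polynomial curves in the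
  level sets of the leading form of \<open>g\<close> along the steepest edge of its Newton polygon
  at the vertex \<open>y\<^sup>d\<close> (\<open>level_curve_degeneration\<close>). Therefore this form is a constant multiple of a power of
  \<open>z\<^sup>m - x y\<^sup>n\<close>, and \<open>m = 1\<close> or \<open>n = 1\<close>, as \<open>V\<^sup>m - x U\<^sup>n\<close> is never a nonzero constant for nonconstant
  \<open>U\<close>, \<open>V\<close> and \<open>m, n \<ge> 2\<close> (\<open>edge_single_root\<close>). If the coefficient of \<open>z\<close> in \<open>g\<close> is a nonzero constant, then
  \<open>m = 1\<close> leaves only \<open>c z + G(y)\<close>, and for \<open>n = 1\<close> a shear makes the polygon smaller.
\<close>

section \<open>Evaluation along ring homomorphisms\<close>

definition ring_hom :: "('a::comm_ring_1 \<Rightarrow> 'r::comm_ring_1) \<Rightarrow> bool"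
  where "ring_hom i \<longleftrightarrow> i 1 = 1 \<and> (\<forall>a b. i (a + b) = i a + i b) \<and> (\<forall>a b. i (a * b) = i a * i b)"

lemma ring_homD:
  assumes "ring_hom i"
  shows "i 1 = 1" "i (a + b) = i a + i b" "i (a * b) = i a * i b" "i 0 = 0"
    "i (- a) = - i a" "i (a - b) = i a - i b" "i (a ^ n) = i a ^ n"
proof -
  show *: "i 1 = 1" "\<And>a b. i (a + b) = i a + i b" "\<And>a b. i (a * b) = i a * i b"
    using assms by (auto simp: ring_hom_def)
  show 0: "i 0 = 0" using *(2)[of 0 0] by simp
  show m: "\<And>a. i (- a) = - i a" using *(2)[of _ "- _"] 0
    by (metis add.right_inverse add_eq_0_iff)
  show "i (a - b) = i a - i b" using *(2)[of a "- b"] m by simp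
  show "i (a ^ n) = i a ^ n" by (induction n) (auto simp: *)
qed

lemma ring_hom_sum:
  assumes "ring_hom i" shows "i (\<Sum>x\<in>S. f x) = (\<Sum>x\<in>S. i (f x))"
  by (induction S rule: infinite_finite_induct) (auto simp: ring_homD[OF assms])

lemma ring_hom_id: "ring_hom (\<lambda>x. x)"
  by (simp add: ring_hom_def)

lemma ring_hom_comp: "ring_hom i \<Longrightarrow> ring_hom j \<Longrightarrow> ring_hom (\<lambda>x. j (i x))"
  by (simp add: ring_hom_def)

text \<open>\<open>evp\<close>, \<open>ev2\<close> and \<open>ev3\<close> evaluate polynomials in one, two and three variables after mapping
  their coefficients along \<open>i\<close>. Evaluation at points, substitution in \<open>A[y, z, u]\<close> and specialization
  of \<open>x\<close> are all instances, so that \<open>evp_comp\<close> relates them to each other.\<close>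

definition evp :: "('a::comm_ring_1 \<Rightarrow> 'r::comm_ring_1) \<Rightarrow> 'a poly \<Rightarrow> 'r \<Rightarrow> 'r"
  where "evp i P x = poly (map_poly i P) x"

lemma evp_0 [simp]: "evp i 0 x = 0"
  by (simp add: evp_def)

lemma evp_pCons: "ring_hom i \<Longrightarrow> evp i (pCons a P) x = i a + x * evp i P x"
  by (simp add: evp_def map_poly_pCons ring_homD)

lemma evp_const: "ring_hom i \<Longrightarrow> evp i [:a:] x = i a"
  by (simp add: evp_pCons)

lemma evp_X: "ring_hom i \<Longrightarrow> evp i [:0, 1:] x = x"
  by (simp add: evp_pCons ring_homD)

lemma evp_add:
  assumes "ring_hom i"
  shows "evp i (P + Q) x = evp i P x + evp i Q x"
proof (induction P arbitrary: Q)
  case 0 then show ?case by simp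
next
  case (pCons a P)
  obtain b Q' where Q: "Q = pCons b Q'" by (cases Q)
  show ?case using pCons.IH[of Q']
    by (simp add: Q evp_pCons[OF assms] ring_homD[OF assms] algebra_simps)
qed

lemma evp_smult:
  assumes "ring_hom i"
  shows "evp i (smult a P) x = i a * evp i P x"
  by (induction P) (auto simp: evp_pCons[OF assms] ring_homD[OF assms] algebra_simps)

lemma evp_mult:
  assumes "ring_hom i"
  shows "evp i (P * Q) x = evp i P x * evp i Q x"
  by (induction P)
    (auto simp: evp_pCons[OF assms] evp_add[OF assms] evp_smult[OF assms] ring_homD[OF assms] algebra_simps)

lemma ring_hom_evp:
  assumes "ring_hom i" shows "ring_hom (\<lambda>P. evp i P x)"
  unfolding ring_hom_def
  by (auto simp: evp_add[OF assms] evp_mult[OF assms] one_pCons evp_const[OF assms] ring_homD[OF assms])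

lemma ring_hom_const: "ring_hom (\<lambda>c. [:c:])"
  by (auto simp: ring_hom_def)

lemma evp_comp:
  assumes "ring_hom i" "ring_hom j"
  shows "j (evp i P x) = evp (\<lambda>a. j (i a)) P (j x)"
  by (induction P)
    (auto simp: evp_pCons[OF assms(1)] evp_pCons[OF ring_hom_comp[OF assms]] ring_homD[OF assms(2)])

lemma evp_const_X: "evp (\<lambda>c. [:c:]) P [:0, 1:] = P"
  by (induction P) (auto simp: evp_pCons[OF ring_hom_const])

lemma evp_id: "evp (\<lambda>x. x) P x = poly P x"
  by (simp add: evp_def)

lemma map_poly_eq_evp:
  assumes "ring_hom i" shows "map_poly i P = evp (\<lambda>c. [:i c:]) P [:0, 1:]"
  by (induction P)
    (auto simp: map_poly_pCons ring_homD[OF assms] evp_pCons[OF ring_hom_comp[OF assms ring_hom_const]])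

lemma ring_hom_map_poly:
  assumes "ring_hom i" shows "ring_hom (map_poly i)"
  using ring_hom_evp[OF ring_hom_comp[OF assms ring_hom_const], of "[:0, 1:]"]
  by (simp add: map_poly_eq_evp[OF assms, abs_def])

lemma evp_map_poly:
  assumes "ring_hom i" "ring_hom j"
  shows "evp j (map_poly i P) x = evp (\<lambda>a. j (i a)) P x"
  using assms by (simp add: evp_def map_poly_map_poly ring_homD o_def)

definition ev2 :: "('a::comm_ring_1 \<Rightarrow> 'r::comm_ring_1) \<Rightarrow> 'a poly poly \<Rightarrow> 'r \<Rightarrow> 'r \<Rightarrow> 'r"
  where "ev2 i P a b = evp (\<lambda>c. evp i c a) P b"

definition ev3 :: "('a::comm_ring_1 \<Rightarrow> 'r::comm_ring_1) \<Rightarrow> 'a poly poly poly \<Rightarrow> 'r \<Rightarrow> 'r \<Rightarrow> 'r \<Rightarrow> 'r"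
  where "ev3 i P a b c = evp (\<lambda>q. ev2 i q a b) P c"

lemma ring_hom_ev2: "ring_hom i \<Longrightarrow> ring_hom (\<lambda>P. ev2 i P a b)"
  unfolding ev2_def by (intro ring_hom_evp)

lemma ring_hom_ev3: "ring_hom i \<Longrightarrow> ring_hom (\<lambda>P. ev3 i P a b c)"
  unfolding ev3_def by (intro ring_hom_evp ring_hom_ev2)

lemma ev2_comp:
  assumes "ring_hom i" "ring_hom j"
  shows "j (ev2 i P a b) = ev2 (\<lambda>a. j (i a)) P (j a) (j b)"
  unfolding ev2_def by (simp add: evp_comp[OF _ assms(2)] ring_hom_evp assms)

lemma ev3_comp:
  assumes "ring_hom i" "ring_hom j"
  shows "j (ev3 i P a b c) = ev3 (\<lambda>a. j (i a)) P (j a) (j b) (j c)"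
  unfolding ev3_def
  by (simp add: evp_comp[OF _ assms(2)] ev2_comp[OF assms] ring_hom_ev2 assms)

lemma ring_hom_emb_base: "ring_hom emb_base"
  unfolding emb_base_def by (auto simp: ring_hom_def one_pCons)

lemma ring_hom_emb_y: "ring_hom emb_y"
  unfolding emb_y_def by (auto simp: ring_hom_def one_pCons)

lemma ring_hom_emb_yz: "ring_hom emb_yz"
  unfolding emb_yz_def by (auto simp: ring_hom_def)

lemma ev3_emb_y:
  assumes "ring_hom i" shows "ev3 i (emb_y P) a b c = evp i P a"
  by (simp add: ev3_def ev2_def emb_y_def evp_const ring_hom_evp ring_hom_ev2[unfolded ev2_def] assms)

lemma ev3_emb_yz:
  assumes "ring_hom i" shows "ev3 i (emb_yz P) a b c = ev2 i P a b"
  by (simp add: ev3_def emb_yz_def evp_const ring_hom_ev2 assms)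

lemma ev3_emb_base:
  assumes "ring_hom i" shows "ev3 i (emb_base P) a b c = i P"
  by (simp add: ev3_def ev2_def emb_base_def evp_const ring_hom_evp ring_hom_ev2[unfolded ev2_def] assms)

lemma ev3_vars:
  assumes "ring_hom i"
  shows "ev3 i var_y a b c = a" "ev3 i var_z a b c = b" "ev3 i var_u a b c = c"
  by (simp_all add: ev3_def ev2_def var_y_def var_z_def var_u_def evp_const evp_X
    ring_hom_evp ring_hom_ev2[unfolded ev2_def] assms)

lemma evp_emb_base: "evp emb_base P var_y = emb_y P"
proof -
  have "emb_y (evp (\<lambda>c. [:c:]) P [:0, 1:]) = evp (\<lambda>a. emb_y [:a:]) P (emb_y [:0, 1:])"
    by (rule evp_comp[OF ring_hom_const ring_hom_emb_y])
  then show ?thesis unfolding evp_const_X by (simp add: emb_y_def emb_base_def[abs_def] var_y_def)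
qed

lemma ev2_emb_base: "ev2 emb_base P var_y var_z = emb_yz P"
proof -
  have "emb_yz (evp (\<lambda>c. [:c:]) P [:0, 1:]) = evp (\<lambda>a. emb_yz [:a:]) P (emb_yz [:0, 1:])"
    by (rule evp_comp[OF ring_hom_const ring_hom_emb_yz])
  then show ?thesis unfolding evp_const_X
    by (simp add: emb_yz_def ev2_def emb_y_def evp_emb_base var_z_def)
qed

lemma ev3_self: "ev3 emb_base P var_y var_z var_u = P"
  using evp_const_X[of P] by (simp add: ev3_def ev2_emb_base emb_yz_def[abs_def] var_u_def)

text \<open>Homomorphisms out of \<open>A[y, z, u]\<close> are determined by their values on \<open>A\<close> and on the variables.\<close>

lemma hom_eq_ev3:
  assumes "ring_hom \<phi>"
  shows "\<phi> P = ev3 (\<lambda>a. \<phi> (emb_base a)) P (\<phi> var_y) (\<phi> var_z) (\<phi> var_u)"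
  using ev3_comp[OF ring_hom_emb_base assms, of P var_y var_z var_u] by (simp add: ev3_self)

section \<open>Subrings and congruences\<close>

definition subring :: "'r::comm_ring_1 set \<Rightarrow> bool"
  where "subring S \<longleftrightarrow> 1 \<in> S \<and> (\<forall>a\<in>S. \<forall>b\<in>S. a - b \<in> S) \<and> (\<forall>a\<in>S. \<forall>b\<in>S. a * b \<in> S)"

lemma subringD:
  assumes "subring S"
  shows "1 \<in> S" "0 \<in> S" "a \<in> S \<Longrightarrow> b \<in> S \<Longrightarrow> a - b \<in> S" "a \<in> S \<Longrightarrow> b \<in> S \<Longrightarrow> a * b \<in> S"
    "a \<in> S \<Longrightarrow> - a \<in> S" "a \<in> S \<Longrightarrow> b \<in> S \<Longrightarrow> a + b \<in> S" "a \<in> S \<Longrightarrow> a ^ n \<in> S"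
proof -
  show 1: "1 \<in> S" and d: "\<And>a b. a \<in> S \<Longrightarrow> b \<in> S \<Longrightarrow> a - b \<in> S"
    and m: "\<And>a b. a \<in> S \<Longrightarrow> b \<in> S \<Longrightarrow> a * b \<in> S"
    using assms by (auto simp: subring_def)
  show 0: "0 \<in> S" using d[OF 1 1] by simp
  show n: "\<And>a. a \<in> S \<Longrightarrow> - a \<in> S" using d[OF 0] by fastforce
  show "a \<in> S \<Longrightarrow> b \<in> S \<Longrightarrow> a + b \<in> S" using d[OF _ n] by fastforce
  show "a \<in> S \<Longrightarrow> a ^ n \<in> S" by (induction n) (auto simp: 1 m)
qed

lemma subring_sum: "subring S \<Longrightarrow> (\<And>x. x \<in> I \<Longrightarrow> f x \<in> S) \<Longrightarrow> (\<Sum>x\<in>I. f x) \<in> S"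
  by (induction I rule: infinite_finite_induct) (auto simp: subringD)

text \<open>The subring generated by \<open>X\<close>. Differences and products suffice, as \<open>0 = 1 - 1\<close> and \<open>a + b = a - (0 - b)\<close>.\<close>

inductive_set rhull :: "'r::comm_ring_1 set \<Rightarrow> 'r set" for X where
  rhull_incl: "x \<in> X \<Longrightarrow> x \<in> rhull X"
| rhull_one: "1 \<in> rhull X"
| rhull_diff: "a \<in> rhull X \<Longrightarrow> b \<in> rhull X \<Longrightarrow> a - b \<in> rhull X"
| rhull_mult: "a \<in> rhull X \<Longrightarrow> b \<in> rhull X \<Longrightarrow> a * b \<in> rhull X"

lemma subring_rhull [simp]: "subring (rhull X)"
  by (auto simp: subring_def intro: rhull.intros)

lemma rhull_least: "X \<subseteq> S \<Longrightarrow> subring S \<Longrightarrow> rhull X \<subseteq> S"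
proof
  fix a assume X: "X \<subseteq> S" "subring S" and "a \<in> rhull X"
  from this(3) show "a \<in> S" by induction (use X in \<open>auto simp: subringD\<close>)
qed

lemma rhull_superset: "X \<subseteq> rhull X"
  by (auto intro: rhull_incl)

lemma rhull_mono: "X \<subseteq> Y \<Longrightarrow> rhull X \<subseteq> rhull Y"
  by (meson rhull_least rhull_superset subring_rhull subset_trans)

lemma rhull_subset_iff: "rhull X \<subseteq> rhull Y \<longleftrightarrow> X \<subseteq> rhull Y"
  by (meson rhull_least rhull_superset subring_rhull subset_trans)

lemma rhull_insert_rhull: "rhull (insert v (rhull X)) = rhull (insert v X)"
proof
  show "rhull (insert v (rhull X)) \<subseteq> rhull (insert v X)"
    unfolding rhull_subset_iff using rhull_mono[of X "insert v X"] by (auto intro: rhull_incl)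
  show "rhull (insert v X) \<subseteq> rhull (insert v (rhull X))"
    unfolding rhull_subset_iff by (auto intro: rhull_incl)
qed

definition coeffs_in :: "'r::comm_ring_1 set \<Rightarrow> 'r poly \<Rightarrow> bool"
  where "coeffs_in S P \<longleftrightarrow> (\<forall>n. coeff P n \<in> S)"

lemma coeffs_in_pCons: "coeffs_in S (pCons a P) \<longleftrightarrow> a \<in> S \<and> coeffs_in S P"
  by (auto simp: coeffs_in_def coeff_pCons split: nat.splits)

lemma coeffs_in_0: "subring S \<Longrightarrow> coeffs_in S 0"
  by (auto simp: coeffs_in_def subringD)

lemma coeffs_in_mono: "coeffs_in S P \<Longrightarrow> S \<subseteq> T \<Longrightarrow> coeffs_in T P"
  by (auto simp: coeffs_in_def)

lemma poly_in_subring: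
  assumes "subring S" "x \<in> S" shows "coeffs_in S P \<Longrightarrow> poly P x \<in> S"
  by (induction P) (auto simp: coeffs_in_pCons subringD assms)

lemma coeffs_in_diff: "subring S \<Longrightarrow> coeffs_in S P \<Longrightarrow> coeffs_in S Q \<Longrightarrow> coeffs_in S (P - Q)"
  by (auto simp: coeffs_in_def subringD)

lemma coeffs_in_mult: "subring S \<Longrightarrow> coeffs_in S P \<Longrightarrow> coeffs_in S Q \<Longrightarrow> coeffs_in S (P * Q)"
  by (auto simp: coeffs_in_def coeff_mult intro!: subring_sum subringD)

lemma rhull_insert_poly:
  assumes "subring B" "a \<in> rhull (insert v B)"
  shows "\<exists>P. coeffs_in B P \<and> a = poly P v"
  using assms(2)
proof induction
  case (rhull_incl x)
  then show ?case
  proof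
    assume "x = v"
    then show ?thesis using assms(1)
      by (intro exI[of _ "[:0, 1:]"]) (auto simp: coeffs_in_pCons coeffs_in_0 subringD)
  next
    assume "x \<in> B"
    then show ?thesis using assms(1)
      by (intro exI[of _ "[:x:]"]) (auto simp: coeffs_in_pCons coeffs_in_0 subringD)
  qed
next
  case rhull_one
  then show ?case using assms(1)
    by (intro exI[of _ "1"]) (auto simp: one_pCons coeffs_in_pCons coeffs_in_0 subringD)
next
  case (rhull_diff a b)
  then show ?case using assms(1) by (metis coeffs_in_diff poly_diff)
next
  case (rhull_mult a b)
  then show ?case using assms(1) by (metis coeffs_in_mult poly_mult)
qed

lemma poly_diff_factor:
  assumes "subring S" "a \<in> S" "b \<in> S"
  shows "coeffs_in S P \<Longrightarrow> \<exists>k\<in>S. poly P a - poly P b = (a - b) * k"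
proof (induction P)
  case 0 then show ?case using assms by (intro bexI[of _ 0]) (auto simp: subringD)
next
  case (pCons c P)
  then obtain k where k: "k \<in> S" "poly P a - poly P b = (a - b) * k"
    by (auto simp: coeffs_in_pCons)
  have "poly P b \<in> S" using pCons.prems assms by (auto simp: coeffs_in_pCons intro: poly_in_subring)
  moreover have "poly (pCons c P) a - poly (pCons c P) b = (a - b) * (poly P b + a * k)"
  proof -
    have 1: "poly P a = poly P b + (a - b) * k" using k(2) by (simp add: algebra_simps)
    show ?thesis unfolding poly_pCons 1 by (simp add: algebra_simps)
  qed
  ultimately show ?case using k assms by (intro bexI[of _ "poly P b + a * k"]) (auto simp: subringD)
qed

text \<open>The witness lies in \<open>S\<close>: in the applications the ambient ring contains fractions of
  elements of \<open>S\<close>, and congruence there would say less.\<close>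

definition cong_in :: "'r::comm_ring_1 set \<Rightarrow> 'r \<Rightarrow> 'r \<Rightarrow> 'r \<Rightarrow> bool"
  where "cong_in S m a b \<longleftrightarrow> (\<exists>e\<in>S. a - b = m * e)"

lemma cong_in_refl: "subring S \<Longrightarrow> cong_in S m a a"
  by (auto simp: cong_in_def subringD intro: bexI[of _ 0])

lemma cong_in_sym: "subring S \<Longrightarrow> cong_in S m a b \<Longrightarrow> cong_in S m b a"
  unfolding cong_in_def by (metis minus_diff_eq mult_minus_right subringD(5))

lemma cong_in_trans: "subring S \<Longrightarrow> cong_in S m a b \<Longrightarrow> cong_in S m b c \<Longrightarrow> cong_in S m a c"
proof -
  assume S: "subring S" "cong_in S m a b" "cong_in S m b c"
  then obtain e f where "e \<in> S" "a - b = m * e" "f \<in> S" "b - c = m * f" by (auto simp: cong_in_def)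
  moreover then have "a - c = m * (e + f)" by (simp add: algebra_simps)
  ultimately show ?thesis using S by (auto simp: cong_in_def subringD)
qed

lemma cong_in_add:
  assumes "subring S" "cong_in S m a b" "cong_in S m c d" shows "cong_in S m (a + c) (b + d)"
proof -
  obtain e f where "e \<in> S" "a - b = m * e" "f \<in> S" "c - d = m * f"
    using assms by (auto simp: cong_in_def)
  moreover then have "(a + c) - (b + d) = m * (e + f)" by (simp add: algebra_simps)
  ultimately show ?thesis using assms by (auto simp: cong_in_def subringD)
qed

lemma cong_in_diff:
  assumes "subring S" "cong_in S m a b" "cong_in S m c d" shows "cong_in S m (a - c) (b - d)"
proof -
  obtain e f where "e \<in> S" "a - b = m * e" "f \<in> S" "c - d = m * f"
    using assms by (auto simp: cong_in_def)
  moreover then have "(a - c) - (b - d) = m * (e - f)" by (simp add: algebra_simps)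
  ultimately show ?thesis using assms by (auto simp: cong_in_def subringD)
qed

lemma cong_in_mult:
  assumes "subring S" "cong_in S m a b" "cong_in S m c d" "a \<in> S" "d \<in> S"
  shows "cong_in S m (a * c) (b * d)"
proof -
  obtain e f where "e \<in> S" "a - b = m * e" "f \<in> S" "c - d = m * f"
    using assms by (auto simp: cong_in_def)
  moreover then have "a * c - b * d = m * (a * f + e * d)"
  proof -
    have "a * c - b * d = a * (c - d) + (a - b) * d" by (simp add: algebra_simps)
    then show ?thesis using \<open>a - b = m * e\<close> \<open>c - d = m * f\<close> by (simp add: algebra_simps)
  qed
  ultimately show ?thesis using assms by (auto simp: cong_in_def subringD)
qed

lemma cong_in_power:
  assumes "subring S" "cong_in S m a b" "a \<in> S" "b \<in> S"
  shows "cong_in S m (a ^ n) (b ^ n)"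
  by (induction n) (auto simp: cong_in_refl cong_in_mult assms subringD)

lemma cong_in_mono: "cong_in S m a b \<Longrightarrow> S \<subseteq> T \<Longrightarrow> cong_in T m a b"
  by (auto simp: cong_in_def)

lemma cong_in_poly:
  assumes "subring S" "cong_in S m a b" "a \<in> S" "b \<in> S"
  shows "coeffs_in S P \<Longrightarrow> coeffs_in S Q \<Longrightarrow> (\<And>n. cong_in S m (coeff P n) (coeff Q n)) \<Longrightarrow>
    cong_in S m (poly P a) (poly Q b)"
proof (induction P arbitrary: Q)
  case 0
  have "coeffs_in S Q \<Longrightarrow> (\<And>n. cong_in S m 0 (coeff Q n)) \<Longrightarrow> cong_in S m 0 (poly Q b)"
  proof (induction Q)
    case 0 then show ?case by (simp add: cong_in_refl assms)
  next
    case (pCons c Q)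
    have "cong_in S m 0 c" using pCons.prems(2)[of 0] by simp
    moreover have "cong_in S m 0 (coeff Q n)" for n using pCons.prems(2)[of "Suc n"] by simp
    moreover have "poly Q b \<in> S" using assms pCons.prems by (auto intro: poly_in_subring simp: coeffs_in_pCons)
    ultimately have "cong_in S m (0 + a * 0) (c + b * poly Q b)"
      using assms pCons
      by (intro cong_in_add cong_in_mult) (auto simp: coeffs_in_pCons)
    then show ?case by simp
  qed
  then show ?case using 0 by simp
next
  case (pCons c P)
  obtain c' Q' where Q: "Q = pCons c' Q'" by (cases Q)
  have "cong_in S m c c'" using pCons.prems(3)[of 0] by (simp add: Q)
  moreover have "cong_in S m (coeff P n) (coeff Q' n)" for n
    using pCons.prems(3)[of "Suc n"] by (simp add: Q)
  moreover have "poly Q' b \<in> S" using assms pCons.prems by (auto intro: poly_in_subring simp: Q coeffs_in_pCons)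
  ultimately show ?case using assms pCons
    by (auto simp: Q coeffs_in_pCons intro!: cong_in_add cong_in_mult)
qed

section \<open>Dilations of polynomial rings\<close>

text \<open>The fixed point iteration for the equation \<open>b + a S + m K(S) = 0\<close>, where \<open>a'\<close> is an inverse of \<open>a\<close>
  modulo \<open>D\<close> and \<open>m\<close> is nilpotent modulo \<open>D\<close>. Keeping it explicit makes the solution compatible with
  congruences of the data (\<open>hensel_iter_cong\<close>).\<close>

fun hensel_iter :: "'r::comm_ring_1 \<Rightarrow> 'r \<Rightarrow> 'r \<Rightarrow> 'r poly \<Rightarrow> nat \<Rightarrow> 'r" where
  "hensel_iter a' b m K 0 = 0"
| "hensel_iter a' b m K (Suc j) = - a' * (b + m * poly K (hensel_iter a' b m K j))"

lemma hensel_iter_in: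
  assumes "subring B" "a' \<in> B" "b \<in> B" "m \<in> B" "coeffs_in B K"
  shows "hensel_iter a' b m K j \<in> B"
  by (induction j) (use assms in \<open>auto intro!: subringD(4,5,6)[OF assms(1)] poly_in_subring intro: subringD\<close>)

text \<open>One step of the iteration multiplies the error by a multiple of \<open>m\<close>, up to multiples of \<open>D\<close>.\<close>

lemma hensel_iter_residue:
  assumes B: "subring B" and mem: "a \<in> B" "a' \<in> B" "b \<in> B" "m \<in> B" "D \<in> B" "d \<in> B" "coeffs_in B K"
    and unit: "a * a' = 1 + D * d"
  shows "\<exists>e\<in>B. \<exists>f\<in>B. b + a * hensel_iter a' b m K j + m * poly K (hensel_iter a' b m K j) = m ^ j * e + D * f"
proof (induction j)
  case 0
  have "b + a * 0 + m * poly K 0 \<in> B"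
    using B mem poly_in_subring[OF B subringD(2)[OF B] mem(7)] by (intro subringD(4,6)[OF B]) (auto simp: subringD)
  then show ?case using B by (intro bexI[of _ "b + a * 0 + m * poly K 0"] bexI[of _ 0]) (auto simp: subringD)
next
  case (Suc j)
  define S where "S = hensel_iter a' b m K j"
  define S' where "S' = hensel_iter a' b m K (Suc j)"
  define E where "E = b + a * S + m * poly K S"
  obtain e f where ef: "e \<in> B" "f \<in> B" "E = m ^ j * e + D * f" using Suc by (auto simp: E_def S_def)
  have S: "S \<in> B" and S': "S' \<in> B" using hensel_iter_in B mem by (auto simp: S_def S'_def simp del: hensel_iter.simps)
  have E: "E \<in> B" using ef B mem by (auto simp: subringD)
  have "S' = - a' * (E - a * S)" by (simp add: S'_def E_def S_def)
  also have "\<dots> = - a' * E + (a * a') * S" by (simp add: algebra_simps)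
  also have "\<dots> = S - a' * E + D * d * S" unfolding unit by (simp add: algebra_simps)
  finally have dS: "S' = S + (D * d * S - a' * E)" by simp
  obtain k where k: "k \<in> B" "poly K S' - poly K S = (S' - S) * k"
    using poly_diff_factor[OF B S' S mem(7)] by blast
  have K: "poly K S' = poly K S + (D * d * S - a' * E) * k"
  proof -
    have "S' - S = D * d * S - a' * E" using dS by simp
    then show ?thesis using k(2) by (simp add: diff_eq_eq)
  qed
  have "b + a * S' + m * poly K S' = E + a * (D * d * S) - (a * a') * E + m * ((D * d * S - a' * E) * k)"
    unfolding K by (subst dS) (simp add: E_def algebra_simps)
  also have "\<dots> = D * (a * d * S - d * E + m * d * S * k) - m * a' * k * E"
    unfolding unit by (simp add: algebra_simps)
  also have "\<dots> = m ^ Suc j * (- a' * k * e) + D * (a * d * S - d * E + m * d * S * k - m * a' * k * f)"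
    unfolding ef(3) by (simp add: algebra_simps)
  finally have "b + a * S' + m * poly K S' = m ^ Suc j * (- a' * k * e) + D * (a * d * S - d * E + m * d * S * k - m * a' * k * f)" .
  moreover have "- a' * k * e \<in> B" "a * d * S - d * E + m * d * S * k - m * a' * k * f \<in> B"
    using B mem k(1) ef(1,2) S E by (auto intro!: subringD(3-6)[OF B])
  ultimately show ?case unfolding S'_def by blast
qed

text \<open>Subtracting the equations for \<open>v\<close> and for \<open>S\<close> gives \<open>D (t - c0) = (v - S) (a + m k)\<close>, and
  \<open>a + m k\<close> is invertible modulo \<open>D\<close> since \<open>m\<close> is nilpotent there. So \<open>D\<close> divides \<open>v - S\<close> in \<open>B[v, t]\<close>.
  Any solution \<open>S\<close> modulo \<open>D\<close> may be used; the freedom of choosing it is needed later.\<close>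

lemma dilation:
  fixes D :: "'r::idom"
  assumes B: "subring B" and mem: "a \<in> B" "a' \<in> B" "m \<in> B" "D \<in> B" "d \<in> B" "c \<in> B"
      "S \<in> B" "c0 \<in> B" "coeffs_in B K"
    and D: "D \<noteq> 0"
    and unit: "a * a' = 1 + D * d"
    and nilp: "m ^ n = D * c"
    and eq: "D * t = b + a * v + m * poly K v"
    and root: "b + a * S + m * poly K S = D * c0"
  shows "\<exists>w. v = S + D * w \<and> rhull (insert w B) = rhull (insert v (insert t B))"
proof -
  let ?R = "rhull (insert v (insert t B))"
  have R: "subring ?R" by simp
  have BR: "B \<subseteq> ?R" by (auto intro: rhull_incl)
  have vR: "v \<in> ?R" and tR: "t \<in> ?R" by (auto intro: rhull_incl)
  have Bv: "B \<subseteq> rhull (insert v B)" "v \<in> rhull (insert v B)" by (auto intro: rhull_incl)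
  obtain k where k: "k \<in> rhull (insert v B)" "poly K v - poly K S = (v - S) * k"
    using poly_diff_factor[of "rhull (insert v B)" v S K] Bv mem coeffs_in_mono[OF mem(9) Bv(1)] by auto
  have kR: "k \<in> ?R" using k(1) rhull_mono[of "insert v B" "insert v (insert t B)"] by blast
  have e1: "D * (t - c0) = (v - S) * (a + m * k)"
  proof -
    have "D * (t - c0) = a * (v - S) + m * (poly K v - poly K S)"
      using eq root by (simp add: algebra_simps)
    then show ?thesis unfolding k(2) by (simp add: algebra_simps)
  qed
  define N where "N = - (a' * m * k)"
  have NR: "N \<in> ?R" using mem BR kR R unfolding N_def by (auto intro!: subringD(4,5)[OF R])
  have e2: "(v - S) * (1 - N) = D * (a' * (t - c0) - d * (v - S))"
  proof -
    have "D * (a' * (t - c0)) = (v - S) * (a * a' + a' * m * k)"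
      using e1 by (metis (no_types, lifting) distrib_left mult.assoc mult.commute)
    then show ?thesis unfolding unit N_def by (simp add: algebra_simps)
  qed
  \<comment> \<open>\<open>1 - N\<close> is invertible modulo \<open>D\<close> because \<open>N\<close> is nilpotent modulo \<open>D\<close>.\<close>
  have geo: "(1 - N) * (\<Sum>i<n. N ^ i) = 1 - N ^ n" by (simp add: one_diff_power_eq)
  have sR: "(\<Sum>i<n. N ^ i) \<in> ?R" using NR R by (auto intro!: subring_sum subringD(7))
  have Nn: "N ^ n = D * ((- 1) ^ n * a' ^ n * k ^ n * c)"
  proof -
    have "N ^ n = (- 1) ^ n * a' ^ n * k ^ n * m ^ n"
      unfolding N_def power_minus[of "a' * m * k"] power_mult_distrib by (simp only: mult_ac)
    then show ?thesis by (simp add: nilp algebra_simps)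
  qed
  define w where "w = (a' * (t - c0) - d * (v - S)) * (\<Sum>i<n. N ^ i) + ((- 1) ^ n * a' ^ n * k ^ n * c) * (v - S)"
  have "v - S = (v - S) * (1 - N) * (\<Sum>i<n. N ^ i) + N ^ n * (v - S)"
    unfolding mult.assoc geo by (simp add: algebra_simps)
  also have "\<dots> = D * w" unfolding e2 Nn w_def by (simp add: algebra_simps)
  finally have vw: "v = S + D * w" by (simp add: algebra_simps)
  have one: "(- 1) ^ n \<in> ?R" using R by (auto intro!: subringD(7)[OF R] simp: subringD(5)[OF R subringD(1)[OF R]])
  have wR: "w \<in> ?R"
    unfolding w_def using mem BR kR R sR vR tR one
    by (intro subringD(6)[OF R] subringD(4)[OF R] subringD(3)[OF R] subringD(7)[OF R, of a'] subringD(7)[OF R, of k]) auto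
  have "rhull (insert w B) \<subseteq> ?R"
    unfolding rhull_subset_iff using wR BR by auto
  moreover have "?R \<subseteq> rhull (insert w B)"
  proof -
    let ?W = "rhull (insert w B)"
    have W: "subring ?W" by simp
    have BW: "B \<subseteq> ?W" "w \<in> ?W" by (auto intro: rhull_incl)
    have vW: "v \<in> ?W" unfolding vw using mem BW by (intro subringD(6)[OF W] subringD(4)[OF W]) auto
    then have "rhull (insert v B) \<subseteq> ?W" unfolding rhull_subset_iff using BW by auto
    then have kW: "k \<in> ?W" using k(1) by auto
    have "D * (t - c0) = D * (w * (a + m * k))" unfolding e1 vw by (simp add: algebra_simps)
    then have "t - c0 = w * (a + m * k)" using D mult_left_cancel by blast
    then have "t = c0 + w * (a + m * k)" by (simp add: algebra_simps)
    then have "t \<in> ?W" using mem BW kW by (auto intro!: subringD(4,6)[OF W])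
    then show ?thesis unfolding rhull_subset_iff using vW BW by auto
  qed
  ultimately show ?thesis using vw by blast
qed

text \<open>Subtracting the equations for \<open>v\<close> and for \<open>S\<close> gives \<open>D (t - c0) = (v - S) (a + m k)\<close>, and
  \<open>a + m k\<close> is invertible modulo \<open>D\<close> since \<open>m\<close> is nilpotent there. So \<open>D\<close> divides \<open>v - S\<close> in \<open>B[v, t]\<close>.
  Any solution \<open>S\<close> modulo \<open>D\<close> may be used; the freedom of choosing it is needed later.\<close>

lemma dilation_exists:
  fixes D :: "'r::idom"
  assumes B: "subring B" and mem: "a \<in> B" "a' \<in> B" "m \<in> B" "D \<in> B" "d \<in> B" "c \<in> B" "b \<in> B" "coeffs_in B K"
    and D: "D \<noteq> 0"
    and unit: "a * a' = 1 + D * d"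
    and nilp: "m ^ n = D * c"
    and eq: "D * t = b + a * v + m * poly K v"
  obtains S c0 w where "S \<in> B" "c0 \<in> B" "b + a * S + m * poly K S = D * c0"
    "v = S + D * w" "rhull (insert w B) = rhull (insert v (insert t B))"
proof -
  define S where "S = hensel_iter a' b m K n"
  have S: "S \<in> B" using hensel_iter_in B mem by (auto simp: S_def)
  obtain e f where ef: "e \<in> B" "f \<in> B" "b + a * S + m * poly K S = m ^ n * e + D * f"
    using hensel_iter_residue[OF B mem(1,2,7,3,4,5,8) unit, of n] by (auto simp: S_def)
  then have r: "b + a * S + m * poly K S = D * (c * e + f)" "c * e + f \<in> B"
    using B mem by (auto simp: nilp algebra_simps subringD)
  show ?thesis
    using dilation[OF B mem(1-6) S r(2) mem(8) D unit nilp eq r(1)] that[OF S r(2) r(1)] by blast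
qed

section \<open>Chinese remainders over the line\<close>

text \<open>A common factor of positive degree has a root.\<close>

lemma complex_coprime_iff:
  fixes P Q :: "complex poly"
  shows "coprime P Q \<longleftrightarrow> (\<forall>x. \<not> (poly P x = 0 \<and> poly Q x = 0))"
proof
  assume c: "coprime P Q"
  show "\<forall>x. \<not> (poly P x = 0 \<and> poly Q x = 0)"
  proof (intro allI notI)
    fix x assume "poly P x = 0 \<and> poly Q x = 0"
    then have "[:-x, 1:] dvd P" "[:-x, 1:] dvd Q" by (auto simp: poly_eq_0_iff_dvd)
    then have "is_unit [:-x, 1:]" using c coprime_common_divisor by blast
    then show False by (simp add: is_unit_iff_degree)
  qed
next
  assume n: "\<forall>x. \<not> (poly P x = 0 \<and> poly Q x = 0)"
  show "coprime P Q"
  proof (rule ccontr)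
    assume "\<not> coprime P Q"
    then obtain g where g: "g dvd P" "g dvd Q" "\<not> is_unit g" by (auto simp: coprime_def)
    have "g \<noteq> 0" using g n by auto
    then have "\<not> constant (poly g)" using g(3) by (simp add: constant_degree is_unit_iff_degree)
    then obtain x where "poly g x = 0" using fundamental_theorem_of_algebra by blast
    then show False using g n by (auto elim!: dvdE)
  qed
qed

lemma complex_bezout:
  fixes P Q :: "complex poly"
  assumes "\<And>x. poly P x = 0 \<Longrightarrow> poly Q x \<noteq> 0"
  obtains U V where "P * U + Q * V = 1"
proof -
  have "coprime P Q" using assms by (auto simp: complex_coprime_iff)
  then show ?thesis
    using that[of "fst (bezout_coefficients P Q)" "snd (bezout_coefficients P Q)"]
      bezout_coefficients_fst_snd[of P Q] by (simp add: mult.commute)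
qed

definition lin_prod :: "complex set \<Rightarrow> complex poly"
  where "lin_prod Z = (\<Prod>l\<in>Z. [:-l, 1:])"

lemma poly_lin_prod: "finite Z \<Longrightarrow> poly (lin_prod Z) x = 0 \<longleftrightarrow> x \<in> Z"
  by (auto simp: lin_prod_def poly_prod)

lemma lin_prod_dvd:
  assumes "finite Z" "\<And>l. l \<in> Z \<Longrightarrow> poly P l = 0"
  shows "lin_prod Z dvd P"
  using assms
proof (induction Z arbitrary: P)
  case empty then show ?case by (simp add: lin_prod_def)
next
  case (insert l Z)
  then have "[:-l, 1:] dvd P" using poly_eq_0_iff_dvd by blast
  then obtain P' where P': "P = [:-l, 1:] * P'" by (elim dvdE)
  have "poly P' x = 0" if "x \<in> Z" for x
    using insert.prems[of x] insert.hyps that unfolding P' by auto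
  then have "lin_prod Z dvd P'" using insert.IH by blast
  then show ?case using insert.hyps unfolding P' lin_prod_def by (simp add: mult_dvd_mono del: mult_pCons_left)
qed

lemma dvd_lin_prod_power:
  fixes P :: "complex poly"
  assumes "P \<noteq> 0" "finite Z" "\<And>l. poly P l = 0 \<Longrightarrow> l \<in> Z"
  shows "P dvd lin_prod Z ^ degree P"
proof -
  have f: "finite {z. poly P z = 0}" using assms(1) by (rule poly_roots_finite)
  have "P = smult (lead_coeff P) (\<Prod>z | poly P z = 0. [:-z, 1:] ^ order z P)"
    by (rule complex_poly_decompose[symmetric])
  also have "\<dots> dvd (\<Prod>z | poly P z = 0. [:-z, 1:] ^ order z P)"
    using assms(1) by (intro smult_dvd) auto
  also have "\<dots> dvd (\<Prod>z | poly P z = 0. [:-z, 1:] ^ degree P)"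
    by (intro prod_dvd_prod le_imp_power_dvd order_degree assms(1))
  also have "\<dots> dvd (\<Prod>z\<in>Z. [:-z, 1:] ^ degree P)"
    using assms by (intro prod_dvd_prod_subset) auto
  also have "\<dots> = lin_prod Z ^ degree P" by (simp add: lin_prod_def prod_power_distrib)
  finally show ?thesis .
qed

definition lagrange :: "complex set \<Rightarrow> complex \<Rightarrow> complex poly"
  where "lagrange Z l = (\<Prod>m\<in>Z - {l}. smult (1 / (l - m)) [:-m, 1:])"

lemma poly_lagrange:
  assumes "finite Z" "l \<in> Z" "x \<in> Z" shows "poly (lagrange Z l) x = (if x = l then 1 else 0)"
proof (cases "x = l")
  case True
  have "poly (lagrange Z l) x = (\<Prod>m\<in>Z - {l}. 1)"
    unfolding lagrange_def poly_prod by (rule prod.cong) (auto simp: True field_simps)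
  then show ?thesis by (simp add: True)
next
  case False
  then show ?thesis using assms unfolding lagrange_def poly_prod by (auto intro!: bexI[of _ x])
qed

abbreviation over :: "complex poly poly poly poly set \<Rightarrow> bool"
  where "over S \<equiv> subring S \<and> range emb_base \<subseteq> S"

abbreviation pix :: "complex \<Rightarrow> complex poly poly poly poly"
  where "pix l \<equiv> emb_base [:-l, 1:]"

lemma emb_base_simps:
  "emb_base (a + b) = emb_base a + emb_base b" "emb_base (a - b) = emb_base a - emb_base b"
  "emb_base (a * b) = emb_base a * emb_base b" "emb_base (- a) = - emb_base a"
  "emb_base (a ^ n) = emb_base a ^ n" "emb_base 0 = 0" "emb_base 1 = 1"
  by (auto simp: ring_homD[OF ring_hom_emb_base])

lemma emb_base_eq_0_iff [simp]: "emb_base c = 0 \<longleftrightarrow> c = 0"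
  by (simp add: emb_base_def)

text \<open>The Lagrange polynomials are orthogonal idempotents modulo the product of the \<open>x - l\<close>, and they sum to \<open>1\<close>.\<close>

lemma cong_in_lin_prod:
  assumes "over S" "finite Z" "a \<in> S" "b \<in> S" "\<And>l. l \<in> Z \<Longrightarrow> cong_in S (pix l) a b"
  shows "cong_in S (emb_base (lin_prod Z)) a b"
proof -
  have S: "subring S" using assms by simp
  obtain e where e: "\<And>l. l \<in> Z \<Longrightarrow> e l \<in> S \<and> a - b = pix l * e l"
    using assms(5) unfolding cong_in_def by metis
  have "lin_prod Z dvd 1 - (\<Sum>l\<in>Z. lagrange Z l)"
    by (rule lin_prod_dvd) (auto simp: poly_sum poly_lagrange assms)
  then obtain g where g: "1 - (\<Sum>l\<in>Z. lagrange Z l) = lin_prod Z * g" by (auto elim: dvdE)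
  have "\<exists>h. lagrange Z l * [:-l, 1:] = lin_prod Z * h" if "l \<in> Z" for l
  proof -
    have "lin_prod Z dvd lagrange Z l * [:-l, 1:]"
      by (rule lin_prod_dvd) (use that assms in \<open>auto simp: poly_lagrange simp del: mult_pCons_right\<close>)
    then show ?thesis by (auto elim: dvdE)
  qed
  then obtain h where h: "\<And>l. l \<in> Z \<Longrightarrow> lagrange Z l * [:-l, 1:] = lin_prod Z * h l" by metis
  have "a - b = emb_base (1 - (\<Sum>l\<in>Z. lagrange Z l)) * (a - b) + (\<Sum>l\<in>Z. emb_base (lagrange Z l) * (a - b))"
    unfolding sum_distrib_right[symmetric] by (simp add: emb_base_simps ring_hom_sum[OF ring_hom_emb_base] algebra_simps)
  also have "(\<Sum>l\<in>Z. emb_base (lagrange Z l) * (a - b)) = (\<Sum>l\<in>Z. emb_base (lin_prod Z) * (emb_base (h l) * e l))"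
  proof (rule sum.cong)
    fix l assume l: "l \<in> Z"
    have "emb_base (lagrange Z l) * (a - b) = emb_base (lagrange Z l * [:-l, 1:]) * e l"
      using e[OF l] by (simp add: emb_base_simps algebra_simps del: mult_pCons_right)
    then show "emb_base (lagrange Z l) * (a - b) = emb_base (lin_prod Z) * (emb_base (h l) * e l)"
      using h[OF l] by (simp add: emb_base_simps algebra_simps)
  qed simp
  finally have "a - b = emb_base (lin_prod Z) * (emb_base g * (a - b) + (\<Sum>l\<in>Z. emb_base (h l) * e l))"
    unfolding g by (simp add: emb_base_simps algebra_simps sum_distrib_left)
  moreover have "emb_base g * (a - b) + (\<Sum>l\<in>Z. emb_base (h l) * e l) \<in> S"
    using assms e by (intro subringD(6)[OF S] subringD(4)[OF S] subringD(3)[OF S] subring_sum[OF S]) auto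
  ultimately show ?thesis unfolding cong_in_def by blast
qed

lemma chinese_remainder:
  assumes "over S" "finite Z" "\<And>l. l \<in> Z \<Longrightarrow> F l \<in> S"
  obtains G where "G \<in> S" "\<And>l. l \<in> Z \<Longrightarrow> cong_in S (pix l) G (F l)"
proof -
  have S: "subring S" using assms by simp
  define G where "G = (\<Sum>l\<in>Z. emb_base (lagrange Z l) * F l)"
  have "G \<in> S" unfolding G_def using assms by (intro subring_sum[OF S] subringD(4)[OF S]) auto
  moreover have "cong_in S (pix l) G (F l)" if l: "l \<in> Z" for l
  proof -
    have *: "\<exists>g. lagrange Z m - (if m = l then 1 else 0) = [:-l, 1:] * g" if "m \<in> Z" for m
    proof -
      have "[:-l, 1:] dvd lagrange Z m - (if m = l then 1 else 0)"
        unfolding poly_eq_0_iff_dvd[symmetric] using l that assms(2) by (auto simp: poly_lagrange)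
      then show ?thesis by (elim dvdE) blast
    qed
    then obtain g where g: "\<And>m. m \<in> Z \<Longrightarrow> lagrange Z m = (if m = l then 1 else 0) + [:-l, 1:] * g m"
      by (metis diff_add_cancel add.commute)
    have "G = (\<Sum>m\<in>Z. (if m = l then F l else 0) + pix l * (emb_base (g m) * F m))"
      unfolding G_def
    proof (rule sum.cong)
      fix m assume m: "m \<in> Z"
      show "emb_base (lagrange Z m) * F m = (if m = l then F l else 0) + pix l * (emb_base (g m) * F m)"
        unfolding g[OF m] by (auto simp add: emb_base_simps algebra_simps simp del: mult_pCons_left mult_pCons_right)
    qed simp
    also have "\<dots> = F l + pix l * (\<Sum>m\<in>Z. emb_base (g m) * F m)"
      using assms(2) l by (simp add: sum.distrib sum_distrib_left)
    finally show ?thesis unfolding cong_in_def using assms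
      by (intro bexI[of _ "\<Sum>m\<in>Z. emb_base (g m) * F m"] subring_sum[OF S] subringD(4)[OF S]) auto
  qed
  ultimately show ?thesis using that by blast
qed

text \<open>Interpolating the coefficients \<open>b\<close> and \<open>c\<close> over the roots of \<open>D\<close> leaves an error divisible by
  the product of the \<open>x - l\<close>, which is nilpotent modulo \<open>D\<close>; the interpolated \<open>a\<close> is nonzero at all
  roots of \<open>D\<close>, hence a unit modulo \<open>D\<close>.\<close>

lemma pointwise_linear_form:
  assumes B: "over B" and D: "D \<noteq> 0" and T: "emb_base D * t \<in> rhull (insert v B)"
    and loc: "\<And>l. poly D l = 0 \<Longrightarrow> \<exists>b\<in>B. \<exists>c. c \<noteq> 0 \<and>
      cong_in (rhull (insert v B)) (pix l) (emb_base D * t) (b + emb_base [:c:] * v)"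
  obtains K b a a' n d c where "b \<in> B" "coeffs_in B K" "a * a' = 1 + D * d" "lin_prod {l. poly D l = 0} ^ n = D * c"
    "emb_base D * t = b + emb_base a * v + emb_base (lin_prod {l. poly D l = 0}) * poly K v"
proof -
  let ?Z = "{l. poly D l = 0}" let ?R = "rhull (insert v B)"
  have Z: "finite ?Z" using D by (rule poly_roots_finite)
  have BR: "B \<subseteq> ?R" "v \<in> ?R" by (auto intro: rhull_incl)
  have R: "over ?R" using B BR by auto
  obtain bb cc where bc: "\<And>l. l \<in> ?Z \<Longrightarrow> bb l \<in> B \<and> cc l \<noteq> 0 \<and>
      cong_in ?R (pix l) (emb_base D * t) (bb l + emb_base [:cc l:] * v)"
  proof -
    let ?P = "\<lambda>l b c. l \<in> ?Z \<longrightarrow> b \<in> B \<and> c \<noteq> 0 \<and> cong_in ?R (pix l) (emb_base D * t) (b + emb_base [:c:] * v)"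
    have "\<exists>x. ?P l (fst x) (snd x)" for l
    proof (cases "l \<in> ?Z")
      case True
      then obtain b c where "?P l b c" using loc[of l] by blast
      then show ?thesis by (intro exI[of _ "(b, c)"]) simp
    qed simp
    then obtain x where "\<And>l. ?P l (fst (x l)) (snd (x l))" by metis
    then show ?thesis using that[of "\<lambda>l. fst (x l)" "\<lambda>l. snd (x l)"] by blast
  qed
  obtain b where b: "b \<in> B" "\<And>l. l \<in> ?Z \<Longrightarrow> cong_in B (pix l) b (bb l)"
    using chinese_remainder[OF B Z, of bb] bc by blast
  define a where "a = (\<Sum>l\<in>?Z. smult (cc l) (lagrange ?Z l))"
  have pa: "poly a l = cc l" if "l \<in> ?Z" for l
  proof -
    have "poly a l = (\<Sum>m\<in>?Z. if m = l then cc l else 0)"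
      unfolding a_def poly_sum by (rule sum.cong) (use poly_lagrange[OF Z] that in auto)
    then show ?thesis using that Z by simp
  qed
  have ca: "cong_in ?R (pix l) (emb_base a) (emb_base [:cc l:])" if "l \<in> ?Z" for l
  proof -
    have "[:-l, 1:] dvd a - [:cc l:]" unfolding poly_eq_0_iff_dvd[symmetric] using pa[OF that] by simp
    then obtain g where "a - [:cc l:] = [:-l, 1:] * g" by (auto elim: dvdE)
    then have "emb_base a - emb_base [:cc l:] = pix l * emb_base g" by (metis emb_base_simps(2,3))
    then show ?thesis unfolding cong_in_def using R by auto
  qed
  have "cong_in ?R (emb_base (lin_prod ?Z)) (emb_base D * t) (b + emb_base a * v)"
  proof (rule cong_in_lin_prod[OF R Z T])
    show "b + emb_base a * v \<in> ?R" using b BR R by (auto intro!: subringD(4,6))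
    fix l assume l: "l \<in> ?Z"
    have "cong_in ?R (pix l) (b + emb_base a * v) (bb l + emb_base [:cc l:] * v)"
      using R BR l b(2)[OF l] ca[OF l]
      by (intro cong_in_add cong_in_mult cong_in_mono[OF b(2)[OF l]] cong_in_refl) auto
    then show "cong_in ?R (pix l) (emb_base D * t) (b + emb_base a * v)"
      using bc[OF l] R cong_in_sym cong_in_trans by meson
  qed
  then obtain e where e: "e \<in> ?R" "emb_base D * t - (b + emb_base a * v) = emb_base (lin_prod ?Z) * e"
    by (auto simp: cong_in_def)
  obtain K where K: "coeffs_in B K" "e = poly K v" using rhull_insert_poly[OF _ e(1)] B by auto
  have eq: "emb_base D * t = b + emb_base a * v + emb_base (lin_prod ?Z) * poly K v"
    using e(2) K(2) by (simp add: algebra_simps)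
  obtain a' V where "a * a' + D * V = 1"
    using complex_bezout[of a D] bc pa by (metis (mono_tags, lifting) mem_Collect_eq)
  then have u: "a * a' = 1 + D * (- V)" by (simp add: algebra_simps)
  obtain c where c: "lin_prod ?Z ^ degree D = D * c"
    using dvd_lin_prod_power[OF D Z] by (auto elim: dvdE)
  show ?thesis using that[OF b(1) K(1) u c eq] .
qed

abbreviation pt3 :: "complex poly poly poly \<Rightarrow> complex \<Rightarrow> complex \<Rightarrow> complex \<Rightarrow> complex"
  where "pt3 \<equiv> ev3 (\<lambda>x. x)"

abbreviation pt2 :: "complex poly poly \<Rightarrow> complex \<Rightarrow> complex \<Rightarrow> complex"
  where "pt2 \<equiv> ev2 (\<lambda>x. x)"

lemmas ring_hom_pt2 = ring_hom_ev2[OF ring_hom_id]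
lemmas ring_hom_pt3 = ring_hom_ev3[OF ring_hom_id]

lemma evp_vanish:
  fixes i :: "'a::comm_ring_1 \<Rightarrow> 'r::idom"
  assumes "ring_hom i" "infinite X" "\<And>x. x \<in> X \<Longrightarrow> evp i P x = 0"
  shows "i (coeff P n) = 0"
proof -
  have "map_poly i P = 0"
  proof (rule ccontr)
    assume "map_poly i P \<noteq> 0"
    then have "finite {x. poly (map_poly i P) x = 0}" by (rule poly_roots_finite)
    moreover have "X \<subseteq> {x. poly (map_poly i P) x = 0}" using assms(3) by (auto simp: evp_def)
    ultimately show False using assms(2) finite_subset by blast
  qed
  then show ?thesis using coeff_map_poly[of i P n] ring_homD(4)[OF assms(1)] by simp
qed

lemma pt1_vanish:
  fixes P :: "complex poly"
  assumes "infinite X" "\<And>x. x \<in> X \<Longrightarrow> poly P x = 0" shows "P = 0"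
  using evp_vanish[OF ring_hom_id assms(1), of P] assms(2) by (auto simp: evp_id poly_eq_iff)

text \<open>Fix \<open>x\<close>: the polynomial in \<open>y\<close> has infinitely many roots.\<close>

lemma pt2_vanish:
  assumes "infinite X" "infinite Y" "\<And>x y. x \<in> X \<Longrightarrow> y \<in> Y \<Longrightarrow> pt2 P x y = 0"
  shows "P = 0"
proof -
  have "coeff P n = 0" for n
  proof (rule pt1_vanish[OF assms(1)])
    fix x assume x: "x \<in> X"
    have "evp (\<lambda>x. x) (coeff P n) x = 0"
      by (rule evp_vanish[OF ring_hom_evp[OF ring_hom_id] assms(2)]) (use assms(3) x in \<open>auto simp: ev2_def\<close>)
    then show "poly (coeff P n) x = 0" by (simp add: evp_id)
  qed
  then show ?thesis by (simp add: poly_eq_iff)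
qed

lemma pt3_vanish:
  assumes "infinite X" "infinite Y" "infinite Z"
    "\<And>x y z. x \<in> X \<Longrightarrow> y \<in> Y \<Longrightarrow> z \<in> Z \<Longrightarrow> pt3 P x y z = 0"
  shows "P = 0"
proof -
  have "coeff P n = 0" for n
  proof (rule pt2_vanish[OF assms(1,2)])
    fix x y assume "x \<in> X" "y \<in> Y"
    then show "pt2 (coeff P n) x y = 0"
      by (intro evp_vanish[OF ring_hom_pt2 assms(3)]) (use assms(4) in \<open>auto simp: ev3_def\<close>)
  qed
  then show ?thesis by (simp add: poly_eq_iff)
qed

lemma infinite_complex: "infinite (UNIV :: complex set)"
  by (rule infinite_UNIV_char_0)

lemma pt2_eqI: "(\<And>x y. pt2 P x y = pt2 Q x y) \<Longrightarrow> P = Q"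
  using pt2_vanish[OF infinite_complex infinite_complex, of "P - Q"] by (simp add: ring_homD[OF ring_hom_pt2])

lemma pt3_eqI: "(\<And>x y z. pt3 P x y z = pt3 Q x y z) \<Longrightarrow> P = Q"
  using pt3_vanish[OF infinite_complex infinite_complex infinite_complex, of "P - Q"]
  by (simp add: ring_homD[OF ring_hom_pt3])

lemma pt3_simps:
  "pt3 var_y a b c = a" "pt3 var_z a b c = b" "pt3 var_u a b c = c"
  "pt3 (emb_base k) a b c = k" "pt3 (emb_y P) a b c = poly P a" "pt3 (emb_yz Q) a b c = pt2 Q a b"
  by (simp_all add: ev3_vars ring_hom_id ev3_emb_base ev3_emb_y ev3_emb_yz evp_id)

section \<open>Automorphisms and variables\<close>

lemma base_automorphismD:
  assumes "base_automorphism \<phi>"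
  shows "ring_hom \<phi>" "bij \<phi>" "\<phi> (emb_base c) = emb_base c"
proof -
  show *: "bij \<phi>" "\<And>c. \<phi> (emb_base c) = emb_base c" using assms by (auto simp: base_automorphism_def)
  have "\<phi> 1 = 1" using *(2)[of 1] by (simp add: ring_homD[OF ring_hom_emb_base])
  then show "ring_hom \<phi>" using assms by (simp add: base_automorphism_def ring_hom_def)
qed

lemma base_automorphismI:
  assumes "ring_hom \<phi>" "bij \<phi>" "\<And>c. \<phi> (emb_base c) = emb_base c"
  shows "base_automorphism \<phi>"
  using assms by (auto simp: base_automorphism_def ring_hom_def)

lemma base_automorphism_inv:
  assumes "base_automorphism \<phi>" shows "base_automorphism (inv \<phi>)"
proof -
  note a = base_automorphismD[OF assms]
  have inj: "\<phi> x = \<phi> y \<Longrightarrow> x = y" for x y using a(2) by (auto simp: bij_def inj_def)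
  have s: "\<phi> (inv \<phi> x) = x" for x using a(2) by (simp add: bij_def surj_f_inv_f)
  have "inv \<phi> (x + y) = inv \<phi> x + inv \<phi> y" "inv \<phi> (x * y) = inv \<phi> x * inv \<phi> y"
    "inv \<phi> (emb_base c) = emb_base c" for x y c
    by (rule inj, simp add: s ring_homD[OF a(1)] a(3))+
  then show ?thesis unfolding base_automorphism_def using bij_imp_bij_inv[OF a(2)] by simp
qed

lemma base_automorphism_comp:
  "base_automorphism \<phi> \<Longrightarrow> base_automorphism \<psi> \<Longrightarrow> base_automorphism (\<lambda>x. \<phi> (\<psi> x))"
  unfolding base_automorphism_def using bij_comp[of \<psi> \<phi>] by (auto simp: o_def)

lemma base_automorphism_ev3:
  assumes "ev3 emb_base a' a b c = var_y" "ev3 emb_base b' a b c = var_z" "ev3 emb_base c' a b c = var_u"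
    and "ev3 emb_base a a' b' c' = var_y" "ev3 emb_base b a' b' c' = var_z" "ev3 emb_base c a' b' c' = var_u"
  shows "base_automorphism (\<lambda>P. ev3 emb_base P a b c)"
proof (rule base_automorphismI)
  have *: "ev3 emb_base (ev3 emb_base P x y z) x' y' z' =
      ev3 emb_base P (ev3 emb_base x x' y' z') (ev3 emb_base y x' y' z') (ev3 emb_base z x' y' z')" for P x y z x' y' z' :: "'a poly poly poly"
    using ev3_comp[OF ring_hom_emb_base ring_hom_ev3[OF ring_hom_emb_base], of P x y z x' y' z']
    by (simp add: ev3_emb_base ring_hom_emb_base)
  show "bij (\<lambda>P. ev3 emb_base P a b c)"
    by (rule o_bij[of "\<lambda>P. ev3 emb_base P a' b' c'"]) (auto simp: fun_eq_iff * assms ev3_self)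
qed (auto simp: ring_hom_ev3 ring_hom_emb_base ev3_emb_base)

text \<open>Compose with an exchange of two variables.\<close>

lemma variable_at_y:
  assumes "is_variable p"
  obtains \<phi> where "base_automorphism \<phi>" "p = \<phi> var_y"
proof -
  obtain \<phi> where \<phi>: "base_automorphism \<phi>" "p \<in> {\<phi> var_y, \<phi> var_z, \<phi> var_u}"
    using assms by (auto simp: is_variable_def)
  have 1: "base_automorphism (\<lambda>P. ev3 emb_base P var_z var_y var_u :: 'a poly poly poly)"
    and 2: "base_automorphism (\<lambda>P. ev3 emb_base P var_u var_z var_y :: 'a poly poly poly)"
    by (rule base_automorphism_ev3[of var_z _ _ _ var_y var_u], simp_all add: ev3_vars ring_hom_emb_base)
      (rule base_automorphism_ev3[of var_u _ _ _ var_z var_y], simp_all add: ev3_vars ring_hom_emb_base)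
  show ?thesis
    using \<phi> that[of \<phi>] that[OF base_automorphism_comp[OF \<phi>(1) 1]] that[OF base_automorphism_comp[OF \<phi>(1) 2]]
    by (auto simp: ev3_vars ring_hom_emb_base)
qed

lemma variable_image:
  assumes "base_automorphism \<theta>" "is_variable p" shows "is_variable (\<theta> p)"
proof -
  obtain \<phi> where "base_automorphism \<phi>" "p = \<phi> var_y" using variable_at_y[OF assms(2)] .
  then show ?thesis unfolding is_variable_def using base_automorphism_comp[OF assms(1), of \<phi>] by blast
qed

lemma variable_irreducible:
  fixes p :: "complex poly poly poly"
  assumes "is_variable p" shows "irreducible p"
proof -
  obtain \<phi> where \<phi>: "base_automorphism \<phi>" "p = \<phi> var_y" using variable_at_y[OF assms] .
  note a = base_automorphismD[OF \<phi>(1)]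
  note b = base_automorphismD(1)[OF base_automorphism_inv[OF \<phi>(1)]]
  have s: "\<phi> (inv \<phi> x) = x" "inv \<phi> (\<phi> x) = x" for x
    using a(2) by (simp_all add: bij_def surj_f_inv_f)
  have "prime_elem (var_y :: complex poly poly poly)"
    unfolding var_y_def by (simp add: prime_elem_const_poly_iff prime_elem_linear_field_poly)
  then have irr: "irreducible (var_y :: complex poly poly poly)" by (rule prime_elem_imp_irreducible)
  show ?thesis
  proof (rule irreducibleI)
    show "p \<noteq> 0"
    proof
      assume "p = 0"
      then have "var_y = inv \<phi> 0" using \<phi>(2) s(2) by metis
      then show False using irr ring_homD(4)[OF b] by simp
    qed
    show "\<not> p dvd 1"
    proof
      assume "p dvd 1"
      then obtain k where "1 = p * k" by (auto elim: dvdE)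
      then have "inv \<phi> 1 = var_y * inv \<phi> k" using \<phi>(2) s(2) ring_homD(3)[OF b] by metis
      then have "(var_y :: complex poly poly poly) dvd 1" using ring_homD(1)[OF b] by (metis dvdI)
      then show False using irr by (simp add: irreducible_def)
    qed
    fix x y assume "p = x * y"
    then have "var_y = inv \<phi> x * inv \<phi> y" using \<phi>(2) s(2) ring_homD(3)[OF b] by metis
    then have "inv \<phi> x dvd 1 \<or> inv \<phi> y dvd 1" using irr by (auto dest: irreducibleD)
    moreover have "inv \<phi> z dvd 1 \<Longrightarrow> z dvd 1" for z
    proof -
      assume "inv \<phi> z dvd 1"
      then obtain k where "1 = inv \<phi> z * k" by (auto elim: dvdE)
      then have "\<phi> 1 = z * \<phi> k" using s(1) ring_homD(3)[OF a(1)] by metis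
      then show "z dvd 1" using ring_homD(1)[OF a(1)] by (metis dvdI)
    qed
    ultimately show "x dvd 1 \<or> y dvd 1" by blast
  qed
qed

text \<open>A variable is irreducible, and \<open>P(w)\<close> factors along the roots of \<open>P\<close>.\<close>

lemma variable_univariate:
  fixes P :: "complex poly"
  assumes "is_variable (evp emb_base P w)" "w \<in> {var_y, var_z}"
  shows "degree P = 1"
proof -
  have pt: "pt3 (evp emb_base Q w) a a a = poly Q a" for Q a
    using evp_comp[OF ring_hom_emb_base ring_hom_pt3, of Q w a a a] assms(2)
    by (auto simp: pt3_simps evp_id)
  have unit: "degree Q = 0" if u: "evp emb_base Q w dvd 1" for Q
  proof (rule ccontr)
    assume "degree Q \<noteq> 0"
    then have "\<not> constant (poly Q)" by (simp add: constant_degree)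
    then obtain x where x: "poly Q x = 0" using fundamental_theorem_of_algebra by blast
    obtain k where "1 = evp emb_base Q w * k" using u by (rule dvdE)
    then have "pt3 1 x x x = pt3 (evp emb_base Q w) x x x * pt3 k x x x"
      by (metis ring_homD(3)[OF ring_hom_pt3])
    then show False using x by (simp add: pt ring_homD[OF ring_hom_pt3])
  qed
  note irr = variable_irreducible[OF assms(1)]
  have "degree P \<noteq> 0"
  proof
    assume "degree P = 0"
    then obtain c where c: "P = [:c:]" by (auto elim: degree_eq_zeroE)
    then have e: "evp emb_base P w = emb_base c" by (simp add: evp_const ring_hom_emb_base)
    have "c \<noteq> 0" using irr e by (auto simp: ring_homD[OF ring_hom_emb_base])
    then have "emb_base c * emb_base (1 / c) = 1"
      by (simp flip: ring_homD(3)[OF ring_hom_emb_base] add: ring_homD(1)[OF ring_hom_emb_base])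
    then have "evp emb_base P w dvd 1" unfolding e by (metis dvdI)
    then show False using irr by (simp add: irreducible_def)
  qed
  then have "\<not> constant (poly P)" by (simp add: constant_degree)
  then obtain x where "poly P x = 0" using fundamental_theorem_of_algebra by blast
  then obtain Q where Q: "P = [:-x, 1:] * Q" by (metis poly_eq_0_iff_dvd dvdE)
  have "evp emb_base P w = evp emb_base [:-x, 1:] w * evp emb_base Q w"
    unfolding Q by (rule evp_mult[OF ring_hom_emb_base])
  then have "evp emb_base [:-x, 1:] w dvd 1 \<or> evp emb_base Q w dvd 1" using irr irreducibleD by blast
  then have "degree Q = 0" using unit[of "[:-x, 1:]"] unit[of Q] by auto
  moreover have "Q \<noteq> 0" using \<open>degree P \<noteq> 0\<close> Q by auto
  ultimately show ?thesis unfolding Q by (subst degree_mult_eq) auto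
qed

lemma automorphism_points:
  assumes "base_automorphism (\<phi> :: complex poly poly poly \<Rightarrow> _)"
  shows "pt3 (\<phi> P) a b c = pt3 P (pt3 (\<phi> var_y) a b c) (pt3 (\<phi> var_z) a b c) (pt3 (\<phi> var_u) a b c)"
proof -
  have "\<phi> P = ev3 emb_base P (\<phi> var_y) (\<phi> var_z) (\<phi> var_u)"
    using hom_eq_ev3[OF base_automorphismD(1)[OF assms], of P] by (simp only: base_automorphismD(3)[OF assms])
  then show ?thesis
    by (simp only: ev3_comp[OF ring_hom_emb_base ring_hom_pt3] pt3_simps)
qed

text \<open>An injective \<open>g\<close> would restrict to nonconstant polynomials on the lines \<open>y = 0\<close> and \<open>y = 1\<close>, and so vanish on both.\<close>

lemma no_injective_plane_polynomial: "\<not> (\<forall>a b a' b'. pt2 g a b = pt2 g a' b' \<longrightarrow> a = a' \<and> b = b')"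
proof
  assume inj: "\<forall>a b a' b'. pt2 g a b = pt2 g a' b' \<longrightarrow> a = a' \<and> b = b'"
  have "\<exists>z. pt2 g y z = 0" for y
  proof -
    define P where "P = map_poly (\<lambda>c. evp (\<lambda>x. x) c y) g"
    have P: "pt2 g y z = poly P z" for z by (simp add: ev2_def evp_def P_def)
    have "poly P 0 \<noteq> poly P 1" using inj P by (metis zero_neq_one)
    then have "\<not> constant (poly P)" by (auto simp: constant_def)
    then show ?thesis using fundamental_theorem_of_algebra P by metis
  qed
  then obtain z z' where "pt2 g 0 z = 0" "pt2 g 1 z' = 0" by metis
  then show False using inj by (metis zero_neq_one)
qed

text \<open>Let \<open>g\<close> be the first component of the automorphism \<open>\<Phi>\<close> of \<open>\<complex>\<^sup>3\<close>. Then
  \<open>t \<mapsto> \<Phi>\<^sup>-\<^sup>1(\<Phi>(y, z, u0) + t (0, d, e))\<close> stays in a level set of \<open>g\<close>. If these curves were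
  constant for all \<open>u0\<close>, \<open>d\<close>, \<open>e\<close>, then \<open>y\<close> and \<open>z\<close> would be functions of \<open>g\<close>, making \<open>g\<close> injective.\<close>

lemma variable_level_curves:
  assumes "is_variable (emb_yz g :: complex poly poly poly)"
  obtains Y Z where
    "\<And>y z t. pt2 g (pt3 Y y z t) (pt3 Z y z t) = pt2 g y z"
    "\<And>y z. pt3 Y y z 0 = y" "\<And>y z. pt3 Z y z 0 = z"
    "\<not> (\<forall>y z t. pt3 Y y z t = y \<and> pt3 Z y z t = z)"
proof -
  obtain \<phi> where \<phi>: "base_automorphism \<phi>" "emb_yz g = \<phi> var_y" using variable_at_y[OF assms] .
  define \<psi> where "\<psi> = inv \<phi>"
  have \<psi>: "base_automorphism \<psi>" unfolding \<psi>_def by (rule base_automorphism_inv[OF \<phi>(1)])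
  have s: "\<phi> (\<psi> x) = x" "\<psi> (\<phi> x) = x" for x
    using base_automorphismD(2)[OF \<phi>(1)] by (simp_all add: \<psi>_def bij_def surj_f_inv_f)
  define f1 where "f1 = (\<lambda>y z u. pt3 (\<phi> var_y) y z u)"
  define f2 where "f2 = (\<lambda>y z u. pt3 (\<phi> var_z) y z u)"
  define f3 where "f3 = (\<lambda>y z u. pt3 (\<phi> var_u) y z u)"
  have \<phi>pt: "pt3 (\<phi> P) a b c = pt3 P (f1 a b c) (f2 a b c) (f3 a b c)" for P a b c
    unfolding f1_def f2_def f3_def by (rule automorphism_points[OF \<phi>(1)])
  have f1: "f1 y z u = pt2 g y z" for y z u
    unfolding f1_def \<phi>(2)[symmetric] by (simp add: pt3_simps)
  have \<psi>pt: "pt3 (\<psi> P) a b c = pt3 P (pt3 (\<psi> var_y) a b c) (pt3 (\<psi> var_z) a b c) (pt3 (\<psi> var_u) a b c)" for P a b c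
    by (rule automorphism_points[OF \<psi>])
  have inv1: "f1 (pt3 (\<psi> var_y) a b c) (pt3 (\<psi> var_z) a b c) (pt3 (\<psi> var_u) a b c) = a" for a b c
    unfolding f1_def \<psi>pt[symmetric] s by (simp add: pt3_simps)
  have inv2: "pt3 (\<psi> P) (f1 a b c) (f2 a b c) (f3 a b c) = pt3 P a b c" for P a b c
    unfolding \<phi>pt[symmetric] s ..
  define sub where "sub = (\<lambda>u0 P. ev3 emb_base P var_y var_z (emb_base u0) :: complex poly poly poly)"
  have sub: "pt3 (sub u0 P) y z t = pt3 P y z u0" for u0 P y z t
    unfolding sub_def using ev3_comp[OF ring_hom_emb_base ring_hom_pt3, of P var_y var_z "emb_base u0" y z t]
    by (simp add: pt3_simps)
  define cur where "cur = (\<lambda>P u0 d e. ev3 emb_base (\<psi> P) (sub u0 (\<phi> var_y))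
    (sub u0 (\<phi> var_z) + emb_base d * var_u) (sub u0 (\<phi> var_u) + emb_base e * var_u))"
  have cur: "pt3 (cur P u0 d e) y z t = pt3 (\<psi> P) (f1 y z u0) (f2 y z u0 + d * t) (f3 y z u0 + e * t)" for P u0 d e y z t
    unfolding cur_def using ev3_comp[OF ring_hom_emb_base ring_hom_pt3[of y z t], of "\<psi> P"]
    by (simp add: pt3_simps sub ring_homD[OF ring_hom_pt3] f1_def f2_def f3_def)
  have "\<exists>u0 d e. \<not> (\<forall>y z t. pt3 (cur var_y u0 d e) y z t = y \<and> pt3 (cur var_z u0 d e) y z t = z)"
  proof (rule ccontr)
    assume "\<not> ?thesis"
    then have *: "pt3 (cur var_y k d e) y z t = y" "pt3 (cur var_z k d e) y z t = z" for y z t k d e by blast+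
    have "pt3 (\<psi> var_y) (pt2 g y z) 0 0 = y" "pt3 (\<psi> var_z) (pt2 g y z) 0 0 = z" for y z
      using *[where k = 0 and d = "- f2 y z 0" and e = "- f3 y z 0" and t = 1 and y = y and z = z]
      by (simp_all add: cur f1)
    then have "\<forall>a b a' b'. pt2 g a b = pt2 g a' b' \<longrightarrow> a = a' \<and> b = b'" by metis
    then show False using no_injective_plane_polynomial by blast
  qed
  then obtain u0 d e where nt: "\<not> (\<forall>y z t. pt3 (cur var_y u0 d e) y z t = y \<and> pt3 (cur var_z u0 d e) y z t = z)"
    by blast
  show ?thesis
  proof (rule that[OF _ _ _ nt])
    fix y z t
    show "pt2 g (pt3 (cur var_y u0 d e) y z t) (pt3 (cur var_z u0 d e) y z t) = pt2 g y z"
      using inv1[of "f1 y z u0" "f2 y z u0 + d * t" "f3 y z u0 + e * t"] by (simp add: cur f1)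
    show "pt3 (cur var_y u0 d e) y z 0 = y" "pt3 (cur var_z u0 d e) y z 0 = z"
      by (simp_all add: cur inv2 pt3_simps)
  qed
qed

section \<open>Degeneration of level curves\<close>

text \<open>The part of weight \<open>N\<close>, where \<open>y\<close> has weight \<open>a\<close> and \<open>z\<close> has weight \<open>b\<close>.\<close>

definition wt_top :: "real \<Rightarrow> real \<Rightarrow> real \<Rightarrow> complex poly poly \<Rightarrow> complex poly poly"
  where "wt_top a b N g = (\<Sum>j\<le>degree g. \<Sum>i\<le>degree (coeff g j).
    monom (monom (if a * real i + b * real j = N then coeff (coeff g j) i else 0) i) j)"

lemma pt2_atoms: "pt2 [:[:k:]:] y z = k" "pt2 [:[:0, 1:]:] y z = y" "pt2 [:0, 1:] y z = z"
  "pt2 (monom [:c:] n) y z = c * z ^ n"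
  by (simp_all add: ev2_def evp_def map_poly_pCons map_poly_monom poly_monom)

lemma pt2_monom: "pt2 (monom (monom c i) j) y z = c * y ^ i * z ^ j"
  by (simp add: ev2_def evp_def map_poly_monom poly_monom)

lemma pt2_sum:
  "pt2 g y z = (\<Sum>j\<le>degree g. \<Sum>i\<le>degree (coeff g j). coeff (coeff g j) i * y ^ i * z ^ j)"
proof -
  have "g = (\<Sum>j\<le>degree g. monom (coeff g j) j)" by (simp add: poly_as_sum_of_monoms)
  also have "\<dots> = (\<Sum>j\<le>degree g. monom (\<Sum>i\<le>degree (coeff g j). monom (coeff (coeff g j) i) i) j)"
    by (simp add: poly_as_sum_of_monoms)
  also have "\<dots> = (\<Sum>j\<le>degree g. \<Sum>i\<le>degree (coeff g j). monom (monom (coeff (coeff g j) i) i) j)"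
    by (simp add: monom_sum)
  finally have "pt2 g y z = pt2 \<dots> y z" by simp
  then show ?thesis by (simp add: ring_hom_sum[OF ring_hom_pt2] pt2_monom)
qed

lemma pt2_wt_top:
  "pt2 (wt_top a b N g) y z = (\<Sum>j\<le>degree g. \<Sum>i\<le>degree (coeff g j).
    (if a * real i + b * real j = N then coeff (coeff g j) i else 0) * y ^ i * z ^ j)"
  by (simp add: wt_top_def ring_hom_sum[OF ring_hom_pt2] pt2_monom)

lemma coeff_wt_top:
  "coeff (coeff (wt_top a b N g) j) i = (if a * real i + b * real j = N then coeff (coeff g j) i else 0)"
proof -
  let ?c = "\<lambda>j i. if a * real i + b * real j = N then coeff (coeff g j) i else 0"
  have "coeff (coeff (wt_top a b N g) j) i =
      (\<Sum>j'\<le>degree g. \<Sum>i'\<le>degree (coeff g j'). if j' = j \<and> i' = i then ?c j i else 0)"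
    unfolding wt_top_def coeff_sum by (intro sum.cong refl) (auto simp: coeff_monom)
  also have "\<dots> = (\<Sum>j'\<le>degree g. if j' = j then (if i \<le> degree (coeff g j) then ?c j i else 0) else 0)"
    by (intro sum.cong refl) (auto simp: if_distrib sum.delta cong: if_cong)
  also have "\<dots> = ?c j i"
    by (auto simp: coeff_eq_0 not_le)
  finally show ?thesis .
qed

lemma powr_limit:
  assumes "e \<le> 0" shows "((\<lambda>s. complex_of_real (s powr e)) \<longlongrightarrow> (if e = 0 then 1 else 0)) at_top"
proof (cases "e = 0")
  case True
  have "\<forall>\<^sub>F s in at_top. complex_of_real (s powr e) = 1"
    using eventually_gt_at_top[of 0] by eventually_elim (simp add: True)
  then show ?thesis using True by (simp add: tendsto_eventually)
next
  case False
  then have "((\<lambda>s. s powr e) \<longlongrightarrow> 0) at_top"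
    using assms by (intro tendsto_neg_powr filterlim_ident) auto
  then have "((\<lambda>s. complex_of_real (s powr e)) \<longlongrightarrow> complex_of_real 0) at_top"
    by (rule tendsto_of_real)
  then show ?thesis using False by simp
qed

text \<open>After division by \<open>s\<^sup>N\<close> only the monomials of weight \<open>N\<close> survive as \<open>s\<close> tends to infinity.\<close>

lemma weighted_limit:
  assumes wt: "\<And>i j. coeff (coeff g j) i \<noteq> 0 \<Longrightarrow> a * real i + b * real j \<le> N"
    and A: "(A \<longlongrightarrow> A0) at_top" and B: "(B \<longlongrightarrow> B0) at_top"
  shows "((\<lambda>s. of_real (s powr - N) * pt2 g (of_real (s powr a) * A s) (of_real (s powr b) * B s))
    \<longlongrightarrow> pt2 (wt_top a b N g) A0 B0) at_top"
proof -
  let ?F = "\<lambda>s. \<Sum>j\<le>degree g. \<Sum>i\<le>degree (coeff g j).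
    (of_real (s powr (a * real i + b * real j - N)) * coeff (coeff g j) i) * A s ^ i * B s ^ j"
  have "(?F \<longlongrightarrow> pt2 (wt_top a b N g) A0 B0) at_top"
    unfolding pt2_wt_top
  proof (intro tendsto_sum tendsto_mult tendsto_power A B)
    fix i j
    show "((\<lambda>s. complex_of_real (s powr (a * real i + b * real j - N)) * coeff (coeff g j) i)
      \<longlongrightarrow> (if a * real i + b * real j = N then coeff (coeff g j) i else 0)) at_top"
    proof (cases "coeff (coeff g j) i = 0")
      case False
      show ?thesis
        using tendsto_mult_right[OF powr_limit, of "a * real i + b * real j - N" "coeff (coeff g j) i"] wt[OF False]
        by (auto split: if_splits)
    qed auto
  qed
  moreover have "\<forall>\<^sub>F s in at_top. ?F s = of_real (s powr - N) * pt2 g (of_real (s powr a) * A s) (of_real (s powr b) * B s)"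
    using eventually_gt_at_top[of 0]
  proof eventually_elim
    case (elim s)
    have "of_real (s powr (a * real i + b * real j - N)) =
        complex_of_real (s powr - N) * (of_real (s powr a) ^ i * of_real (s powr b) ^ j)" for i j :: nat
    proof -
      have "s powr (a * real i + b * real j - N) = s powr - N * ((s powr a) ^ i * (s powr b) ^ j)"
        using elim by (simp add: powr_realpow[symmetric] powr_powr powr_add powr_diff powr_minus divide_simps mult_ac)
      then show ?thesis by simp
    qed
    then show ?case
      unfolding pt2_sum by (simp add: sum_distrib_left power_mult_distrib mult_ac)
  qed
  ultimately show ?thesis by (rule Lim_transform_eventually)
qed

lemma pt3_sum: "pt3 P y z t = (\<Sum>l\<le>degree P. pt2 (coeff P l) y z * t ^ l)"
proof -
  have "P = (\<Sum>l\<le>degree P. monom (coeff P l) l)" by (simp add: poly_as_sum_of_monoms)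
  then have "pt3 P y z t = pt3 \<dots> y z t" by simp
  also have "\<dots> = (\<Sum>l\<le>degree P. pt2 (coeff P l) y z * t ^ l)"
    unfolding ring_hom_sum[OF ring_hom_pt3]
    by (simp add: ev3_def evp_def map_poly_monom poly_monom ring_homD[OF ring_hom_pt2])
  finally show ?thesis .
qed

lemma finite_support2: "finite {(j, i). coeff (coeff g j) i \<noteq> (0::complex)}"
proof (rule finite_subset)
  show "{(j, i). coeff (coeff g j) i \<noteq> 0} \<subseteq> (SIGMA j:{..degree g}. {..degree (coeff g j)})"
    by (auto intro: le_degree)
qed auto

lemma finite_support3:
  fixes P :: "complex poly poly poly"
  shows "finite {(l, j, i). coeff (coeff (coeff P l) j) i \<noteq> 0}"
proof (rule finite_subset)
  show "{(l, j, i). coeff (coeff (coeff P l) j) i \<noteq> 0} \<subseteq>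
    (SIGMA l:{..degree P}. {(j, i). coeff (coeff (coeff P l) j) i \<noteq> 0})"
    by (auto intro!: le_degree)
qed (auto simp: finite_support2)

text \<open>Rescale \<open>y\<close> and \<open>z\<close> by \<open>s\<^sup>a\<close> and \<open>s\<^sup>b\<close>, and the time \<open>t\<close> by \<open>s\<^sup>-\<^sup>m\<close>. For the largest slope \<open>m\<close>
  at which the rescaled curves stay bounded they converge, and a term of positive degree in \<open>t\<close>
  survives in the limit. The limit curve \<open>(U, V)\<close> through a general point lies in a level set of the
  leading form.\<close>

lemma level_curve_degeneration:
  fixes g :: "complex poly poly"
  assumes cur: "\<And>y z t. pt2 g (pt3 Y y z t) (pt3 Z y z t) = pt2 g y z"
    and Y0: "\<And>y z. pt3 Y y z 0 = y" and Z0: "\<And>y z. pt3 Z y z 0 = z"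
    and nt: "\<not> (\<forall>y z t. pt3 Y y z t = y \<and> pt3 Z y z t = z)"
    and wt: "\<And>i j. coeff (coeff g j) i \<noteq> 0 \<Longrightarrow> a * real i + b * real j \<le> N"
    and top: "wt_top a b N g \<noteq> 0"
  obtains U V k where
    "\<And>t. pt2 (wt_top a b N g) (poly U t) (poly V t) = k" "k \<noteq> 0" "degree U \<noteq> 0 \<or> degree V \<noteq> 0"
proof -
  define X where "X = (\<lambda>h. if h then Y else Z)"
  define w where "w = (\<lambda>h. if h then a else b)"
  define I where "I = {(h, l, j, i). coeff (coeff (coeff (X h) l) j) i \<noteq> 0 \<and> l \<noteq> 0}"
  define sl where "sl = (\<lambda>(h, l, j, i). (a * real i + b * real j - w h) / real l)"
  have "I \<subseteq> (SIGMA h:UNIV. {(l, j, i). coeff (coeff (coeff (X h) l) j) i \<noteq> 0})" by (auto simp: I_def)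
  then have fin: "finite I" by (rule finite_subset) (auto simp: finite_support3)
  have c0: "pt2 (coeff (X h) 0) y z = (if h then y else z)" for h y z
  proof -
    have "pt3 (X h) y z 0 = pt2 (coeff (X h) 0) y z"
      unfolding pt3_sum by (simp add: power_0_left if_distrib cong: if_cong)
    then show ?thesis using Y0[of y z] Z0[of y z] by (cases h) (simp_all add: X_def)
  qed
  have "I \<noteq> {}"
  proof
    assume "I = {}"
    then have "coeff (X h) l = 0" if "l \<noteq> 0" for h l using that by (auto simp: I_def poly_eq_iff)
    then have "pt3 (X h) y z t = pt2 (coeff (X h) 0) y z" for h y z t
    proof -
      have "pt3 (X h) y z t = (\<Sum>l\<le>degree (X h). if l = 0 then pt2 (coeff (X h) 0) y z else 0)"
        unfolding pt3_sum using \<open>\<And>l h. l \<noteq> 0 \<Longrightarrow> coeff (X h) l = 0\<close>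
        by (intro sum.cong) (auto simp: ring_homD[OF ring_hom_pt2])
      then show ?thesis by simp
    qed
    from this[of True] this[of False] show False using nt c0[of True] c0[of False] by (simp add: X_def)
  qed
  \<comment> \<open>The critical slope: for this \<open>m\<close> no coefficient of the rescaled curve diverges, and at least one is kept.\<close>
  define m where "m = Max (sl ` I)"
  obtain h0 l0 j0 i0 where x0: "(h0, l0, j0, i0) \<in> I" "sl (h0, l0, j0, i0) = m"
    using Max_in[of "sl ` I"] fin \<open>I \<noteq> {}\<close> unfolding m_def by fastforce
  have Y00: "coeff (X h) 0 = (if h then [:[:0, 1:]:] else [:0, 1:])" for h
    by (rule pt2_eqI) (auto simp: c0 pt2_atoms)
  have wX: "a * real i + b * real j \<le> w h + m * real l" if "coeff (coeff (coeff (X h) l) j) i \<noteq> 0" for h l j i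
  proof (cases "l = 0")
    case True
    then show ?thesis using that unfolding True Y00
      by (auto simp: w_def coeff_pCons split: if_splits nat.splits)
  next
    case False
    then have "(h, l, j, i) \<in> I" using that by (auto simp: I_def)
    then have "sl (h, l, j, i) \<le> m" using fin by (auto simp: m_def)
    then show ?thesis using False by (simp add: sl_def field_simps)
  qed
  define gb where "gb = wt_top a b N g"
  define q where "q = (\<lambda>h l. wt_top a b (w h + m * real l) (coeff (X h) l))"
  have l0: "l0 \<noteq> 0" using x0 by (auto simp: I_def)
  have "coeff (coeff (q h0 l0) j0) i0 \<noteq> 0"
    using x0 l0 by (auto simp: q_def coeff_wt_top I_def sl_def field_simps)
  then have q0: "q h0 l0 \<noteq> 0" by auto
  then have "q h0 l0 * gb \<noteq> 0" using top by (simp add: gb_def)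
  then obtain y0 z0 where yz: "pt2 (q h0 l0 * gb) y0 z0 \<noteq> 0"
    using pt2_vanish[OF infinite_complex infinite_complex] by blast
  define C where "C = (\<lambda>h. \<Sum>l\<le>degree (X h). monom (pt2 (q h l) y0 z0) l)"
  have coeffC: "coeff (C h) l = pt2 (q h l) y0 z0" for h l
  proof -
    have "coeff (X h) l = 0 \<Longrightarrow> q h l = 0" by (simp add: q_def poly_eq_iff coeff_wt_top)
    then have "\<not> l \<le> degree (X h) \<Longrightarrow> q h l = 0" by (auto simp: coeff_eq_0)
    then show ?thesis unfolding C_def coeff_sum coeff_monom
      by (auto simp: ring_homD[OF ring_hom_pt2])
  qed
  have lim: "((\<lambda>s. of_real (s powr - w h) * pt3 (X h) (of_real (s powr a) * y0) (of_real (s powr b) * z0) (of_real (s powr - m) * t))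
      \<longlongrightarrow> poly (C h) t) at_top" for h t
  proof -
    let ?F = "\<lambda>s. \<Sum>l\<le>degree (X h). (of_real (s powr - (w h + m * real l)) * pt2 (coeff (X h) l) (of_real (s powr a) * y0) (of_real (s powr b) * z0)) * t ^ l"
    have "(?F \<longlongrightarrow> poly (C h) t) at_top"
      unfolding C_def poly_sum poly_monom q_def
      by (intro tendsto_sum tendsto_mult tendsto_const weighted_limit) (use wX in auto)
    moreover have "\<forall>\<^sub>F s in at_top. ?F s = of_real (s powr - w h) * pt3 (X h) (of_real (s powr a) * y0) (of_real (s powr b) * z0) (of_real (s powr - m) * t)"
      using eventually_gt_at_top[of 0]
    proof eventually_elim
      case (elim s)
      have "complex_of_real (s powr - (w h + m * real l)) = of_real (s powr - w h) * of_real (s powr - m) ^ l" for l :: nat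
      proof -
        have "s powr - (w h + m * real l) = s powr - w h * (s powr - m) ^ l"
          using elim by (simp add: powr_realpow[symmetric] powr_powr powr_add[symmetric])
        then show ?thesis by simp
      qed
      then show ?case unfolding pt3_sum by (simp add: sum_distrib_left power_mult_distrib mult_ac)
    qed
    ultimately show ?thesis by (rule Lim_transform_eventually)
  qed
  have const: "pt2 gb (poly (C True) t) (poly (C False) t) = pt2 gb y0 z0" for t
  proof -
    let ?P = "\<lambda>s. complex_of_real (s powr a) * y0" and ?Q = "\<lambda>s. complex_of_real (s powr b) * z0"
      and ?t = "\<lambda>s. complex_of_real (s powr - m) * t"
    let ?A = "\<lambda>s. of_real (s powr - a) * pt3 Y (?P s) (?Q s) (?t s)"
    let ?B = "\<lambda>s. of_real (s powr - b) * pt3 Z (?P s) (?Q s) (?t s)"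
    have "((\<lambda>s. of_real (s powr - N) * pt2 g (of_real (s powr a) * ?A s) (of_real (s powr b) * ?B s))
        \<longlongrightarrow> pt2 gb (poly (C True) t) (poly (C False) t)) at_top"
      unfolding gb_def using lim[of True t] lim[of False t] wt
      by (intro weighted_limit) (auto simp: X_def w_def)
    moreover have "\<forall>\<^sub>F s in at_top. of_real (s powr - N) * pt2 g (of_real (s powr a) * ?A s) (of_real (s powr b) * ?B s)
        = of_real (s powr - N) * pt2 g (?P s) (?Q s)"
      using eventually_gt_at_top[of 0]
    proof eventually_elim
      case (elim s)
      have "complex_of_real (s powr e) * (of_real (s powr - e) * x) = x" for e x
      proof -
        have "s powr e * s powr - e = 1" using elim by (simp add: powr_minus)
        then have "complex_of_real (s powr e) * of_real (s powr - e) = 1" by (metis of_real_1 of_real_mult)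
        then show ?thesis by (simp add: mult.assoc[symmetric])
      qed
      then show ?case by (simp only: cur)
    qed
    ultimately have "((\<lambda>s. of_real (s powr - N) * pt2 g (?P s) (?Q s))
        \<longlongrightarrow> pt2 gb (poly (C True) t) (poly (C False) t)) at_top" by (rule Lim_transform_eventually)
    moreover have "((\<lambda>s. of_real (s powr - N) * pt2 g (?P s) (?Q s)) \<longlongrightarrow> pt2 gb y0 z0) at_top"
      unfolding gb_def by (intro weighted_limit tendsto_const wt)
    ultimately show ?thesis by (rule tendsto_unique[OF trivial_limit_at_top_linorder])
  qed
  have "coeff (C h0) l0 \<noteq> 0" using yz by (auto simp: coeffC ring_homD[OF ring_hom_pt2])
  then have "degree (C h0) \<noteq> 0" using l0 by (metis coeff_eq_0 gr0I)
  then have "degree (C True) \<noteq> 0 \<or> degree (C False) \<noteq> 0" by (cases h0) auto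
  moreover have "pt2 gb y0 z0 \<noteq> 0" using yz by (auto simp: ring_homD[OF ring_hom_pt2])
  ultimately show ?thesis using that[of "C True" "C False" "pt2 gb y0 z0"] const by (simp add: gb_def)
qed

section \<open>Shears of the plane\<close>

definition shear :: "complex \<Rightarrow> nat \<Rightarrow> complex poly poly \<Rightarrow> complex poly poly"
  where "shear c n g = ev2 (\<lambda>k. [:[:k:]:]) g ([:[:0, 1:]:] + monom [:c:] n) [:0, 1:]"

lemma ring_hom_const2: "ring_hom (\<lambda>k. [:[:k:]:])"
  by (auto simp: ring_hom_def one_pCons)

lemma ring_hom_shear: "ring_hom (shear c n)"
  unfolding shear_def by (intro ring_hom_ev2 ring_hom_const2)

lemma pt2_shear: "pt2 (shear c n g) y z = pt2 g (y + c * z ^ n) z"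
  unfolding shear_def ev2_comp[OF ring_hom_const2 ring_hom_pt2]
  by (simp add: pt2_atoms ring_homD[OF ring_hom_pt2])

lemma evp_diff_dvd: "ring_hom i \<Longrightarrow> (a - b) dvd evp i P a - evp i P b"
proof (induction P)
  case (pCons c P)
  then obtain k where k: "evp i P a = evp i P b + (a - b) * k" by (metis dvdE diff_eq_eq add.commute)
  have "evp i (pCons c P) a - evp i (pCons c P) b = (a - b) * (evp i P b + a * k)"
    unfolding evp_pCons[OF pCons.prems] k by (simp add: algebra_simps)
  then show ?case by simp
qed simp

text \<open>The substitution changes \<open>y\<close> by a multiple of \<open>z\<^sup>n\<close>, hence \<open>g\<close> by a multiple of \<open>z\<^sup>2\<close>.\<close>

lemma coeff_shear_low:
  assumes "n \<ge> 2" "m < 2" shows "coeff (shear c n g) m = coeff g m"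
proof -
  let ?Y = "[:[:0, 1:]:] :: complex poly poly" and ?i = "\<lambda>k::complex. [:[:k:]:]"
  have id: "ev2 ?i g ?Y [:0, 1:] = g"
    by (rule pt2_eqI) (simp add: ev2_comp[OF ring_hom_const2 ring_hom_pt2] pt2_atoms)
  have step: "monom 1 n dvd evp (\<lambda>c. evp ?i c a) h z - evp (\<lambda>c. evp ?i c b) h z"
    if ab: "monom 1 n dvd a - b" for a b h z
  proof (induction h)
    case (pCons c h)
    have "monom 1 n dvd evp ?i c a - evp ?i c b"
      using dvd_trans[OF ab evp_diff_dvd[OF ring_hom_const2]] .
    moreover have "evp (\<lambda>c. evp ?i c a) (pCons c h) z - evp (\<lambda>c. evp ?i c b) (pCons c h) z =
        (evp ?i c a - evp ?i c b) + z * (evp (\<lambda>c. evp ?i c a) h z - evp (\<lambda>c. evp ?i c b) h z)"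
      by (simp add: evp_pCons ring_hom_evp ring_hom_const2 algebra_simps)
    ultimately show ?case using pCons.IH by simp
  qed simp
  have "monom 1 n dvd (?Y + monom [:c:] n) - ?Y"
  proof -
    have "monom [:c:] n = monom 1 n * [:[:c:]:]" by (simp add: smult_monom)
    then have "monom 1 n dvd monom [:c:] n" by (metis dvdI)
    then show ?thesis by simp
  qed
  from step[OF this, of g "[:0, 1:]"] have "monom 1 n dvd shear c n g - g"
    unfolding shear_def ev2_def[symmetric] id .
  then obtain k where k: "shear c n g - g = monom 1 n * k" by (rule dvdE)
  have "coeff (shear c n g - g) m = 0" unfolding k using assms by (simp add: coeff_monom_mult)
  then show ?thesis by simp
qed

lemma variable_shear:
  assumes "is_variable (emb_yz g :: complex poly poly poly)" shows "is_variable (emb_yz (shear c n g))"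
proof -
  let ?\<theta> = "\<lambda>P. ev3 emb_base P (var_y + emb_base c * var_z ^ n) var_z var_u :: complex poly poly poly"
  have "base_automorphism ?\<theta>"
    by (rule base_automorphism_ev3[of "var_y - emb_base c * var_z ^ n" _ _ _ var_z var_u])
      (simp_all add: ev3_vars ring_hom_emb_base ring_homD[OF ring_hom_ev3[OF ring_hom_emb_base]] ev3_emb_base)
  from variable_image[OF this assms] have "is_variable (?\<theta> (emb_yz g))" .
  also have "?\<theta> (emb_yz g) = emb_yz (shear c n g)"
    by (rule pt3_eqI)
      (simp add: ev3_comp[OF ring_hom_emb_base ring_hom_pt3] pt3_simps pt2_shear ring_homD[OF ring_hom_pt3])
  finally show ?thesis .
qed

section \<open>Weights\<close>

text \<open>Here \<open>z\<close> has weight \<open>1\<close> and \<open>y\<close> has weight \<open>a\<close>, so that \<open>y \<mapsto> y + c z\<^sup>a\<close> is homogeneous.\<close>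

definition wt_le :: "nat \<Rightarrow> nat \<Rightarrow> complex poly poly \<Rightarrow> bool"
  where "wt_le a N g \<longleftrightarrow> (\<forall>i j. coeff (coeff g j) i \<noteq> 0 \<longrightarrow> a * i + j \<le> N)"

lemma wt_le_add: "wt_le a N g \<Longrightarrow> wt_le a N h \<Longrightarrow> wt_le a N (g + h)"
  unfolding wt_le_def by (metis add.right_neutral coeff_add)

lemma wt_le_0 [simp]: "wt_le a N 0"
  by (simp add: wt_le_def)

lemma wt_le_sum: "(\<And>x. x \<in> S \<Longrightarrow> wt_le a N (f x)) \<Longrightarrow> wt_le a N (sum f S)"
  by (induction S rule: infinite_finite_induct) (auto intro: wt_le_add)

lemma wt_le_mult:
  assumes "wt_le a N g" "wt_le a M h" shows "wt_le a (N + M) (g * h)"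
  unfolding wt_le_def
proof (intro allI impI)
  fix i j assume nz: "coeff (coeff (g * h) j) i \<noteq> 0"
  have "coeff (coeff (g * h) j) i =
      (\<Sum>j'\<le>j. \<Sum>i'\<le>i. coeff (coeff g j') i' * coeff (coeff h (j - j')) (i - i'))"
    by (simp add: coeff_mult coeff_sum)
  with nz obtain j' where j': "j' \<le> j" "(\<Sum>i'\<le>i. coeff (coeff g j') i' * coeff (coeff h (j - j')) (i - i')) \<noteq> 0"
    by (metis (no_types, lifting) atMost_iff sum.not_neutral_contains_not_neutral)
  then obtain i' where i': "i' \<le> i" "coeff (coeff g j') i' * coeff (coeff h (j - j')) (i - i') \<noteq> 0"
    by (metis (no_types, lifting) atMost_iff sum.not_neutral_contains_not_neutral)
  then have "a * i' + j' \<le> N" "a * (i - i') + (j - j') \<le> M"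
    using assms by (auto simp: wt_le_def)
  moreover have "a * i = a * i' + a * (i - i')" using i'(1) by (simp flip: add_mult_distrib2)
  ultimately show "a * i + j \<le> N + M" using j'(1) by linarith
qed

lemma wt_le_mono: "wt_le a N g \<Longrightarrow> N \<le> M \<Longrightarrow> wt_le a M g"
  unfolding wt_le_def by (meson le_trans)

lemma wt_le_power: "wt_le a N g \<Longrightarrow> wt_le a (n * N) (g ^ n)"
proof (induction n)
  case 0 then show ?case by (auto simp: wt_le_def one_pCons coeff_pCons split: nat.splits)
next
  case (Suc n) then show ?case using wt_le_mult[of a N g "n * N" "g ^ n"] by (simp add: add.commute)
qed

lemma wt_le_shear:
  assumes "wt_le a N g" shows "wt_le a N (shear c a g)"
proof -
  let ?Y = "[:[:0, 1:]:] + monom [:c:] a :: complex poly poly"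
  have "shear c a g = (\<Sum>j\<le>degree g. \<Sum>i\<le>degree (coeff g j). [:[:coeff (coeff g j) i:]:] * ?Y ^ i * [:0, 1:] ^ j)"
    by (rule pt2_eqI)
      (simp add: pt2_shear pt2_sum[of g] ring_hom_sum[OF ring_hom_pt2] ring_homD[OF ring_hom_pt2] pt2_atoms
        del: mult_pCons_left mult_pCons_right)
  moreover have "wt_le a N ([:[:coeff (coeff g j) i:]:] * ?Y ^ i * [:0, 1:] ^ j)" for i j
  proof (cases "coeff (coeff g j) i = 0")
    case False
    have "wt_le a a ?Y"
      by (rule wt_le_add) (auto simp: wt_le_def coeff_pCons coeff_monom split: nat.splits if_splits)
    moreover have "wt_le a 1 [:0, 1:]" "wt_le a 0 [:[:coeff (coeff g j) i:]:]"
      by (auto simp: wt_le_def coeff_pCons split: nat.splits)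
    ultimately have "wt_le a (0 + i * a + j * 1) ([:[:coeff (coeff g j) i:]:] * ?Y ^ i * [:0, 1:] ^ j)"
      by (intro wt_le_mult wt_le_power)
    moreover have "a * i + j \<le> N" using assms False by (auto simp: wt_le_def)
    then have "0 + i * a + j * 1 \<le> N" by (simp add: mult.commute)
    ultimately show ?thesis by (rule wt_le_mono)
  qed (simp add: wt_le_def)
  ultimately show ?thesis by (auto intro!: wt_le_sum)
qed

section \<open>Edges of the Newton polygon\<close>

lemma degree_power_const:
  fixes U :: "complex poly"
  assumes "degree (U ^ n) = 0" "n > 0" shows "degree U = 0"
  using assms by (cases "U = 0") (auto simp: degree_power_eq)

text \<open>\<open>U\<close> and \<open>V\<close> are coprime. Differentiation gives \<open>m V\<^sup>m\<^sup>-\<^sup>1 V' = x n U\<^sup>n\<^sup>-\<^sup>1 U'\<close>, so \<open>V\<^sup>m\<^sup>-\<^sup>1\<close> divides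
  \<open>U'\<close> and \<open>U\<^sup>n\<^sup>-\<^sup>1\<close> divides \<open>V'\<close>. For \<open>m, n \<ge> 2\<close> the degrees of \<open>U\<close> and \<open>V\<close> would each be smaller
  than the other.\<close>

lemma no_curve_power_diff:
  fixes U V :: "complex poly"
  assumes eq: "V ^ m - smult x (U ^ n) = [:k:]" and k: "k \<noteq> 0" "x \<noteq> 0" and nc: "degree U \<noteq> 0 \<or> degree V \<noteq> 0"
    and mn: "m > 0" "n > 0"
  shows "m = 1 \<or> n = 1"
proof (rule ccontr)
  assume "\<not> ?thesis"
  then have m: "m \<ge> 2" and n: "n \<ge> 2" using mn by auto
  have Veq: "V ^ m = smult x (U ^ n) + [:k:]" using eq by (simp add: algebra_simps)
  have UV: "degree U \<noteq> 0 \<and> degree V \<noteq> 0"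
  proof (rule ccontr)
    assume "\<not> (degree U \<noteq> 0 \<and> degree V \<noteq> 0)"
    then consider "degree U = 0" | "degree V = 0" by blast
    then show False
    proof cases
      case 1
      then have "degree (V ^ m) = 0" unfolding Veq
        using degree_power_le[of U n] degree_smult_le[of x "U ^ n"] degree_add_le[of "smult x (U ^ n)" 0 "[:k:]"] by simp
      then show False using degree_power_const[of V m] mn nc 1 by simp
    next
      case 2
      have "U ^ n = smult (1 / x) (V ^ m - [:k:])" unfolding Veq using k by simp
      then have "degree (U ^ n) = degree (V ^ m - [:k:])" using k by simp
      also have "\<dots> = 0" using 2 degree_power_le[of V m] degree_diff_le[of "V ^ m" 0 "[:k:]"] by simp
      finally show False using degree_power_const[of U n] mn nc 2 by simp
    qed
  qed
  have UV0: "U \<noteq> 0" "V \<noteq> 0" using UV by auto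
  have cop: "coprime U V"
    unfolding complex_coprime_iff
  proof (intro allI notI)
    fix t assume "poly U t = 0 \<and> poly V t = 0"
    then have "poly (V ^ m - smult x (U ^ n)) t = 0" using m n by (simp add: zero_power)
    then show False unfolding eq using k by simp
  qed
  have "pderiv (V ^ m - smult x (U ^ n)) = 0" unfolding eq by simp
  then have d: "smult (of_nat m) (V ^ (m - 1) * pderiv V) = smult x (smult (of_nat n) (U ^ (n - 1) * pderiv U))"
    using m n pderiv_power_Suc[of V "m - 1"] pderiv_power_Suc[of U "n - 1"]
    by (simp add: pderiv_diff pderiv_smult)
  have "V ^ (m - 1) dvd U ^ (n - 1) * pderiv U"
  proof -
    have "U ^ (n - 1) * pderiv U = V ^ (m - 1) * smult (of_nat m / (x * of_nat n)) (pderiv V)"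
    proof -
      have "smult (1 / (x * of_nat n)) (smult (of_nat m) (V ^ (m - 1) * pderiv V)) = U ^ (n - 1) * pderiv U"
        unfolding d using k n by simp
      then show ?thesis by (simp add: field_simps)
    qed
    then show ?thesis by (metis dvdI)
  qed
  then have "V ^ (m - 1) dvd pderiv U" using cop by (simp add: coprime_dvd_mult_right_iff coprime_commute)
  then have 1: "(m - 1) * degree V \<le> degree U - 1"
    using UV dvd_imp_degree_le[of "V ^ (m - 1)" "pderiv U"] UV0 by (auto simp: degree_pderiv degree_power_eq pderiv_eq_0_iff)
  have "U ^ (n - 1) dvd V ^ (m - 1) * pderiv V"
  proof -
    have "V ^ (m - 1) * pderiv V = U ^ (n - 1) * smult (x * of_nat n / of_nat m) (pderiv U)"
    proof -
      have "smult (1 / of_nat m) (smult x (smult (of_nat n) (U ^ (n - 1) * pderiv U))) = V ^ (m - 1) * pderiv V"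
        unfolding d[symmetric] using k m by simp
      then show ?thesis by (simp add: field_simps)
    qed
    then show ?thesis by (metis dvdI)
  qed
  then have "U ^ (n - 1) dvd pderiv V" using cop by (simp add: coprime_dvd_mult_right_iff coprime_commute)
  then have 2: "(n - 1) * degree U \<le> degree V - 1"
    using UV dvd_imp_degree_le[of "U ^ (n - 1)" "pderiv V"] UV0 by (auto simp: degree_pderiv degree_power_eq pderiv_eq_0_iff)
  have "1 * degree V \<le> (m - 1) * degree V" "1 * degree U \<le> (n - 1) * degree U"
    using m n by (intro mult_right_mono; simp)+
  then show False using 1 2 UV by linarith
qed

text \<open>The left side of \<open>hom\<close> is the form \<open>U\<^sup>d\<^sup>-\<^sup>n\<^sup>K \<Prod> (V\<^sup>m - x U\<^sup>n)\<close>, taken over the roots \<open>x\<close> of \<open>e\<close>.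
  All factors of a nonzero constant are constant; two different roots, or a factor \<open>U\<close>, would
  make both \<open>U\<close> and \<open>V\<close> constant.\<close>

lemma edge_single_root:
  fixes e U V :: "complex poly"
  assumes dK: "degree e = K" "K > 0" and e0: "coeff e 0 \<noteq> 0"
    and mn: "m > 0" "n > 0" and d: "n * K \<le> d"
    and hom: "\<And>t. (\<Sum>k\<le>K. coeff e k * poly U t ^ (d - n * k) * poly V t ^ (m * k)) = c" "c \<noteq> 0"
    and nc: "degree U \<noteq> 0 \<or> degree V \<noteq> 0"
  obtains x where "x \<noteq> 0" "e = smult (lead_coeff e) ([:-x, 1:] ^ K)" "d = n * K" "m = 1 \<or> n = 1"
proof -
  have en: "e \<noteq> 0" using e0 by auto
  have hom1: "(\<Sum>k\<le>K. coeff e k * u ^ (d - n * k) * v ^ (m * k)) = u ^ (d - n * K) * (u ^ n) ^ K * poly e (v ^ m / u ^ n)"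
    if "u \<noteq> 0" for u v :: complex
  proof -
    have "u ^ (d - n * K) * (u ^ n) ^ K * poly e (v ^ m / u ^ n) =
        (\<Sum>k\<le>K. coeff e k * (u ^ (d - n * K) * (u ^ n) ^ K * (v ^ m / u ^ n) ^ k))"
      unfolding poly_altdef dK by (simp add: sum_distrib_left mult_ac)
    also have "\<dots> = (\<Sum>k\<le>K. coeff e k * (u ^ (d - n * k) * v ^ (m * k)))"
    proof (intro sum.cong refl)
      fix k assume k: "k \<in> {..K}"
      have "n * k \<le> n * K" using k by simp
      then have 1: "d - n * k = (d - n * K) + (n * K - n * k)" using d by simp
      have 2: "u ^ (n * K) = u ^ (n * K - n * k) * u ^ (n * k)"
        using \<open>n * k \<le> n * K\<close> by (simp flip: power_add)
      have "u ^ (d - n * K) * (u ^ n) ^ K * (v ^ m / u ^ n) ^ k = u ^ (d - n * k) * v ^ (m * k)"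
        unfolding 1 power_add power_mult[symmetric] power_divide 2 using that by simp
      then show "coeff e k * (u ^ (d - n * K) * (u ^ n) ^ K * (v ^ m / u ^ n) ^ k) = coeff e k * (u ^ (d - n * k) * v ^ (m * k))"
        by simp
    qed
    finally show ?thesis by (simp add: mult_ac)
  qed
  define Z where "Z = {x. poly e x = 0}"
  have Zf: "finite Z" unfolding Z_def using en by (rule poly_roots_finite)
  have Z0: "0 \<notin> Z" using e0 by (simp add: Z_def poly_0_coeff_0)
  have dec: "e = smult (lead_coeff e) (\<Prod>x\<in>Z. [:-x, 1:] ^ order x e)"
    unfolding Z_def by (rule complex_poly_decompose[symmetric])
  have sumord: "(\<Sum>x\<in>Z. order x e) = K"
  proof -
    have "K = degree (\<Prod>x\<in>Z. [:-x, 1:] ^ order x e)" using dK dec en by (metis degree_smult_eq leading_coeff_0_iff)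
    also have "\<dots> = (\<Sum>x\<in>Z. degree ([:-x, 1:] ^ order x e))" by (rule degree_prod_sum_eq) auto
    also have "\<dots> = (\<Sum>x\<in>Z. order x e)" by (simp add: degree_power_eq)
    finally show ?thesis by simp
  qed
  have Une: "U \<noteq> 0"
  proof
    assume U: "U = 0"
    have s: "c = coeff e K * 0 ^ (d - n * K) * poly V t ^ (m * K)" for t
    proof -
      have "(\<Sum>k\<le>K. coeff e k * poly U t ^ (d - n * k) * poly V t ^ (m * k)) =
          (\<Sum>k\<le>K. if k = K then coeff e K * 0 ^ (d - n * K) * poly V t ^ (m * K) else 0)"
      proof (intro sum.cong refl)
        fix k assume "k \<in> {..K}"
        then have "k \<noteq> K \<Longrightarrow> n * k < n * K" using mn by simp
        then have "k \<noteq> K \<Longrightarrow> d - n * k > 0" using d by linarith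
        then show "coeff e k * poly U t ^ (d - n * k) * poly V t ^ (m * k) =
          (if k = K then coeff e K * 0 ^ (d - n * K) * poly V t ^ (m * K) else 0)"
          by (auto simp: U zero_power)
      qed
      then show ?thesis using hom(1)[of t] by simp
    qed
    have dK0: "d - n * K = 0" using s[of 0] hom(2) by (cases "d - n * K") auto
    have "poly (V ^ (m * K) - [:c / coeff e K:]) t = 0" for t
      using s[of t] hom(2) unfolding dK0 by (auto simp: field_simps)
    then have "V ^ (m * K) = [:c / coeff e K:]" using poly_all_0_iff_0 by (metis right_minus_eq)
    then have "degree (V ^ (m * K)) = 0" by simp
    then have "degree V = 0" by (rule degree_power_const) (use mn dK in auto)
    then show False using nc U by simp
  qed
  define P where "P = U ^ (d - n * K) * smult (lead_coeff e) (\<Prod>x\<in>Z. (V ^ m - smult x (U ^ n)) ^ order x e)"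
  have Pc: "P = [:c:]"
  proof -
    have "infinite (UNIV - {t. poly U t = 0})"
      using poly_roots_finite[OF Une] infinite_complex by (simp add: Diff_infinite_finite)
    then have "P - [:c:] = 0"
    proof (rule pt1_vanish)
      fix t assume "t \<in> UNIV - {t. poly U t = 0}"
      then have u: "poly U t \<noteq> 0" by simp
      let ?u = "poly U t" and ?v = "poly V t"
      have "c = ?u ^ (d - n * K) * (?u ^ n) ^ K * poly e (?v ^ m / ?u ^ n)"
        using hom(1)[of t] hom1[OF u] by simp
      also have "poly e (?v ^ m / ?u ^ n) = lead_coeff e * (\<Prod>x\<in>Z. (?v ^ m / ?u ^ n - x) ^ order x e)"
        by (subst dec) (simp add: poly_prod)
      also have "?u ^ (d - n * K) * (?u ^ n) ^ K * (lead_coeff e * (\<Prod>x\<in>Z. (?v ^ m / ?u ^ n - x) ^ order x e)) =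
          ?u ^ (d - n * K) * (lead_coeff e * (\<Prod>x\<in>Z. (?u ^ n) ^ order x e * (?v ^ m / ?u ^ n - x) ^ order x e))"
        by (simp add: sumord[symmetric] power_sum prod.distrib mult_ac)
      also have "(\<Prod>x\<in>Z. (?u ^ n) ^ order x e * (?v ^ m / ?u ^ n - x) ^ order x e) = (\<Prod>x\<in>Z. (?v ^ m - x * ?u ^ n) ^ order x e)"
        using u by (intro prod.cong refl) (simp add: power_mult_distrib[symmetric] algebra_simps)
      finally show "poly (P - [:c:]) t = 0" by (simp add: P_def poly_prod mult_ac)
    qed
    then show ?thesis by simp
  qed
  have unit: "degree Q = 0" if "Q dvd P" for Q
    using that dvd_imp_degree_le[of Q P] hom(2) by (auto simp: Pc)
  have fac: "degree (V ^ m - smult x (U ^ n)) = 0" if x: "x \<in> Z" for x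
  proof (rule unit)
    have "order x e \<noteq> 0" using x en by (simp add: Z_def order_root)
    then have "V ^ m - smult x (U ^ n) dvd (V ^ m - smult x (U ^ n)) ^ order x e" by (simp add: dvd_power)
    also have "\<dots> dvd (\<Prod>x\<in>Z. (V ^ m - smult x (U ^ n)) ^ order x e)" using Zf x by (rule dvd_prodI)
    also have "\<dots> dvd P" unfolding P_def by (simp add: dvd_smult)
    finally show "V ^ m - smult x (U ^ n) dvd P" .
  qed
  have noU: "degree U \<noteq> 0"
  proof
    assume U: "degree U = 0"
    have "Z \<noteq> {}" using sumord dK by auto
    then obtain x where x: "x \<in> Z" by auto
    have "V ^ m = (V ^ m - smult x (U ^ n)) + smult x (U ^ n)" by simp
    then have "degree (V ^ m) = 0"
      using fac[OF x] U degree_power_le[of U n] degree_smult_le[of x "U ^ n"]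
        degree_add_le[of "V ^ m - smult x (U ^ n)" 0 "smult x (U ^ n)"] by simp
    then show False using degree_power_const[of V m] mn nc U by simp
  qed
  have d': "d = n * K"
  proof (rule ccontr)
    assume "d \<noteq> n * K"
    then have "U dvd U ^ (d - n * K)" using d by (intro dvd_power) auto
    then have "U dvd P" unfolding P_def by (rule dvd_mult2)
    then show False using unit[of U] noU by simp
  qed
  have "\<exists>x. Z = {x}"
  proof (rule ccontr)
    assume no: "\<nexists>x. Z = {x}"
    have "Z \<noteq> {}" using sumord dK by auto
    then obtain x where x: "x \<in> Z" by blast
    then obtain y where xy: "x \<in> Z" "y \<in> Z" "x \<noteq> y" using no by blast
    have "smult (y - x) (U ^ n) = (V ^ m - smult x (U ^ n)) - (V ^ m - smult y (U ^ n))"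
      by (simp add: smult_diff_left)
    then have "degree (smult (y - x) (U ^ n)) \<le> 0"
      using fac[OF xy(1)] fac[OF xy(2)] by (metis degree_diff_le le_refl)
    then have "degree (U ^ n) = 0" using xy by simp
    then show False using degree_power_const[of U n] mn noU by simp
  qed
  then obtain x where x: "Z = {x}" by blast
  have x0: "x \<noteq> 0" using Z0 x by auto
  have ex: "e = smult (lead_coeff e) ([:-x, 1:] ^ K)" using dec sumord by (simp add: x)
  obtain k where k: "V ^ m - smult x (U ^ n) = [:k:]" using fac[of x] x by (auto elim: degree_eq_zeroE)
  have "k \<noteq> 0"
  proof
    assume "k = 0"
    then have "P = 0" using k Zf sumord dK unfolding P_def by (simp add: x zero_power)
    then show False using Pc hom(2) by simp
  qed
  then have "m = 1 \<or> n = 1" using no_curve_power_diff[OF k _ x0 nc mn] by blast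
  then show ?thesis using that[OF x0 ex d'] by blast
qed

section \<open>Plane variables with a constant coefficient of \<open>z\<close>\<close>

lemma variable_in_z:
  assumes var: "is_variable (emb_yz g :: complex poly poly poly)"
    and c: "coeff g 1 = [:c:]" and deg: "\<And>j. degree (coeff g j) = 0"
  shows "pt2 g y z = poly (coeff g 0) y + c * z"
proof -
  define P where "P = map_poly (\<lambda>q. coeff q 0) g"
  have cP: "coeff g j = [:coeff P j:]" for j
    using degree_eq_zeroE[OF deg[of j]] by (metis P_def coeff_0 coeff_map_poly coeff_pCons_0)
  have pt: "pt2 g y z = poly P z" for y z
  proof -
    have "pt2 g y z = poly (map_poly (\<lambda>q. poly q y) g) z" by (simp add: ev2_def evp_def)
    also have "map_poly (\<lambda>q. poly q y) g = P"
      by (simp add: poly_eq_iff coeff_map_poly cP)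
    finally show ?thesis .
  qed
  have "emb_yz g = evp emb_base P var_z"
    by (rule pt3_eqI) (simp add: pt3_simps pt evp_comp[OF ring_hom_emb_base ring_hom_pt3] evp_id)
  then have d: "degree P = 1" using variable_univariate[of P var_z] var by simp
  have "pt2 g y z = coeff P 0 + coeff P 1 * z" unfolding pt poly_altdef d by simp
  also have "coeff P 1 = c" using c cP[of 1] by simp
  finally show ?thesis by (simp add: cP)
qed

text \<open>For the weight \<open>1\<close> of \<open>y\<close> and \<open>0\<close> of \<open>z\<close> the leading form is \<open>y\<^sup>D C(z)\<close>. On a nonconstant curve
  in a level set \<open>y\<close> is constant, therefore \<open>z\<close> is not, and \<open>C\<close> has degree \<open>0\<close>.\<close>

lemma variable_newton_bound:
  assumes var: "is_variable (emb_yz g :: complex poly poly poly)"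
    and nc: "coeff (coeff g j0) i0 \<noteq> 0" "i0 > 0"
  shows "degree (coeff g 0) > 0 \<and> (\<forall>j\<ge>1. \<forall>i. coeff (coeff g j) i \<noteq> 0 \<longrightarrow> i < degree (coeff g 0))"
proof -
  define S where "S = snd ` {(j, i). coeff (coeff g j) i \<noteq> 0}"
  have fS: "finite S" unfolding S_def by (intro finite_imageI finite_support2)
  have inS: "coeff (coeff g j) i \<noteq> 0 \<Longrightarrow> i \<in> S" for i j by (force simp: S_def)
  define D where "D = Max S"
  have D: "coeff (coeff g j) i \<noteq> 0 \<Longrightarrow> i \<le> D" for i j
    using inS fS by (auto simp: D_def)
  have Dpos: "D > 0" using D[OF nc(1)] nc(2) by simp
  have "D \<in> S" unfolding D_def using fS inS[OF nc(1)] by (intro Max_in) auto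
  then obtain j1 where j1: "coeff (coeff g j1) D \<noteq> 0" by (auto simp: S_def)
  let ?gb = "wt_top 1 0 (real D) g"
  define C where "C = map_poly (\<lambda>q. coeff q D) g"
  have cC: "coeff C j = coeff (coeff g j) D" for j by (simp add: C_def coeff_map_poly)
  have gb: "pt2 ?gb y z = y ^ D * poly C z" for y z
  proof -
    have "?gb = monom (monom 1 D) 0 * map_poly (\<lambda>c. [:c:]) C"
      by (auto simp: poly_eq_iff coeff_wt_top coeff_monom_mult cC coeff_map_poly monom_0 smult_monom
        coeff_pCons coeff_monom split: nat.splits)
    moreover have "pt2 (map_poly (\<lambda>c. [:c:]) C) y z = poly C z"
      unfolding ev2_def evp_map_poly[OF ring_hom_const ring_hom_evp[OF ring_hom_id]]
      by (simp add: evp_const ring_hom_id evp_id)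
    ultimately show ?thesis by (simp add: ring_homD[OF ring_hom_pt2] pt2_monom del: monom_0)
  qed
  have "coeff (coeff ?gb j1) D \<noteq> 0" using j1 by (simp add: coeff_wt_top)
  then have gb0: "?gb \<noteq> 0" by auto
  obtain Y Z where YZ: "\<And>y z t. pt2 g (pt3 Y y z t) (pt3 Z y z t) = pt2 g y z"
    "\<And>y z. pt3 Y y z 0 = y" "\<And>y z. pt3 Z y z 0 = z" "\<not> (\<forall>y z t. pt3 Y y z t = y \<and> pt3 Z y z t = z)"
    using variable_level_curves[OF var] by blast
  obtain U V k where UV: "\<And>t. pt2 ?gb (poly U t) (poly V t) = k" "k \<noteq> 0" "degree U \<noteq> 0 \<or> degree V \<noteq> 0"
    using level_curve_degeneration[OF YZ, of 1 0 "real D"] gb0 D by auto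
  have "poly (U ^ D * pcompose C V - [:k:]) t = 0" for t
    using UV(1)[of t] by (simp add: gb poly_pcompose)
  then have "U ^ D * pcompose C V = [:k:]" using poly_all_0_iff_0 by (metis right_minus_eq)
  then have dd: "degree (U ^ D * pcompose C V) = 0" "U ^ D * pcompose C V \<noteq> 0" using UV(2) by auto
  then have "degree (U ^ D) = 0" "degree (pcompose C V) = 0"
    using degree_mult_eq[of "U ^ D" "pcompose C V"] by auto
  then have "degree U = 0" "degree C * degree V = 0"
    using degree_power_const[of U D] Dpos by (auto simp: degree_pcompose)
  then have "degree C = 0" using UV(3) by simp
  then have *: "coeff (coeff g j) D = 0" if "j \<ge> 1" for j
    using that cC[of j] by (metis coeff_eq_0 le_less_trans less_numeral_extra(1) not_le less_le_trans)
  then have "j1 = 0" using j1 by (metis less_one not_le)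
  then have "degree (coeff g 0) = D"
    using j1 D by (intro antisym le_degree) (auto simp: degree_le not_le, metis leading_coeff_0_iff D degree_0 le_degree Dpos not_gr0 le0)
  moreover have "i < D" if "j \<ge> 1" "coeff (coeff g j) i \<noteq> 0" for i j
    using D[OF that(2)] *[OF that(1)] that(2) by (cases "i = D") auto
  ultimately show ?thesis using Dpos by blast
qed

text \<open>The bound \<open>B\<close> on the slopes \<open>j / (d - i)\<close> of the Newton polygon, seen from its vertex \<open>(d, 0)\<close>,
  drives the induction. The steepest edge, of slope \<open>m / n\<close> in lowest terms, carries a power of
  \<open>z\<^sup>m - x y\<^sup>n\<close>. If \<open>m = 1\<close>, the monomial \<open>y\<^sup>d\<^sup>-\<^sup>n z\<close> occurs in \<open>g\<close>, so \<open>n = d\<close> because the coefficient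
  of \<open>z\<close> is constant, and no other monomial with \<open>z\<close> fits below the edge. If \<open>n = 1\<close> and \<open>m \<ge> 2\<close>, the
  shear by \<open>z\<^sup>m / x\<close> removes the edge, and all slopes become smaller than \<open>m\<close>.\<close>

lemma variable_shape_induct:
  assumes "is_variable (emb_yz g :: complex poly poly poly)" "coeff g 1 = [:c:]" "c \<noteq> 0"
    "degree (coeff g 0) > 0"
    "\<forall>j\<ge>1. \<forall>i. coeff (coeff g j) i \<noteq> 0 \<longrightarrow> i < degree (coeff g 0) \<and> j < B * (degree (coeff g 0) - i)"
  shows "\<exists>R. coeff R 0 = 0 \<and> coeff R 1 = 0 \<and> (\<forall>y z. pt2 g y z = c * z + poly (coeff g 0) (y - poly R z))"
  using assms
proof (induction B arbitrary: g rule: less_induct)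
  case (less B)
  note var = less.prems(1) and c1 = less.prems(2) and c0 = less.prems(3)
  define d where "d = degree (coeff g 0)"
  have dpos: "d > 0" using less.prems(4) by (simp add: d_def)
  have bd: "i < d" "j < B * (d - i)" if "j \<ge> 1" "coeff (coeff g j) i \<noteq> 0" for i j
    using less.prems(5) that by (auto simp: d_def)
  have bd0: "i \<le> d" if "coeff (coeff g j) i \<noteq> 0" for i j
    using bd[of j i] that by (cases "j = 0") (auto simp: d_def le_degree)
  define S where "S = {(j, i). coeff (coeff g j) i \<noteq> 0} \<inter> {(j, i). j \<ge> 1}"
  have fS: "finite S" unfolding S_def using finite_support2 by blast
  have "(1, 0) \<in> S" using c1 c0 by (simp add: S_def)
  define sl where "sl = (\<lambda>(j::nat, i). real j / real (d - i))"
  define \<mu> where "\<mu> = Max (sl ` S)"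
  obtain j1 i1 where s1: "(j1, i1) \<in> S" "sl (j1, i1) = \<mu>"
    using Max_in[of "sl ` S"] fS \<open>(1, 0) \<in> S\<close> unfolding \<mu>_def by fastforce
  have j1: "j1 \<ge> 1" "coeff (coeff g j1) i1 \<noteq> 0" "i1 < d" using s1 bd by (auto simp: S_def)
  define G where "G = gcd j1 (d - i1)"
  define m where "m = j1 div G"
  define n where "n = (d - i1) div G"
  have G: "G > 0" using j1 by (simp add: G_def)
  have jm: "j1 = m * G" and dn: "d - i1 = n * G" by (simp_all add: m_def n_def G_def)
  have mn: "m > 0" "n > 0" using jm dn j1 by (auto intro!: gr0I)
  have cop: "coprime m n" unfolding m_def n_def G_def using j1 by (intro div_gcd_coprime) auto
  have \<mu>: "\<mu> = real m / real n"
    using s1(2) G mn by (simp add: sl_def jm dn)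
  have edge: "j * n \<le> m * (d - i)" if nz: "coeff (coeff g j) i \<noteq> 0" for i j
  proof (cases "j = 0")
    case False
    then have "(j, i) \<in> S" using nz by (simp add: S_def)
    then have "sl (j, i) \<le> \<mu>" using fS by (simp add: \<mu>_def)
    moreover have "d - i > 0" using bd[OF _ nz] False by simp
    ultimately have "real j * real n \<le> real m * real (d - i)"
      unfolding \<mu> sl_def using mn by (simp add: field_simps)
    then show ?thesis by (simp flip: of_nat_mult)
  qed simp
  have wt: "real m * real i + real n * real j \<le> real m * real d" if nz: "coeff (coeff g j) i \<noteq> 0" for i j
  proof -
    have "m * i + n * j \<le> m * i + m * (d - i)" using edge[OF nz] by (simp add: mult.commute)
    also have "\<dots> = m * d" using bd0[OF nz] by (simp flip: add_mult_distrib2)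
    finally show ?thesis by (simp flip: of_nat_mult of_nat_add)
  qed
  let ?gb = "wt_top (real m) (real n) (real m * real d) g"
  define ck where "ck = (\<lambda>k. if n * k \<le> d then coeff (coeff g (m * k)) (d - n * k) else 0)"
  have on_edge: "\<exists>k. j = m * k \<and> i = d - n * k \<and> n * k \<le> d"
    if "real m * real i + real n * real j = real m * real d" "i \<le> d" for i j
  proof -
    have "real (m * i + n * j) = real (m * d)" using that(1) by simp
    then have e: "m * i + n * j = m * d" by (simp only: of_nat_eq_iff)
    have e2: "n * j = m * (d - i)" using e that(2) by (simp add: diff_mult_distrib2)
    then have "m dvd n * j" by simp
    then have "m dvd j" using cop by (simp add: coprime_dvd_mult_right_iff)
    then obtain k where k: "j = m * k" by blast
    then have "n * k = d - i" using e2 mn by (metis mult.left_commute mult_cancel1 not_gr_zero)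
    then show ?thesis using k that(2) by (intro exI[of _ k]) auto
  qed
  define K where "K = d div n"
  have ck0: "ck k = 0" if "k > K" for k
  proof -
    have "\<not> n * k \<le> d" using that mn by (simp add: K_def div_less_iff_less_mult not_le mult.commute)
    then show ?thesis by (simp add: ck_def)
  qed
  have ckd: "ck 0 \<noteq> 0" using dpos by (simp add: ck_def d_def) (metis degree_0 leading_coeff_0_iff not_gr0)
  have ckG: "ck G \<noteq> 0"
  proof -
    have "n * G \<le> d" "d - n * G = i1" using dn j1 by auto
    then show ?thesis using j1 jm by (simp add: ck_def)
  qed
  define e where "e = (\<Sum>k\<le>K. monom (ck k) k)"
  have ce: "coeff e k = ck k" for k
    using ck0[of k] by (auto simp: e_def coeff_sum not_le)
  have e_deg: "degree e > 0" using ckG G ce by (metis le_degree le_zero_eq not_gr0)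
  have nK: "n * degree e \<le> d"
  proof -
    have "ck (degree e) \<noteq> 0" using e_deg ce by (metis degree_0 leading_coeff_0_iff not_gr0)
    then show ?thesis by (auto simp: ck_def split: if_splits)
  qed
  have gbe: "pt2 ?gb y z = (\<Sum>k\<le>degree e. coeff e k * y ^ (d - n * k) * z ^ (m * k))" for y z
  proof -
    have "?gb = (\<Sum>k\<le>degree e. monom (monom (ck k) (d - n * k)) (m * k))"
    proof (rule poly_eqI, rule poly_eqI)
      fix j i
      have R: "coeff (coeff (\<Sum>k\<le>degree e. monom (monom (ck k) (d - n * k)) (m * k)) j) i =
          (\<Sum>k\<le>degree e. if m * k = j \<and> d - n * k = i then ck k else 0)"
        unfolding coeff_sum by (intro sum.cong refl) (auto simp: coeff_monom)
      have nk: "n * k \<le> d" if "k \<le> degree e" for k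
        using that nK by (meson le_trans mult_le_mono2)
      show "coeff (coeff ?gb j) i = coeff (coeff (\<Sum>k\<le>degree e. monom (monom (ck k) (d - n * k)) (m * k)) j) i"
      proof (cases "real m * real i + real n * real j = real m * real d \<and> i \<le> d")
        case True
        then obtain k0 where k0: "j = m * k0" "i = d - n * k0" "n * k0 \<le> d" using on_edge by blast
        have "(\<Sum>k\<le>degree e. if m * k = j \<and> d - n * k = i then ck k else 0) =
            (\<Sum>k\<le>degree e. if k = k0 then ck k0 else 0)"
          using k0 mn by (intro sum.cong refl) auto
        also have "\<dots> = ck k0" using ce[of k0] by (auto simp: coeff_eq_0 not_le)
        finally show ?thesis unfolding R coeff_wt_top using True k0 by (auto simp: ck_def)
      next
        case False
        have "\<not> (m * k = j \<and> d - n * k = i)" if "k \<le> degree e" for k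
        proof
          assume k: "m * k = j \<and> d - n * k = i"
          then have "i \<le> d" "m * i + n * j = m * d"
            using nk[OF that] by (auto simp: diff_mult_distrib2 mult.left_commute)
          moreover have "real (m * i + n * j) = real (m * d) \<longleftrightarrow> real m * real i + real n * real j = real m * real d" by simp
          ultimately show False using False by metis
        qed
        then have "(\<Sum>k\<le>degree e. if m * k = j \<and> d - n * k = i then ck k else 0) = 0"
          by (intro sum.neutral) auto
        moreover have "coeff (coeff ?gb j) i = 0"
          using False bd0[of j i] by (auto simp: coeff_wt_top)
        ultimately show ?thesis unfolding R by simp
      qed
    qed
    then show ?thesis by (simp add: ring_hom_sum[OF ring_hom_pt2] pt2_monom ce)
  qed
  have "coeff (coeff ?gb j1) i1 \<noteq> 0"
  proof -
    have "m * i1 + n * j1 = m * i1 + m * (d - i1)" using jm dn by simp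
    also have "\<dots> = m * d" using j1 by (simp flip: add_mult_distrib2)
    finally have "real m * real i1 + real n * real j1 = real m * real d" by (simp flip: of_nat_mult of_nat_add)
    then show ?thesis using j1 by (simp add: coeff_wt_top)
  qed
  then have gb0: "?gb \<noteq> 0" by auto
  obtain Y Z where YZ: "\<And>y z t. pt2 g (pt3 Y y z t) (pt3 Z y z t) = pt2 g y z"
    "\<And>y z. pt3 Y y z 0 = y" "\<And>y z. pt3 Z y z 0 = z" "\<not> (\<forall>y z t. pt3 Y y z t = y \<and> pt3 Z y z t = z)"
    using variable_level_curves[OF var] by blast
  obtain U V k where UV: "\<And>t. pt2 ?gb (poly U t) (poly V t) = k" "k \<noteq> 0" "degree U \<noteq> 0 \<or> degree V \<noteq> 0"
    using level_curve_degeneration[OF YZ wt gb0] by blast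
  obtain x where x: "x \<noteq> 0" "e = smult (lead_coeff e) ([:-x, 1:] ^ degree e)" "d = n * degree e" "m = 1 \<or> n = 1"
    using edge_single_root[OF refl e_deg _ mn nK UV(1)[unfolded gbe] UV(2,3)] ckd ce by metis
  show ?case
  proof (cases "m = 1")
    case True
    have "coeff e 1 \<noteq> 0"
    proof -
      have "poly (pderiv e) 0 \<noteq> 0"
        using e_deg x(1) by (subst x(2)) (auto simp: pderiv_smult pderiv_power pderiv_pCons)
      then show ?thesis by (simp add: poly_0_coeff_0 coeff_pderiv)
    qed
    then have "coeff (coeff g 1) (d - n) \<noteq> 0" and nd: "n \<le> d" by (auto simp: ce ck_def True split: if_splits)
    then have "d = n" by (auto simp: c1[simplified] coeff_pCons split: nat.splits)
    have hi: "coeff g j = 0" if "j \<ge> 2" for j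
    proof (rule ccontr)
      assume "coeff g j \<noteq> 0"
      then obtain i where i: "coeff (coeff g j) i \<noteq> 0" by (auto simp: poly_eq_iff)
      have "j * d \<le> d - i" using edge[OF i] True \<open>d = n\<close> by simp
      moreover have "2 * d \<le> j * d" using that by simp
      ultimately show False using dpos by linarith
    qed
    have "g = [:coeff g 0, [:c:]:]"
      using hi c1 by (auto simp: poly_eq_iff coeff_pCons numeral_2_eq_2 split: nat.splits)
    then have "pt2 g y z = pt2 [:coeff g 0, [:c:]:] y z" for y z by simp
    then have "pt2 g y z = c * z + poly (coeff g 0) (y - poly 0 z)" for y z
      unfolding ev2_def evp_id evp_pCons[OF ring_hom_evp[OF ring_hom_id, unfolded evp_id]] by simp
    then show ?thesis by (intro exI[of _ 0]) simp
  next
    case False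
    then have n1: "n = 1" and m2: "m \<ge> 2" using x(4) mn by auto
    have dK: "d = degree e" using x(3) n1 by simp
    define ga where "ga = 1 / x"
    let ?g1 = "shear ga m g"
    have c0': "coeff ?g1 0 = coeff g 0" and c1': "coeff ?g1 1 = [:c:]"
      using coeff_shear_low[OF m2, of _ ga g] c1 by auto
    have gbs: "shear ga m ?gb = monom (monom (lead_coeff e * (- x) ^ d) d) 0"
    proof -
      have inf: "infinite (UNIV - {0::complex})" using infinite_complex by simp
      have *: "pt2 ?gb y z = lead_coeff e * (z ^ m - x * y) ^ d" for y z
      proof -
        have "?gb - [:[:lead_coeff e:]:] * (monom [:1:] m - [:[:x:]:] * [:[:0, 1:]:]) ^ d = 0"
        proof (rule pt2_vanish[OF inf inf])
          fix y z :: complex assume "y \<in> UNIV - {0}"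
          then have y: "y \<noteq> 0" by simp
          have "pt2 ?gb y z = (\<Sum>k\<le>d. coeff e k * y ^ (d - k) * z ^ (m * k))" unfolding gbe by (simp add: n1 dK)
          also have "\<dots> = (\<Sum>k\<le>d. y ^ d * (coeff e k * (z ^ m / y) ^ k))"
          proof (intro sum.cong refl)
            fix k assume "k \<in> {..d}"
            then have "y ^ d = y ^ (d - k) * y ^ k" by (simp flip: power_add)
            then show "coeff e k * y ^ (d - k) * z ^ (m * k) = y ^ d * (coeff e k * (z ^ m / y) ^ k)"
              using y by (simp add: power_divide power_mult)
          qed
          also have "\<dots> = y ^ d * poly e (z ^ m / y)" by (simp add: poly_altdef dK sum_distrib_left)
          also have "poly e (z ^ m / y) = lead_coeff e * (z ^ m / y - x) ^ d"
            by (subst x(2)) (simp add: dK)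
          also have "y ^ d * (lead_coeff e * (z ^ m / y - x) ^ d) = lead_coeff e * (y * (z ^ m / y - x)) ^ d"
            by (simp add: power_mult_distrib)
          also have "y * (z ^ m / y - x) = z ^ m - x * y" using y by (simp add: algebra_simps)
          finally show "pt2 (?gb - [:[:lead_coeff e:]:] * (monom [:1:] m - [:[:x:]:] * [:[:0, 1:]:]) ^ d) y z = 0"
            by (simp add: ring_homD[OF ring_hom_pt2] pt2_atoms del: mult_pCons_left mult_pCons_right)
        qed
        then have "?gb = [:[:lead_coeff e:]:] * (monom [:1:] m - [:[:x:]:] * [:[:0, 1:]:]) ^ d" by simp
        then show ?thesis
          by (simp add: ring_homD[OF ring_hom_pt2] pt2_atoms del: mult_pCons_left mult_pCons_right)
      qed
      show ?thesis
      proof (rule pt2_eqI)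
        fix y z
        have sub: "z ^ m - x * (y + ga * z ^ m) = - x * y" using x(1) by (simp add: ga_def algebra_simps)
        show "pt2 (shear ga m ?gb) y z = pt2 (monom (monom (lead_coeff e * (- x) ^ d) d) 0) y z"
          unfolding pt2_shear * pt2_monom sub power_mult_distrib by simp
      qed
    qed
    have rest: "wt_le m (m * d - 1) (shear ga m (g - ?gb))"
    proof (rule wt_le_shear)
      show "wt_le m (m * d - 1) (g - ?gb)"
        unfolding wt_le_def
      proof (intro allI impI)
        fix i j assume "coeff (coeff (g - ?gb) j) i \<noteq> 0"
        then have nz: "coeff (coeff g j) i \<noteq> 0" and ne: "real m * real i + real n * real j \<noteq> real m * real d"
          by (auto simp: coeff_wt_top split: if_splits)
        have "real (m * i + j) < real (m * d)" using wt[OF nz] ne n1 by (auto simp: less_le)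
        then have "m * i + j < m * d" by (simp only: of_nat_less_iff)
        then show "m * i + j \<le> m * d - 1" by linarith
      qed
    qed
    have g1: "?g1 = monom (monom (lead_coeff e * (- x) ^ d) d) 0 + shear ga m (g - ?gb)"
      unfolding ring_homD(6)[OF ring_hom_shear] gbs by simp
    have nb: "i < d \<and> j < m * (d - i)" if "j \<ge> 1" "coeff (coeff ?g1 j) i \<noteq> 0" for i j
    proof -
      have "coeff (coeff (shear ga m (g - ?gb)) j) i \<noteq> 0"
        using that unfolding g1 by (simp add: coeff_monom del: monom_0)
      then have le: "m * i + j \<le> m * d - 1" using rest by (simp add: wt_le_def)
      moreover have md: "m * d > 0" using mn dpos by simp
      ultimately have lt: "m * i + j < m * d" by linarith
      then have "m * i < m * d" by linarith
      then have "i < d" by simp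
      moreover have "m * d = m * i + m * (d - i)" using \<open>i < d\<close> by (simp flip: add_mult_distrib2)
      ultimately show ?thesis using lt by linarith
    qed
    have "m < B"
    proof -
      have "m * G < B * G" using bd(2)[OF j1(1,2)] jm dn n1 by simp
      then show ?thesis by simp
    qed
    from less.IH[OF this variable_shear[OF var, of ga m] c1' c0]
    obtain R where R: "coeff R 0 = 0" "coeff R 1 = 0"
      "\<And>y z. pt2 ?g1 y z = c * z + poly (coeff g 0) (y - poly R z)"
      using nb dpos by (auto simp: c0' d_def)
    have "pt2 g y z = c * z + poly (coeff g 0) (y - poly (R + monom ga m) z)" for y z
      using R(3)[of "y - ga * z ^ m" z] by (simp add: pt2_shear poly_monom algebra_simps)
    then show ?thesis using R m2 by (intro exI[of _ "R + monom ga m"]) (auto simp: coeff_monom)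
  qed
qed

theorem variable_shape:
  assumes "is_variable (emb_yz g :: complex poly poly poly)" "coeff g 1 = [:c:]" "c \<noteq> 0"
  shows "\<exists>R. coeff R 0 = 0 \<and> coeff R 1 = 0 \<and> (\<forall>y z. pt2 g y z = c * z + poly (coeff g 0) (y - poly R z))"
proof (cases "\<exists>j i. coeff (coeff g j) i \<noteq> 0 \<and> i > 0")
  case True
  then have nb: "degree (coeff g 0) > 0" "\<forall>j\<ge>1. \<forall>i. coeff (coeff g j) i \<noteq> 0 \<longrightarrow> i < degree (coeff g 0)"
    using variable_newton_bound[OF assms(1)] by blast+
  have "j < Suc (degree g) * (degree (coeff g 0) - i)" if "j \<ge> 1" "coeff (coeff g j) i \<noteq> 0" for i j
  proof -
    have "j \<le> degree g" using that(2) by (intro le_degree) auto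
    then have "j < Suc (degree g) * 1" by simp
    moreover have "degree (coeff g 0) - i \<ge> 1" using nb(2) that by force
    then have "Suc (degree g) * 1 \<le> Suc (degree g) * (degree (coeff g 0) - i)" by (rule mult_le_mono2)
    ultimately show ?thesis by (rule less_le_trans)
  qed
  then show ?thesis using variable_shape_induct[OF assms nb(1), of "Suc (degree g)"] nb(2) by blast
next
  case False
  then have "degree (coeff g j) = 0" for j by (metis coeff_0 degree_0 leading_coeff_0_iff not_gr0)
  from variable_in_z[OF assms(1,2) this] have "pt2 g y z = poly (coeff g 0) (y - poly 0 z) + c * z" for y z by simp
  then show ?thesis by (intro exI[of _ 0]) (simp add: add.commute)
qed

section \<open>Specialization\<close>

definition spec_yz :: "complex \<Rightarrow> complex poly poly poly \<Rightarrow> complex poly poly"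
  where "spec_yz l g = map_poly (specialize_xy l) g"

abbreviation at_x :: "complex \<Rightarrow> complex poly \<Rightarrow> complex"
  where "at_x l \<equiv> (\<lambda>c. poly c l)"

lemma ring_hom_at_x: "ring_hom (at_x l)"
  by (simp add: ring_hom_def)

lemma ring_hom_specialize_xy: "ring_hom (specialize_xy l)"
  unfolding specialize_xy_def[abs_def] by (rule ring_hom_map_poly[OF ring_hom_at_x])

lemma ring_hom_spec_yz: "ring_hom (spec_yz l)"
  unfolding spec_yz_def[abs_def] by (rule ring_hom_map_poly[OF ring_hom_specialize_xy])

lemma specialize_x_eq: "specialize_x l p = map_poly (spec_yz l) p"
  by (simp add: specialize_x_def spec_yz_def[abs_def] specialize_xy_def[abs_def])

lemma ring_hom_specialize_x: "ring_hom (specialize_x l)"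
  unfolding specialize_x_eq[abs_def] by (rule ring_hom_map_poly[OF ring_hom_spec_yz])

lemma coeff_specialize_xy: "coeff (specialize_xy l P) n = poly (coeff P n) l"
  by (simp add: specialize_xy_def coeff_map_poly)

lemma coeff_spec_yz: "coeff (spec_yz l g) n = specialize_xy l (coeff g n)"
  by (simp add: spec_yz_def coeff_map_poly ring_homD[OF ring_hom_specialize_xy])

lemma coeff_specialize_x: "coeff (specialize_x l P) n = spec_yz l (coeff P n)"
  by (simp add: specialize_x_eq coeff_map_poly ring_homD[OF ring_hom_spec_yz])

lemma poly_specialize_xy: "poly (specialize_xy l P) y = evp (at_x l) P y"
  by (simp add: specialize_xy_def evp_def)

lemma pt2_spec_yz: "pt2 (spec_yz l g) y z = ev2 (at_x l) g y z"
  unfolding ev2_def spec_yz_def evp_map_poly[OF ring_hom_specialize_xy ring_hom_evp[OF ring_hom_id]]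
  by (simp add: evp_id poly_specialize_xy)

lemma pt3_specialize_x: "pt3 (specialize_x l P) y z u = ev3 (at_x l) P y z u"
  unfolding ev3_def specialize_x_eq evp_map_poly[OF ring_hom_spec_yz ring_hom_pt2]
  by (simp add: pt2_spec_yz)

lemma specialize_atoms:
  "specialize_x l (emb_base c) = emb_base (poly c l)"
  "specialize_x l (emb_y P) = emb_y (specialize_xy l P)"
  "specialize_x l (emb_yz g) = emb_yz (spec_yz l g)"
  "specialize_x l var_y = var_y" "specialize_x l var_z = var_z" "specialize_x l var_u = var_u"
  by (simp_all add: specialize_x_eq spec_yz_def specialize_xy_def emb_base_def emb_y_def emb_yz_def
    var_y_def var_z_def var_u_def map_poly_pCons)

lemma at_atoms:
  "ev3 (at_x l) (emb_base c) y z u = poly c l"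
  "ev3 (at_x l) (emb_y P) y z u = poly (specialize_xy l P) y"
  "ev3 (at_x l) (emb_yz g) y z u = pt2 (spec_yz l g) y z"
  "ev3 (at_x l) var_y y z u = y" "ev3 (at_x l) var_z y z u = z" "ev3 (at_x l) var_u y z u = u"
  by (simp_all add: pt3_specialize_x[symmetric] specialize_atoms pt3_simps)

lemmas ring_hom_at = ring_hom_ev3[OF ring_hom_at_x]

lemma at_evp: "ev3 (at_x l) (evp emb_base P a) y z u = poly (specialize_xy l P) (ev3 (at_x l) a y z u)"
  unfolding evp_comp[OF ring_hom_emb_base ring_hom_at] at_atoms poly_specialize_xy ..

lemma specialize_xy_0_dvd: "specialize_xy l P = 0 \<Longrightarrow> [:[:-l, 1:]:] dvd P"
  unfolding const_poly_dvd_iff by (metis coeff_0 coeff_specialize_xy poly_eq_0_iff_dvd)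

lemma spec_yz_0_dvd: "spec_yz l g = 0 \<Longrightarrow> [:[:[:-l, 1:]:]:] dvd g"
  unfolding const_poly_dvd_iff[of "[:[:-l, 1:]:]"] by (metis coeff_0 coeff_spec_yz specialize_xy_0_dvd)

lemma cofinite_infinite: "finite F \<Longrightarrow> infinite (- F :: complex set)"
  using infinite_complex by (simp add: finite_compl)

lemma poly_infinite_zero:
  fixes P :: "complex poly" assumes "finite F" "\<And>l. l \<notin> F \<Longrightarrow> poly P l = 0" shows "P = 0"
  by (rule pt1_vanish[OF cofinite_infinite[OF assms(1)]]) (use assms(2) in auto)

lemma specialize_xy_eqI:
  assumes "finite F" "\<And>l. l \<notin> F \<Longrightarrow> specialize_xy l P = specialize_xy l Q" shows "P = Q"
proof -
  have "coeff P n - coeff Q n = 0" for n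
    by (rule poly_infinite_zero[OF assms(1)]) (metis assms(2) coeff_specialize_xy eq_iff_diff_eq_0 poly_diff)
  then show ?thesis by (simp add: poly_eq_iff)
qed

lemma spec_yz_eqI:
  assumes "finite F" "\<And>l. l \<notin> F \<Longrightarrow> spec_yz l P = spec_yz l Q" shows "P = Q"
proof (rule poly_eqI)
  fix n show "coeff P n = coeff Q n"
    by (rule specialize_xy_eqI[OF assms(1)]) (metis assms(2) coeff_spec_yz)
qed

lemma specialize_x_eqI:
  assumes "finite F" "\<And>l. l \<notin> F \<Longrightarrow> specialize_x l P = specialize_x l Q" shows "P = Q"
proof (rule poly_eqI)
  fix n show "coeff P n = coeff Q n"
    by (rule spec_yz_eqI[OF assms(1)]) (metis assms(2) coeff_specialize_x)
qed

lemma at_eqI: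
  assumes "finite F" "\<And>l y z u. l \<notin> F \<Longrightarrow> ev3 (at_x l) P y z u = ev3 (at_x l) Q y z u" shows "P = Q"
  by (rule specialize_x_eqI[OF assms(1)], rule pt3_eqI) (simp add: pt3_specialize_x assms(2))

lemma ring_hom_lift: "ring_hom (\<lambda>k::complex. emb_base [:k:])"
  by (rule ring_hom_comp[OF ring_hom_const ring_hom_emb_base])

lemma evp_in_subring:
  assumes S: "subring S" and "ring_hom i" "\<And>c. i c \<in> S" "a \<in> S" shows "evp i P a \<in> S"
proof (induction P)
  case 0 then show ?case using S by (simp add: subringD)
next
  case (pCons c P)
  then show ?case unfolding evp_pCons[OF assms(2)]
    by (intro subringD(6)[OF S] subringD(4)[OF S] assms)
qed

lemma evp_over: "over S \<Longrightarrow> a \<in> S \<Longrightarrow> evp emb_base P a \<in> S"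
  by (rule evp_in_subring) (auto simp: ring_hom_emb_base)

lemma ev2_over: "over S \<Longrightarrow> a \<in> S \<Longrightarrow> b \<in> S \<Longrightarrow> ev2 emb_base P a b \<in> S"
  unfolding ev2_def by (rule evp_in_subring) (auto simp: ring_hom_emb_base ring_hom_evp evp_over)

lemma evp_lift_over: "over S \<Longrightarrow> a \<in> S \<Longrightarrow> evp (\<lambda>k. emb_base [:k:]) P a \<in> S"
  by (rule evp_in_subring) (auto simp: ring_hom_lift)

text \<open>Constants of the fibre \<open>x = l\<close> are lifted to \<open>A\<close> by the embedding \<open>k \<mapsto> emb_base [:k:]\<close>.\<close>

lemma evp_spec_cong:
  assumes "over S" "a \<in> S"
  shows "cong_in S (pix l) (evp emb_base P a) (evp (\<lambda>k. emb_base [:k:]) (specialize_xy l P) a)"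
proof -
  let ?L = "map_poly (\<lambda>k. [:k:]) (specialize_xy l P)"
  have "specialize_xy l (P - ?L) = 0"
    by (simp add: poly_eq_iff coeff_specialize_xy coeff_map_poly)
  then obtain Q where "P - ?L = [:[:-l, 1:]:] * Q" using specialize_xy_0_dvd by (blast elim: dvdE)
  then have P: "P = ?L + [:[:-l, 1:]:] * Q" by (simp add: diff_eq_eq add.commute)
  have "evp emb_base P a = evp emb_base ?L a + pix l * evp emb_base Q a"
    by (subst P) (simp only: evp_add[OF ring_hom_emb_base] evp_mult[OF ring_hom_emb_base] evp_const[OF ring_hom_emb_base])
  moreover have "evp emb_base ?L a = evp (\<lambda>k. emb_base [:k:]) (specialize_xy l P) a"
    by (rule evp_map_poly[OF ring_hom_const ring_hom_emb_base])
  ultimately show ?thesis unfolding cong_in_def using evp_over[OF assms] by auto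
qed

lemma base_spec_cong:
  assumes "over S" shows "cong_in S (pix l) (emb_base c) (emb_base [:poly c l:])"
proof -
  have "[:-l, 1:] dvd c - [:poly c l:]" by (simp flip: poly_eq_0_iff_dvd)
  then obtain k where "c - [:poly c l:] = [:-l, 1:] * k" by (rule dvdE)
  then have "emb_base c - emb_base [:poly c l:] = pix l * emb_base k" by (metis emb_base_simps(2,3))
  then show ?thesis unfolding cong_in_def using assms by auto
qed

section \<open>Subalgebras given by generators\<close>

definition gen :: "complex poly poly poly poly set \<Rightarrow> complex poly poly poly poly set"
  where "gen X = rhull (range emb_base \<union> X)"

lemma over_gen [simp]: "subring (gen X)" "range emb_base \<subseteq> gen X"
  by (auto simp: gen_def intro: rhull_incl)

lemma gen_incl: "x \<in> X \<Longrightarrow> x \<in> gen X"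
  by (auto simp: gen_def intro: rhull_incl)

lemma gen_ops:
  "emb_base c \<in> gen X" "1 \<in> gen X" "0 \<in> gen X"
  "a \<in> gen X \<Longrightarrow> b \<in> gen X \<Longrightarrow> a + b \<in> gen X" "a \<in> gen X \<Longrightarrow> b \<in> gen X \<Longrightarrow> a - b \<in> gen X"
  "a \<in> gen X \<Longrightarrow> b \<in> gen X \<Longrightarrow> a * b \<in> gen X" "a \<in> gen X \<Longrightarrow> - a \<in> gen X" "a \<in> gen X \<Longrightarrow> a ^ n \<in> gen X"
  by (auto simp: subringD) (auto simp: gen_def intro: rhull_incl)

lemmas gen_intros = gen_incl gen_ops

lemma gen_evp: "a \<in> gen X \<Longrightarrow> evp emb_base P a \<in> gen X"
  by (intro evp_over) auto

lemma gen_ev2: "a \<in> gen X \<Longrightarrow> b \<in> gen X \<Longrightarrow> ev2 emb_base P a b \<in> gen X"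
  by (intro ev2_over) auto

lemma gen_subset_iff: "gen X \<subseteq> gen Y \<longleftrightarrow> X \<subseteq> gen Y"
  unfolding gen_def[of X] using over_gen[of Y]
  by (metis (no_types, opaque_lifting) Un_subset_iff gen_def rhull_subset_iff)

lemma gen_eqI: "X \<subseteq> gen Y \<Longrightarrow> Y \<subseteq> gen X \<Longrightarrow> gen X = gen Y"
  using gen_subset_iff by blast

lemma gen_mono: "X \<subseteq> Y \<Longrightarrow> gen X \<subseteq> gen Y"
  unfolding gen_subset_iff by (auto intro: gen_intros)

lemma rhull_insert_gen: "rhull (insert v (gen X)) = gen (insert v X)"
  unfolding gen_def rhull_insert_rhull by (rule arg_cong[of _ _ rhull]) auto

lemma rhull_insert2_gen: "rhull (insert v (insert t (gen X))) = gen (insert v (insert t X))"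
  by (metis rhull_insert_gen rhull_insert_rhull)

lemma gen_over: "X \<subseteq> S \<Longrightarrow> over S \<Longrightarrow> gen X \<subseteq> S"
  unfolding gen_def by (intro rhull_least) auto

lemma gen_is_ev3: "x \<in> gen {a, b, c} \<Longrightarrow> \<exists>P. x = ev3 emb_base P a b c"
proof -
  let ?S = "range (\<lambda>P. ev3 emb_base P a b c)"
  note h = ring_hom_ev3[OF ring_hom_emb_base, of a b c]
  have "subring ?S" unfolding subring_def
  proof (intro conjI ballI)
    show "1 \<in> ?S" using ring_homD(1)[OF h] by (rule range_eqI[OF sym])
    fix x y assume "x \<in> ?S" "y \<in> ?S"
    then obtain P Q where "x = ev3 emb_base P a b c" "y = ev3 emb_base Q a b c" by blast
    then show "x - y \<in> ?S" "x * y \<in> ?S"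
      using range_eqI[of _ "\<lambda>P. ev3 emb_base P a b c" "P - Q"] range_eqI[of _ "\<lambda>P. ev3 emb_base P a b c" "P * Q"]
      by (simp_all add: ring_homD(3,6)[OF h])
  qed
  moreover have "emb_base k \<in> ?S" for k
    by (rule range_eqI[where x = "emb_base k"]) (simp add: ev3_emb_base ring_hom_emb_base)
  moreover have "a \<in> ?S" "b \<in> ?S" "c \<in> ?S"
    by (rule range_eqI[where x = var_y], simp add: ev3_vars ring_hom_emb_base)
      (rule range_eqI[where x = var_z], simp add: ev3_vars ring_hom_emb_base,
       rule range_eqI[where x = var_u], simp add: ev3_vars ring_hom_emb_base)
  ultimately have "gen {a, b, c} \<subseteq> ?S" by (intro gen_over) auto
  then show "x \<in> gen {a, b, c} \<Longrightarrow> \<exists>P. x = ev3 emb_base P a b c" by auto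
qed

lemma gen_vars: "gen {var_y, var_z, var_u} = UNIV"
proof -
  have "P \<in> gen {var_y, var_z, var_u}" for P
  proof -
    have "evp (\<lambda>q. ev2 emb_base q var_y var_z) P var_u \<in> gen {var_y, var_z, var_u}"
      by (rule evp_in_subring) (auto simp: ring_hom_ev2 ring_hom_emb_base intro!: gen_ev2 intro: gen_intros)
    then show ?thesis using ev3_self[of P] by (simp add: ev3_def)
  qed
  then show ?thesis by auto
qed

text \<open>The form of \<open>dilation\<close> used below. For the later comparison of coordinates modulo \<open>Q\<close> the element
  \<open>S\<close> is taken divisible by \<open>Q\<close>.\<close>

lemma gen_dilation:
  assumes D: "D \<noteq> 0" and T: "emb_base D * t \<in> gen (insert v X)"
    and loc: "\<And>l. poly D l = 0 \<Longrightarrow> \<exists>b\<in>gen X. \<exists>c. c \<noteq> 0 \<and>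
      cong_in (gen (insert v X)) (pix l) (emb_base D * t) (b + emb_base [:c:] * v)"
    and Q: "\<And>l. poly D l = 0 \<Longrightarrow> poly Q l \<noteq> 0"
  obtains S w where "S \<in> gen X" "v = emb_base Q * S + emb_base D * w" "gen (insert w X) = gen (insert v (insert t X))"
proof -
  let ?B = "gen X"
  have B: "over ?B" by simp
  have Bs: "subring ?B" by simp
  let ?m = "lin_prod {l. poly D l = 0}"
  have T': "emb_base D * t \<in> rhull (insert v ?B)" using T by (simp only: rhull_insert_gen)
  have loc': "\<And>l. poly D l = 0 \<Longrightarrow> \<exists>b\<in>?B. \<exists>c. c \<noteq> 0 \<and>
      cong_in (rhull (insert v ?B)) (pix l) (emb_base D * t) (b + emb_base [:c:] * v)"
    using loc by (simp only: rhull_insert_gen)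
  obtain K b a a' n d c where K: "b \<in> ?B" "coeffs_in ?B K" "a * a' = 1 + D * d" "?m ^ n = D * c"
    "emb_base D * t = b + emb_base a * v + emb_base ?m * poly K v"
    by (rule pointwise_linear_form[OF B D T' loc'])
  have unit: "emb_base a * emb_base a' = 1 + emb_base D * emb_base d" by (metis K(3) emb_base_simps(1,3,7))
  have nilp: "emb_base ?m ^ n = emb_base D * emb_base c" by (metis K(4) emb_base_simps(3,5))
  have D0: "emb_base D \<noteq> 0" using D by simp
  obtain S c0 where S: "S \<in> ?B" "c0 \<in> ?B" "b + emb_base a * S + emb_base ?m * poly K S = emb_base D * c0"
    by (rule dilation_exists[OF Bs gen_ops(1) gen_ops(1) gen_ops(1) gen_ops(1) gen_ops(1) gen_ops(1) K(1,2) D0 unit nilp K(5)])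
  \<comment> \<open>Only \<open>S\<close> modulo \<open>D\<close> matters, so a multiplier that is \<open>1\<close> modulo \<open>D\<close> and \<open>0\<close> modulo \<open>Q\<close> makes it divisible by \<open>Q\<close>.\<close>
  obtain U V where UV: "D * V + Q * U = 1" using complex_bezout[of D Q] Q by metis
  define S' where "S' = emb_base Q * (emb_base U * S)"
  have S': "S' \<in> ?B" using S unfolding S'_def by (intro gen_ops)
  have dS: "S' = S - emb_base D * (emb_base V * S)"
  proof -
    have "S' + emb_base D * (emb_base V * S) = emb_base (D * V + Q * U) * S"
      by (simp add: S'_def emb_base_simps algebra_simps)
    then show ?thesis unfolding UV by (simp add: emb_base_simps eq_diff_eq)
  qed
  obtain k where k: "k \<in> ?B" "poly K S' - poly K S = (S' - S) * k"
    using poly_diff_factor[OF Bs S' S(1) K(2)] by blast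
  have K': "poly K S' = poly K S - emb_base D * (emb_base V * S) * k"
  proof -
    have "S' - S = - (emb_base D * (emb_base V * S))" using dS by simp
    then show ?thesis using k(2) by (simp add: diff_eq_eq)
  qed
  have root: "b + emb_base a * S' + emb_base ?m * poly K S' =
      emb_base D * (c0 - emb_base a * (emb_base V * S) - emb_base ?m * (emb_base V * S * k))"
    unfolding K' right_diff_distrib S(3)[symmetric] by (subst dS) (simp add: algebra_simps)
  have c1: "c0 - emb_base a * (emb_base V * S) - emb_base ?m * (emb_base V * S * k) \<in> ?B"
    using S k by (intro gen_ops)
  obtain w where "v = S' + emb_base D * w" "rhull (insert w ?B) = rhull (insert v (insert t ?B))"
    using dilation[OF Bs gen_ops(1) gen_ops(1) gen_ops(1) gen_ops(1) gen_ops(1) gen_ops(1) S' c1 K(2) D0 unit nilp K(5) root] by blast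
  then show ?thesis using that[of "emb_base U * S" w] S unfolding S'_def rhull_insert_gen rhull_insert2_gen
    by (auto intro: gen_ops)
qed

section \<open>Algebraic independence\<close>

lemma continuous_pt3: "continuous_on UNIV (\<lambda>(y, z, u). pt3 P y z u)"
  unfolding pt3_sum pt2_sum split_def by (intro continuous_intros)

lemma at_ev3: "ev3 (at_x l) (ev3 emb_base P a b c) y z u =
    ev3 (at_x l) P (ev3 (at_x l) a y z u) (ev3 (at_x l) b y z u) (ev3 (at_x l) c y z u)"
  unfolding ev3_comp[OF ring_hom_emb_base ring_hom_at] at_atoms ..

text \<open>At a general \<open>l\<close> the specialized map \<open>(a, b, c)\<close> of \<open>\<complex>\<^sup>3\<close> is injective, because \<open>y\<close>, \<open>h(l) z\<close> and
  \<open>r(l) u\<close> are polynomials in its components. By invariance of domain its image is open, and a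
  polynomial vanishing on an open set is zero.\<close>

lemma ev3_injective:
  assumes gens: "var_y \<in> gen {a, b, c}" "emb_base h * var_z \<in> gen {a, b, c}" "emb_base r * var_u \<in> gen {a, b, c}"
    and nz: "h \<noteq> 0" "r \<noteq> 0" and P: "ev3 emb_base P a b c = 0"
  shows "P = 0"
proof (rule specialize_x_eqI)
  show "finite {l. poly (h * r) l = 0}" using nz by (intro poly_roots_finite) simp
  fix l assume l: "l \<notin> {l. poly (h * r) l = 0}"
  define F where "F = (\<lambda>(y, z, u). (pt3 (specialize_x l a) y z u, pt3 (specialize_x l b) y z u, pt3 (specialize_x l c) y z u))"
  obtain Q1 Q2 Q3 where Q: "var_y = ev3 emb_base Q1 a b c" "emb_base h * var_z = ev3 emb_base Q2 a b c"
    "emb_base r * var_u = ev3 emb_base Q3 a b c"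
    using gens gen_is_ev3 by meson
  have "inj F"
  proof (rule injI)
    fix v v' assume "F v = F v'"
    moreover obtain y z u where v: "v = (y, z, u)" by (cases v)
    moreover obtain y' z' u' where v': "v' = (y', z', u')" by (cases v')
    ultimately have e: "F (y, z, u) = F (y', z', u')" by simp
    have 1: "ev3 (at_x l) (ev3 emb_base Q a b c) y z u = ev3 (at_x l) (ev3 emb_base Q a b c) y' z' u'" for Q
      unfolding at_ev3 using e by (simp add: F_def pt3_specialize_x)
    have "y = y'" using 1[of Q1] unfolding Q(1)[symmetric] at_atoms .
    moreover have "z = z'" using 1[of Q2] l unfolding Q(2)[symmetric] by (simp add: ring_homD[OF ring_hom_at] at_atoms)
    moreover have "u = u'" using 1[of Q3] l unfolding Q(3)[symmetric] by (simp add: ring_homD[OF ring_hom_at] at_atoms)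
    ultimately show "v = v'" by (simp add: v v')
  qed
  moreover have "continuous_on UNIV F"
    unfolding F_def split_def using continuous_pt3[unfolded split_def] by (intro continuous_on_Pair) auto
  ultimately have "open (range F)" using invariance_of_domain[of UNIV F] by simp
  then obtain X YZ where X: "open X" "open YZ" "F 0 \<in> X \<times> YZ" "X \<times> YZ \<subseteq> range F"
    using open_prod_elim[of "range F" "F 0"] by blast
  then obtain Y Z where Y: "open Y" "open Z" "snd (F 0) \<in> Y \<times> Z" "Y \<times> Z \<subseteq> YZ"
    using open_prod_elim[of YZ "snd (F 0)"] by (metis mem_Times_iff)
  have inf: "infinite X" "infinite Y" "infinite Z"
    using X Y finite_imp_not_open by (auto simp: mem_Times_iff)
  have "specialize_x l P = 0"
  proof (rule pt3_vanish[OF inf])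
    fix x y z assume "x \<in> X" "y \<in> Y" "z \<in> Z"
    then have "(x, y, z) \<in> range F" using X Y by blast
    then obtain s t u where stu: "(x, y, z) = F (s, t, u)" by (metis imageE prod_cases3)
    have "pt3 (specialize_x l P) x y z = ev3 (at_x l) (ev3 emb_base P a b c) s t u"
      using stu by (simp add: at_ev3 F_def pt3_specialize_x)
    then show "pt3 (specialize_x l P) x y z = 0" unfolding P by (simp add: ring_homD[OF ring_hom_at])
  qed
  then show "specialize_x l P = specialize_x l 0" by (simp add: ring_homD[OF ring_hom_specialize_x])
qed

lemma variable_if_generating:
  assumes "gen {p, a, b} = UNIV" shows "is_variable p"
proof -
  let ?\<phi> = "\<lambda>P. ev3 emb_base P p a b"
  note h = ring_hom_ev3[OF ring_hom_emb_base, of p a b]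
  have "inj ?\<phi>"
  proof (rule injI)
    fix P Q assume "?\<phi> P = ?\<phi> Q"
    then have "?\<phi> (P - Q) = 0" by (simp add: ring_homD[OF h])
    then have "P - Q = 0" by (rule ev3_injective[rotated 5, of _ _ _ _ 1 1]) (use assms in auto)
    then show "P = Q" by simp
  qed
  moreover have "surj ?\<phi>" using gen_is_ev3[of _ p a b] assms by (metis UNIV_I surjI)
  ultimately have "base_automorphism ?\<phi>"
    by (intro base_automorphismI h bijI) (auto simp: ev3_emb_base ring_hom_emb_base)
  moreover have "p = ?\<phi> var_y" by (simp add: ev3_vars ring_hom_emb_base)
  ultimately show ?thesis unfolding is_variable_def by blast
qed

section \<open>Residual variables linear in \<open>u\<close>\<close>

lemma gen_top:
  assumes "var_y \<in> gen X" "var_z \<in> gen X" "var_u \<in> gen X" shows "gen X = UNIV"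
  using gen_subset_iff[of "{var_y, var_z, var_u}" X] assms gen_vars by auto

lemma evp_degree_1:
  assumes "ring_hom i" "degree P = 1" shows "evp i P a = i (coeff P 0) + i (coeff P 1) * a"
proof -
  have "P = [:coeff P 0, coeff P 1:]"
    using assms(2) by (auto simp: poly_eq_iff coeff_pCons coeff_eq_0 split: nat.splits)
  then show ?thesis by (metis evp_pCons[OF assms(1)] evp_0 add.right_neutral mult.commute mult_zero_right)
qed

text \<open>At a root \<open>l\<close> of \<open>c\<close> the polynomial \<open>G(l, y)\<close> is a variable, hence linear. So \<open>c u = p - G(y)\<close>
  satisfies the hypothesis of \<open>gen_dilation\<close> for \<open>v = y\<close> over \<open>A[p, z]\<close>.\<close>

lemma residual_linear_in_u:
  assumes p: "p = emb_base c * var_u + emb_y G" and res: "residual_x_variable p"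
  shows "is_variable p"
proof -
  have deg: "degree (specialize_xy l G) = 1" if "poly c l = 0" for l
  proof -
    have "is_variable (specialize_x l p)" using res by (simp add: residual_x_variable_def)
    also have "specialize_x l p = evp emb_base (specialize_xy l G) var_y"
      unfolding p ring_homD[OF ring_hom_specialize_x] specialize_atoms evp_emb_base that by (simp add: ring_homD[OF ring_hom_emb_base])
    finally show ?thesis by (rule variable_univariate) simp
  qed
  show ?thesis
  proof (cases "c = 0")
    case True
    then have deg: "degree (specialize_xy l G) = 1" for l using deg by simp
    have G: "coeff G n = 0" if "n \<ge> 2" for n
      by (rule poly_infinite_zero[of "{}"]) (use deg that coeff_eq_0[of "specialize_xy _ G" n] in \<open>auto simp: coeff_specialize_xy\<close>)
    have "poly (coeff G 1) l \<noteq> 0" for l using deg[of l] by (metis coeff_specialize_xy leading_coeff_0_iff degree_0 zero_neq_one)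
    then have "degree (coeff G 1) = 0" using fundamental_theorem_of_algebra constant_degree by blast
    then obtain k where k: "coeff G 1 = [:k:]" by (rule degree_eq_zeroE)
    have k0: "k \<noteq> 0" using \<open>\<And>l. poly (coeff G 1) l \<noteq> 0\<close> k by auto
    have "degree G = 1"
      using G k k0 by (intro antisym degree_le le_degree) (auto simp: numeral_2_eq_2)
    then have "p = emb_base (coeff G 0) + emb_base [:k:] * var_y"
      unfolding p True by (simp add: evp_emb_base[symmetric] evp_degree_1 ring_hom_emb_base k[unfolded One_nat_def] emb_base_simps)
    then have "var_y = emb_base [:1 / k:] * (p - emb_base (coeff G 0))"
      using k0 by (simp add: mult.assoc[symmetric] flip: emb_base_simps(3)) (simp add: one_pCons[symmetric] emb_base_simps)
    then have "gen {p, var_z, var_u} = UNIV" by (intro gen_top) (metis gen_intros insertI1, auto intro: gen_intros)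
    then show ?thesis by (rule variable_if_generating)
  next
    case False
    let ?B = "gen {p, var_z}"
    let ?R = "gen {var_y, p, var_z}"
    have t: "emb_base c * var_u = p - emb_y G" by (simp add: p)
    have loc: "\<exists>b\<in>?B. \<exists>k. k \<noteq> 0 \<and> cong_in ?R (pix l) (emb_base c * var_u) (b + emb_base [:k:] * var_y)"
      if l: "poly c l = 0" for l
    proof -
      let ?g = "specialize_xy l G"
      have "cong_in ?R (pix l) (p - emb_y G) (p - evp (\<lambda>k. emb_base [:k:]) ?g var_y)"
        unfolding evp_emb_base[symmetric]
        by (intro cong_in_diff cong_in_refl evp_spec_cong) (auto intro: gen_intros)
      also have "p - evp (\<lambda>k. emb_base [:k:]) ?g var_y = (p - emb_base [:coeff ?g 0:]) + emb_base [:- coeff ?g 1:] * var_y"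
        unfolding evp_degree_1[OF ring_hom_lift deg[OF l]] by (simp add: ring_homD(5)[OF ring_hom_lift])
      finally show ?thesis unfolding t using deg[OF l]
        by (intro bexI[of _ "p - emb_base [:coeff ?g 0:]"] exI[of _ "- coeff ?g 1"])
          (auto intro!: gen_ops intro: gen_incl, metis degree_0 leading_coeff_0_iff zero_neq_one One_nat_def)
    qed
    have T: "emb_base c * var_u \<in> ?R"
      unfolding t evp_emb_base[symmetric] by (intro gen_ops gen_evp gen_incl) auto
    obtain w where "gen {w, p, var_z} = gen {var_y, var_u, p, var_z}"
      by (rule gen_dilation[OF False T loc, where Q = 1]) auto
    also have "\<dots> = UNIV" by (rule gen_top) (auto intro: gen_intros)
    finally have "gen {p, w, var_z} = UNIV" by (simp add: insert_commute)
    then show ?thesis by (rule variable_if_generating)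
  qed
qed

section \<open>Residual variables of the plane\<close>

lemma specialize_xy_simps:
  "specialize_xy l (pCons a P) = pCons (poly a l) (specialize_xy l P)" "specialize_xy l 0 = 0"
  "specialize_xy l (smult a P) = smult (poly a l) (specialize_xy l P)"
  by (simp_all add: poly_eq_iff coeff_specialize_xy coeff_pCons split: nat.splits)

lemma poly_eqI_all: "(\<And>x. poly P x = poly Q x) \<Longrightarrow> P = (Q :: complex poly)"
  by (simp add: poly_eq_poly_eq_iff[symmetric] fun_eq_iff)

text \<open>The two leading coefficients of \<open>G(X - r)\<close>; the second one recovers the shift \<open>r\<close>.\<close>

lemma coeff_pcompose_shift:
  fixes G :: "complex poly"
  shows "degree G \<le> n \<Longrightarrow> coeff (pcompose G [:- r, 1:]) n = coeff G n"
    and "degree G \<le> Suc n \<Longrightarrow> coeff (pcompose G [:- r, 1:]) n = coeff G n - of_nat (Suc n) * r * coeff G (Suc n)"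
proof (induction G arbitrary: n)
  case 0
  { case 1 then show ?case by simp next case 2 then show ?case by simp }
next
  case (pCons a G)
  have c: "coeff (pcompose (pCons a G) [:- r, 1:]) n =
      (case n of 0 \<Rightarrow> a - r * coeff (pcompose G [:- r, 1:]) 0
       | Suc m \<Rightarrow> coeff (pcompose G [:- r, 1:]) m - r * coeff (pcompose G [:- r, 1:]) (Suc m))" for n
    by (auto simp: pcompose_pCons coeff_pCons split: nat.splits)
  { case 1
    then show ?case using pCons.IH(1)[of "n - 1"] pCons.IH(1)[of n] pCons.hyps
      by (cases n) (auto simp: c coeff_eq_0 degree_pCons_eq_if split: if_splits)
  next
    case 2
    show ?case
    proof (cases n)
      case 0
      then show ?thesis using 2 pCons.IH(1)[of 0] by (auto simp: c split: if_splits)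
    next
      case (Suc m)
      have "degree G \<le> Suc m" using 2 Suc by (auto split: if_splits)
      then show ?thesis using pCons.IH(2)[of m] pCons.IH(1)[of "Suc m"] Suc by (simp add: c algebra_simps)
    qed
  }
qed

lemma coeff_poly_const: "coeff (poly g [:z:]) n = poly (map_poly (\<lambda>q. coeff q n) g) z"
  by (induction g) (auto simp: map_poly_pCons)

lemma poly_poly_const: "poly (poly g [:z:]) y = pt2 g y z"
proof -
  have "poly (evp (\<lambda>x. x) g [:z:]) y = evp (\<lambda>a. poly a y) g (poly [:z:] y)"
    by (rule evp_comp[OF ring_hom_id]) (simp add: ring_hom_def)
  then show ?thesis by (simp add: ev2_def evp_id)
qed

lemma pt2_at_0: "pt2 g 0 z = poly (map_poly (\<lambda>q. coeff q 0) g) z"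
  by (simp add: ev2_def evp_def poly_0_coeff_0)

lemma specialize_xy_pcompose: "specialize_xy l (pcompose H R) = pcompose (specialize_xy l H) (specialize_xy l R)"
proof -
  have p: "pcompose P Q = evp (\<lambda>x. [:x:]) P Q" for P Q :: "'a::comm_ring_1 poly"
    by (simp add: pcompose_altdef evp_def)
  have "specialize_xy l (pcompose H R) = evp (\<lambda>a. specialize_xy l [:a:]) H (specialize_xy l R)"
    unfolding p by (rule evp_comp[OF ring_hom_const ring_hom_specialize_xy])
  also have "\<dots> = evp (\<lambda>a. [:poly a l:]) H (specialize_xy l R)"
    by (simp add: specialize_xy_def map_poly_pCons)
  also have "\<dots> = evp (\<lambda>x. [:x:]) (specialize_xy l H) (specialize_xy l R)"
    unfolding specialize_xy_def[of l H] by (rule evp_map_poly[OF ring_hom_at_x ring_hom_const, symmetric])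
  finally show ?thesis unfolding p .
qed

text \<open>On the fibre over a root \<open>l\<close> of \<open>N\<close> the composition with the nonconstant \<open>R(l, \<cdot>)\<close> is injective,
  so \<open>x - l\<close> divides \<open>H\<close>; cancel it and go on.\<close>

lemma const_dvd_pcompose_cancel:
  fixes H R :: "complex poly poly"
  assumes "N \<noteq> 0" "\<And>l. poly N l = 0 \<Longrightarrow> degree (specialize_xy l R) > 0" "[:N:] dvd pcompose H R"
  shows "[:N:] dvd H"
  using assms
proof (induction "degree N" arbitrary: N H rule: less_induct)
  case less
  show ?case
  proof (cases "degree N = 0")
    case True
    then have "is_unit N" using less.prems(1) by (simp add: is_unit_iff_degree)
    then show ?thesis by (simp add: const_poly_dvd_iff unit_imp_dvd)
  next
    case False
    then have "\<not> constant (poly N)" by (simp add: constant_degree)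
    then obtain l where l: "poly N l = 0" using fundamental_theorem_of_algebra by blast
    then have "[:-l, 1:] dvd N" by (simp add: poly_eq_0_iff_dvd)
    then obtain N' where N: "N = [:-l, 1:] * N'" by (rule dvdE)
    obtain k where k: "pcompose H R = [:N:] * k" using less.prems(3) by (rule dvdE)
    have "specialize_xy l (pcompose H R) = 0"
      unfolding k by (simp add: poly_eq_iff coeff_specialize_xy l)
    then have "pcompose (specialize_xy l H) (specialize_xy l R) = 0" by (simp add: specialize_xy_pcompose)
    then have "specialize_xy l H = 0" using pcompose_eq_0 less.prems(2)[OF l] by blast
    then obtain H' where H: "H = [:[:-l, 1:]:] * H'" using specialize_xy_0_dvd by (blast elim: dvdE)
    have "[:[:-l, 1:]:] * pcompose H' R = [:[:-l, 1:]:] * ([:N':] * k)"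
      using k unfolding H N pcompose_mult by (simp add: pcompose_const mult_ac)
    then have "pcompose H' R = [:N':] * k" by (simp only: mult_cancel_left) simp
    then have "[:N':] dvd pcompose H' R" by (metis dvdI)
    moreover have "degree N' < degree N" "N' \<noteq> 0" using less.prems(1) unfolding N by (auto simp: degree_mult_eq simp del: mult_pCons_left)
    moreover have "\<And>l. poly N' l = 0 \<Longrightarrow> degree (specialize_xy l R) > 0" using less.prems(2) unfolding N by simp
    ultimately have "[:N':] dvd H'" using less.hyps by blast
    then have "[:[:-l, 1:]:] * [:N':] dvd H" unfolding H by (rule mult_dvd_mono[OF dvd_refl])
    then show ?thesis unfolding N by simp
  qed
qed

text \<open>Put \<open>Y = D y - R(z)\<close>, with \<open>R / D\<close> in lowest terms. Then \<open>p = c z + Gh(Y)\<close> with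
  \<open>Gh(D X) = G(X)\<close>, and \<open>Gh\<close> has coefficients in \<open>A\<close>: as \<open>Gh(- R(z))\<close> is integral and \<open>R\<close> is not
  constant modulo any prime factor of \<open>D\<close>, no denominators can occur. Two dilations over \<open>A[p, u]\<close>
  recover first \<open>z\<close> from \<open>c z = p - Gh(Y)\<close> and then \<open>y\<close> from \<open>D y = Y + R(z)\<close>. Both are linear on the
  relevant fibres. If \<open>D(l) = 0\<close>, then \<open>p\<close> is there a variable that depends on \<open>z\<close> alone, so it is linear
  in \<open>z\<close>; as \<open>R(l, z)\<close> has degree at least \<open>2\<close>, this makes \<open>Gh\<close> constant and \<open>c(l) \<noteq> 0\<close>. If \<open>c(l) = 0\<close>,
  then \<open>p\<close> depends on \<open>y\<close> alone, and \<open>Gh\<close> is linear.\<close>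

lemma residual_plane_shape:
  assumes res: "residual_x_variable (emb_yz g)" and c1: "coeff g 1 = [:c:]" and l: "poly c l \<noteq> 0"
  obtains R where "coeff R 0 = 0" "coeff R 1 = 0"
    "\<And>y z. pt2 (spec_yz l g) y z = poly c l * z + poly (specialize_xy l (coeff g 0)) (y - poly R z)"
proof -
  have "is_variable (emb_yz (spec_yz l g))"
    using res by (simp add: residual_x_variable_def flip: specialize_atoms(3))
  moreover have "coeff (spec_yz l g) 1 = [:poly c l:]"
    by (simp add: coeff_spec_yz c1[simplified] specialize_xy_simps)
  ultimately show ?thesis using variable_shape[of "spec_yz l g"] l that by (auto simp: coeff_spec_yz)
qed

text \<open>Outside the finite set \<open>F\<close> the fibres of \<open>g\<close> are \<open>c z + G(y - R(z)/D)\<close>, where \<open>G\<close> is the part of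
  \<open>g\<close> of degree \<open>0\<close> in \<open>z\<close>: the shear is one rational function of \<open>x\<close>, with denominator \<open>D\<close>.\<close>

definition sheared_by :: "complex poly poly poly \<Rightarrow> complex poly \<Rightarrow> complex set \<Rightarrow> complex poly \<Rightarrow> complex poly poly \<Rightarrow> bool"
  where "sheared_by g c F D R \<longleftrightarrow> finite F \<and> D \<noteq> 0 \<and> coeff R 0 = 0 \<and> coeff R 1 = 0 \<and>
    (\<forall>l. l \<notin> F \<longrightarrow> poly D l \<noteq> 0 \<and> (\<forall>y z. pt2 (spec_yz l g) y z =
      poly c l * z + poly (specialize_xy l (coeff g 0)) (y - poly (specialize_xy l R) z / poly D l)))"

text \<open>Let \<open>d\<close> be the degree of \<open>G\<close>. In \<open>G(y - R(z))\<close> the coefficient of \<open>y\<^sup>d\<^sup>-\<^sup>1\<close> determines \<open>R\<close>, so that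
  the shears of the single fibres are given by one formula \<open>- M / (d \<cdot> lead_coeff G)\<close> in the coefficients
  of \<open>g\<close>. If \<open>d = 0\<close>, any shear will do.\<close>

text \<open>Put \<open>Y = D y - R(z)\<close>, with \<open>R / D\<close> in lowest terms. Then \<open>p = c z + Gh(Y)\<close> with
  \<open>Gh(D X) = G(X)\<close>, and \<open>Gh\<close> has coefficients in \<open>A\<close>: as \<open>Gh(- R(z))\<close> is integral and \<open>R\<close> is not
  constant modulo any prime factor of \<open>D\<close>, no denominators can occur. Two dilations over \<open>A[p, u]\<close>
  recover first \<open>z\<close> from \<open>c z = p - Gh(Y)\<close> and then \<open>y\<close> from \<open>D y = Y + R(z)\<close>. Both are linear on the
  relevant fibres. If \<open>D(l) = 0\<close>, then \<open>p\<close> is there a variable that depends on \<open>z\<close> alone, so it is linear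
  in \<open>z\<close>; as \<open>R(l, z)\<close> has degree at least \<open>2\<close>, this makes \<open>Gh\<close> constant and \<open>c(l) \<noteq> 0\<close>. If \<open>c(l) = 0\<close>,
  then \<open>p\<close> depends on \<open>y\<close> alone, and \<open>Gh\<close> is linear.\<close>

lemma residual_plane_sheared:
  assumes res: "residual_x_variable (emb_yz g)" and c1: "coeff g 1 = [:c:]" and c0: "c \<noteq> 0"
  shows "\<exists>F D R. sheared_by g c F D R"
proof (cases "degree (coeff g 0) = 0")
  case True
  then obtain a where a: "coeff g 0 = [:a:]" by (rule degree_eq_zeroE)
  have sa: "specialize_xy l (coeff g 0) = [:poly a l:]" for l by (simp add: a specialize_xy_simps)
  have "pt2 (spec_yz l g) y z = poly c l * z + poly a l" if l: "poly c l \<noteq> 0" for l y z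
  proof -
    obtain R where "pt2 (spec_yz l g) y z = poly c l * z + poly (specialize_xy l (coeff g 0)) (y - poly R z)"
      using residual_plane_shape[OF res c1 l] by metis
    then show ?thesis by (simp add: sa)
  qed
  then have "sheared_by g c {l. poly c l = 0} 1 0"
    unfolding sheared_by_def using c0 by (auto simp: sa poly_roots_finite)
  then show ?thesis by blast
next
  case False
  define G where "G = coeff g 0"
  define n where "n = degree G - 1"
  have dG: "degree G = Suc n" using False by (simp add: G_def n_def)
  define g2 where "g2 = g - [:coeff g 0, coeff g 1:]"
  define M where "M = map_poly (\<lambda>q. coeff q n) g2"
  have cM: "coeff M 0 = 0" "coeff M 1 = 0" by (simp_all add: M_def coeff_map_poly g2_def)
  define D where "D = smult (of_nat (Suc n)) (lead_coeff G)"
  have lG: "lead_coeff G \<noteq> 0" using dG by (metis degree_0 leading_coeff_0_iff nat.distinct(1))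
  have D0: "D \<noteq> 0" using lG by (simp add: D_def del: of_nat_Suc)
  have "poly D l \<noteq> 0 \<and> (\<forall>y z. pt2 (spec_yz l g) y z =
      poly c l * z + poly (specialize_xy l G) (y - poly (specialize_xy l (- M)) z / poly D l))"
    if l: "poly (c * lead_coeff G) l \<noteq> 0" for l
  proof -
    have Dl: "poly D l \<noteq> 0" using l by (simp add: D_def del: of_nat_Suc)
    obtain R where R: "\<And>y z. pt2 (spec_yz l g) y z = poly c l * z + poly (specialize_xy l G) (y - poly R z)"
    proof -
      have "poly c l \<noteq> 0" using l by simp
      from residual_plane_shape[OF res c1 this] show ?thesis using that unfolding G_def by metis
    qed
    have Rz: "poly R z = poly (specialize_xy l (- M)) z / poly D l" for z
    proof -
      let ?r = "poly R z" and ?G = "specialize_xy l G"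
      have "poly (poly (spec_yz l g) [:z:]) y = poly ([:poly c l * z:] + pcompose ?G [:- ?r, 1:]) y" for y
        by (simp add: poly_poly_const R poly_pcompose algebra_simps)
      then have e: "poly (spec_yz l g) [:z:] = [:poly c l * z:] + pcompose ?G [:- ?r, 1:]"
        by (intro poly_eqI_all)
      have "degree ?G \<le> Suc n" by (metis coeff_specialize_xy coeff_eq_0 dG degree_le poly_0)
      then have "coeff (pcompose ?G [:- ?r, 1:]) n = coeff ?G n - of_nat (Suc n) * ?r * coeff ?G (Suc n)"
        by (rule coeff_pcompose_shift(2))
      also have "of_nat (Suc n) * ?r * coeff ?G (Suc n) = ?r * poly D l"
        by (simp add: D_def coeff_specialize_xy dG)
      finally have 1: "coeff (poly (spec_yz l g) [:z:]) n = coeff [:poly c l * z:] n + coeff ?G n - ?r * poly D l"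
        unfolding e by simp
      have "g = [:G, [:c:]:] + g2" using c1 by (simp add: g2_def G_def)
      then have "spec_yz l g = spec_yz l [:G, [:c:]:] + spec_yz l g2" by (metis ring_homD(2)[OF ring_hom_spec_yz])
      also have "spec_yz l [:G, [:c:]:] = [:?G, [:poly c l:]:]"
        by (simp add: spec_yz_def map_poly_pCons specialize_xy_def)
      finally have "coeff (poly (spec_yz l g) [:z:]) n = coeff ?G n + coeff [:poly c l * z:] n + coeff (poly (spec_yz l g2) [:z:]) n"
        by (simp add: mult.commute)
      also have "coeff (poly (spec_yz l g2) [:z:]) n = poly (specialize_xy l M) z"
        unfolding coeff_poly_const
        by (rule arg_cong[of _ _ "\<lambda>P. poly P z"]) (simp add: poly_eq_iff coeff_map_poly M_def coeff_specialize_xy coeff_spec_yz)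
      finally have "?r * poly D l = - poly (specialize_xy l M) z" using 1 by (simp add: algebra_simps eq_neg_iff_add_eq_0)
      then show ?thesis using Dl by (simp add: ring_homD[OF ring_hom_specialize_xy] field_simps)
    qed
    show ?thesis using Dl R by (simp add: Rz)
  qed
  moreover have "finite {l. poly (c * lead_coeff G) l = 0}" using c0 lG by (intro poly_roots_finite) simp
  ultimately have "sheared_by g c {l. poly (c * lead_coeff G) l = 0} D (- M)"
    unfolding sheared_by_def using D0 cM by (simp add: G_def)
  then show ?thesis by blast
qed

text \<open>Let \<open>d\<close> be the degree of \<open>G\<close>. In \<open>G(y - R(z))\<close> the coefficient of \<open>y\<^sup>d\<^sup>-\<^sup>1\<close> determines \<open>R\<close>, so that
  the shears of the single fibres are given by one formula \<open>- M / (d \<cdot> lead_coeff G)\<close> in the coefficients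
  of \<open>g\<close>. If \<open>d = 0\<close>, any shear will do.\<close>

text \<open>A common root of \<open>D\<close> and \<open>R\<close> can be cancelled at the cost of enlarging \<open>F\<close>.\<close>

text \<open>Put \<open>Y = D y - R(z)\<close>, with \<open>R / D\<close> in lowest terms. Then \<open>p = c z + Gh(Y)\<close> with
  \<open>Gh(D X) = G(X)\<close>, and \<open>Gh\<close> has coefficients in \<open>A\<close>: as \<open>Gh(- R(z))\<close> is integral and \<open>R\<close> is not
  constant modulo any prime factor of \<open>D\<close>, no denominators can occur. Two dilations over \<open>A[p, u]\<close>
  recover first \<open>z\<close> from \<open>c z = p - Gh(Y)\<close> and then \<open>y\<close> from \<open>D y = Y + R(z)\<close>. Both are linear on the
  relevant fibres. If \<open>D(l) = 0\<close>, then \<open>p\<close> is there a variable that depends on \<open>z\<close> alone, so it is linear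
  in \<open>z\<close>; as \<open>R(l, z)\<close> has degree at least \<open>2\<close>, this makes \<open>Gh\<close> constant and \<open>c(l) \<noteq> 0\<close>. If \<open>c(l) = 0\<close>,
  then \<open>p\<close> depends on \<open>y\<close> alone, and \<open>Gh\<close> is linear.\<close>

lemma residual_plane_sheared_reduced:
  assumes res: "residual_x_variable (emb_yz g)" and c1: "coeff g 1 = [:c:]" and c0: "c \<noteq> 0"
  obtains F D R where "sheared_by g c F D R" "\<And>l. poly D l = 0 \<Longrightarrow> specialize_xy l R \<noteq> 0"
proof -
  define n where "n = (LEAST n. \<exists>F D R. sheared_by g c F D R \<and> degree D = n)"
  have "\<exists>n F D R. sheared_by g c F D R \<and> degree D = n" using residual_plane_sheared[OF assms] by blast
  then have "\<exists>F D R. sheared_by g c F D R \<and> degree D = n" unfolding n_def by (rule LeastI_ex)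
  then obtain F D R where s: "sheared_by g c F D R" "degree D = n" by blast
  have "specialize_xy l R \<noteq> 0" if l: "poly D l = 0" for l
  proof
    assume "specialize_xy l R = 0"
    then obtain R' where R: "R = [:[:-l, 1:]:] * R'" using specialize_xy_0_dvd by (blast elim: dvdE)
    obtain D' where D: "D = [:-l, 1:] * D'" using l poly_eq_0_iff_dvd by (metis dvdE)
    have D0: "D' \<noteq> 0" using s(1) unfolding D sheared_by_def by auto
    have "sheared_by g c (insert l F) D' R'"
      unfolding sheared_by_def
    proof (intro conjI allI impI)
      show "finite (insert l F)" "D' \<noteq> 0" using s(1) D0 by (auto simp: sheared_by_def)
      have "R = smult [:-l, 1:] R'" unfolding R by simp
      then have "coeff R n = [:-l, 1:] * coeff R' n" for n by (simp only: coeff_smult)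
      then have "coeff R n = 0 \<Longrightarrow> coeff R' n = 0" for n by (metis mult_eq_0_iff one_neq_zero pCons_eq_0_iff)
      then show "coeff R' 0 = 0" "coeff R' 1 = 0" using s(1) unfolding sheared_by_def by auto
      fix l' assume l': "l' \<notin> insert l F"
      then show "poly D' l' \<noteq> 0" using s(1) unfolding sheared_by_def D by auto
      fix y z
      have "specialize_xy l' R = smult (l' - l) (specialize_xy l' R')"
        unfolding R by (simp add: poly_eq_iff coeff_specialize_xy algebra_simps)
      then have "poly (specialize_xy l' R) z / poly D l' = poly (specialize_xy l' R') z / poly D' l'"
        using l' unfolding D by (simp add: left_diff_distrib[symmetric])
      then show "pt2 (spec_yz l' g) y z = poly c l' * z + poly (specialize_xy l' (coeff g 0)) (y - poly (specialize_xy l' R') z / poly D' l')"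
        using s(1) l' unfolding sheared_by_def by auto
    qed
    then have "n \<le> degree D'" unfolding n_def by (intro Least_le) blast
    moreover have "degree D = Suc (degree D')" unfolding D using D0 by (subst degree_mult_eq) auto
    ultimately show False using s(2) by simp
  qed
  then show ?thesis using that[OF s(1)] by blast
qed

lemma degree_ge_2I: "P \<noteq> 0 \<Longrightarrow> coeff P 0 = 0 \<Longrightarrow> coeff P 1 = 0 \<Longrightarrow> degree P \<ge> 2"
  by (metis One_nat_def leading_coeff_0_iff less_2_cases not_le)

lemma cong_in_evp:
  assumes "over S" "cong_in S m a b" "a \<in> S" "b \<in> S" shows "cong_in S m (evp emb_base P a) (evp emb_base P b)"
  unfolding evp_def
  using assms by (intro cong_in_poly) (auto simp: coeffs_in_def coeff_map_poly emb_base_simps intro: cong_in_refl subringD)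

text \<open>Put \<open>Y = D y - R(z)\<close>, with \<open>R / D\<close> in lowest terms. Then \<open>p = c z + Gh(Y)\<close> with
  \<open>Gh(D X) = G(X)\<close>, and \<open>Gh\<close> has coefficients in \<open>A\<close>: as \<open>Gh(- R(z))\<close> is integral and \<open>R\<close> is not
  constant modulo any prime factor of \<open>D\<close>, no denominators can occur. Two dilations over \<open>A[p, u]\<close>
  recover first \<open>z\<close> from \<open>c z = p - Gh(Y)\<close> and then \<open>y\<close> from \<open>D y = Y + R(z)\<close>. Both are linear on the
  relevant fibres. If \<open>D(l) = 0\<close>, then \<open>p\<close> is there a variable that depends on \<open>z\<close> alone, so it is linear
  in \<open>z\<close>; as \<open>R(l, z)\<close> has degree at least \<open>2\<close>, this makes \<open>Gh\<close> constant and \<open>c(l) \<noteq> 0\<close>. If \<open>c(l) = 0\<close>,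
  then \<open>p\<close> depends on \<open>y\<close> alone, and \<open>Gh\<close> is linear.\<close>

lemma residual_plane:
  assumes p: "p = emb_yz g" and res: "residual_x_variable p" and c1: "coeff g 1 = [:c:]" and c0: "c \<noteq> 0"
    and van: "\<And>l j. poly c l = 0 \<Longrightarrow> j \<ge> 1 \<Longrightarrow> specialize_xy l (coeff g j) = 0"
  shows "is_variable p"
proof -
  note res' = res[unfolded p]
  obtain F D R where sh: "sheared_by g c F D R" and red: "\<And>l. poly D l = 0 \<Longrightarrow> specialize_xy l R \<noteq> 0"
    using residual_plane_sheared_reduced[OF res' c1 c0] by blast
  have fF: "finite F" and D0: "D \<noteq> 0" and R01: "coeff R 0 = 0" "coeff R 1 = 0"
    using sh by (auto simp: sheared_by_def)
  define G where "G = coeff g 0"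
  have shl: "poly D l \<noteq> 0" "pt2 (spec_yz l g) y z = poly c l * z + poly (specialize_xy l G) (y - poly (specialize_xy l R) z / poly D l)"
    if "l \<notin> F" for l y z using sh that by (auto simp: sheared_by_def G_def)
  have degR: "degree (specialize_xy l R) \<ge> 2" if "poly D l = 0" for l
    by (rule degree_ge_2I[OF red[OF that]]) (simp_all add: coeff_specialize_xy R01[simplified])
  define d where "d = degree G"
  \<comment> \<open>\<open>H(X) = D\<^sup>d G(X/D)\<close>, so that \<open>Gh = H/D\<^sup>d\<close>\<close>
  define H where "H = (\<Sum>i\<le>d. monom (coeff G i * D ^ (d - i)) i)"
  have cH: "coeff H i = coeff G i * D ^ (d - i)" for i
    by (auto simp: H_def coeff_sum d_def coeff_eq_0 not_le)
  have HG: "pcompose H [:0, D:] = [:D ^ d:] * G"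
  proof (rule poly_eqI)
    fix i show "coeff (pcompose H [:0, D:]) i = coeff ([:D ^ d:] * G) i"
    proof (cases "i \<le> d")
      case True
      then have "D ^ d = D ^ i * D ^ (d - i)" by (simp flip: power_add)
      then show ?thesis by (simp add: coeff_pcompose_linear cH)
    next
      case False
      then show ?thesis by (simp add: coeff_pcompose_linear cH d_def coeff_eq_0)
    qed
  qed
  have Hl: "poly (specialize_xy l H) (poly D l * y) = poly D l ^ d * poly (specialize_xy l G) y" for l y
  proof -
    have "specialize_xy l (pcompose H [:0, D:]) = specialize_xy l ([:D ^ d:] * G)" by (simp add: HG)
    then have "pcompose (specialize_xy l H) [:0, poly D l:] = smult (poly D l ^ d) (specialize_xy l G)"
      by (simp add: specialize_xy_pcompose specialize_xy_simps)
    then have "poly (pcompose (specialize_xy l H) [:0, poly D l:]) y = poly (smult (poly D l ^ d) (specialize_xy l G)) y" by simp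
    then show ?thesis by (simp add: poly_pcompose mult.commute)
  qed
  define ga where "ga = map_poly (\<lambda>q. coeff q 0) g - [:0, c:]"
  have "[:D ^ d:] * ga = pcompose H (- R)"
  proof (rule specialize_xy_eqI[OF fF], rule poly_eqI_all)
    fix l z assume l: "l \<notin> F"
    have m: "specialize_xy l (map_poly (\<lambda>q. coeff q 0) g) = map_poly (\<lambda>q. coeff q 0) (spec_yz l g)"
      by (simp add: poly_eq_iff coeff_specialize_xy coeff_map_poly coeff_spec_yz)
    have "poly (specialize_xy l ga) z = pt2 (spec_yz l g) 0 z - poly c l * z"
      by (simp add: ga_def ring_homD[OF ring_hom_specialize_xy] m pt2_at_0 specialize_xy_simps mult.commute)
    also have "\<dots> = poly (specialize_xy l G) (- poly (specialize_xy l R) z / poly D l)" by (simp add: shl(2)[OF l])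
    finally have "poly (specialize_xy l ([:D ^ d:] * ga)) z = poly D l ^ d * poly (specialize_xy l G) (- poly (specialize_xy l R) z / poly D l)"
      by (simp add: specialize_xy_simps)
    also have "\<dots> = poly (specialize_xy l H) (- poly (specialize_xy l R) z)"
      using Hl[of l "- poly (specialize_xy l R) z / poly D l"] shl(1)[OF l] by simp
    finally show "poly (specialize_xy l ([:D ^ d:] * ga)) z = poly (specialize_xy l (pcompose H (- R))) z"
      by (simp add: specialize_xy_pcompose poly_pcompose ring_homD[OF ring_hom_specialize_xy])
  qed
  then have "[:D ^ d:] dvd pcompose H (- R)" by (metis dvdI)
  then have "[:D ^ d:] dvd H"
  proof (rule const_dvd_pcompose_cancel[rotated 2])
    show "D ^ d \<noteq> 0" using D0 by simp
    fix l assume "poly (D ^ d) l = 0"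
    then have "poly D l = 0" by (auto simp: poly_power)
    then show "degree (specialize_xy l (- R)) > 0" using degR[of l] by (simp add: ring_homD[OF ring_hom_specialize_xy])
  qed
  then obtain Gh where Gh: "H = [:D ^ d:] * Gh" by (rule dvdE)
  have Ghl: "pcompose (specialize_xy l Gh) [:0, poly D l:] = specialize_xy l G" for l
  proof -
    have "[:D ^ d:] * pcompose Gh [:0, D:] = [:D ^ d:] * G"
      using HG unfolding Gh pcompose_mult by (simp add: pcompose_const)
    then have "pcompose Gh [:0, D:] = G" using D0 by (simp only: mult_cancel_left) simp
    then have "specialize_xy l (pcompose Gh [:0, D:]) = specialize_xy l G" by simp
    then show ?thesis by (simp add: specialize_xy_pcompose specialize_xy_simps)
  qed
  have Ghp: "poly (specialize_xy l Gh) (poly D l * y) = poly (specialize_xy l G) y" for l y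
    unfolding Ghl[symmetric] by (simp add: poly_pcompose mult.commute)
  define Y where "Y = emb_base D * var_y - evp emb_base R var_z"
  have aY: "ev3 (at_x l) Y y z u = poly D l * y - poly (specialize_xy l R) z" for l y z u
    by (simp add: Y_def ring_homD[OF ring_hom_at] at_atoms at_evp)
  have pY: "p = emb_base c * var_z + evp emb_base Gh Y"
  proof (rule at_eqI[OF fF])
    fix l y z u assume l: "l \<notin> F"
    have "poly D l * (y - poly (specialize_xy l R) z / poly D l) = poly D l * y - poly (specialize_xy l R) z"
      using shl(1)[OF l] by (simp add: algebra_simps)
    then show "ev3 (at_x l) p y z u = ev3 (at_x l) (emb_base c * var_z + evp emb_base Gh Y) y z u"
      using Ghp[of l "y - poly (specialize_xy l R) z / poly D l"]
      by (simp add: p ring_homD[OF ring_hom_at] at_atoms at_evp aY shl(2)[OF l])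
  qed
  have atD: "degree (specialize_xy l Gh) = 0 \<and> poly c l \<noteq> 0" if l: "poly D l = 0" for l
  proof -
    define Q where "Q = [:0, poly c l:] + pcompose (specialize_xy l Gh) (- specialize_xy l R)"
    have "specialize_x l p = evp emb_base Q var_z"
      by (rule pt3_eqI)
        (simp add: pt3_specialize_x pY ring_homD[OF ring_hom_at] at_atoms at_evp aY l Q_def
          evp_comp[OF ring_hom_emb_base ring_hom_pt3] pt3_simps evp_id poly_pcompose mult.commute)
    then have "is_variable (evp emb_base Q var_z)" using res by (metis residual_x_variable_def)
    then have Q1: "degree Q = 1" by (rule variable_univariate) simp
    have dp: "degree (pcompose (specialize_xy l Gh) (- specialize_xy l R)) = degree (specialize_xy l Gh) * degree (specialize_xy l R)"
      by (simp add: degree_pcompose)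
    have Gh0: "degree (specialize_xy l Gh) = 0"
    proof (rule ccontr)
      assume "degree (specialize_xy l Gh) \<noteq> 0"
      then have "degree (specialize_xy l Gh) * degree (specialize_xy l R) \<ge> 1 * 2"
        using degR[OF l] by (intro mult_le_mono) auto
      then have ge: "degree (pcompose (specialize_xy l Gh) (- specialize_xy l R)) \<ge> 2" unfolding dp by simp
      have "degree [:0, poly c l:] \<le> 1" by simp
      then have "degree [:0, poly c l:] < degree (pcompose (specialize_xy l Gh) (- specialize_xy l R))" using ge by linarith
      then have "degree Q = degree (pcompose (specialize_xy l Gh) (- specialize_xy l R))"
        unfolding Q_def by (rule degree_add_eq_right)
      then have "degree Q \<ge> 2" using ge by simp
      then show False using Q1 by simp
    qed
    moreover have "poly c l \<noteq> 0"
    proof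
      assume "poly c l = 0"
      then have "degree Q = 0" using dp Gh0 by (simp add: Q_def)
      then show False using Q1 by simp
    qed
    ultimately show ?thesis by blast
  qed
  have atc: "degree (specialize_xy l Gh) = 1" if l: "poly c l = 0" for l
  proof -
    have Dl: "poly D l \<noteq> 0" using atD l by blast
    have "spec_yz l g = [:specialize_xy l G:]"
      using van[OF l] by (auto simp: poly_eq_iff coeff_spec_yz coeff_pCons G_def split: nat.splits)
    then have "specialize_x l p = evp emb_base (specialize_xy l G) var_y"
      by (simp add: p specialize_atoms evp_emb_base) (simp add: emb_yz_def emb_y_def)
    then have "is_variable (evp emb_base (specialize_xy l G) var_y)" using res by (metis residual_x_variable_def)
    then have "degree (specialize_xy l G) = 1" by (rule variable_univariate) simp
    then show ?thesis using Dl unfolding Ghl[symmetric] by (simp add: degree_pcompose)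
  qed
  let ?B = "gen {p, var_u}"
  have t1: "emb_base c * var_z = p - evp emb_base Gh Y" by (simp add: pY)
  have loc1: "\<exists>b\<in>?B. \<exists>k. k \<noteq> 0 \<and> cong_in (gen {Y, p, var_u}) (pix l) (emb_base c * var_z) (b + emb_base [:k:] * Y)"
    if l: "poly c l = 0" for l
  proof -
    let ?g = "specialize_xy l Gh"
    have "cong_in (gen {Y, p, var_u}) (pix l) (p - evp emb_base Gh Y) (p - evp (\<lambda>k. emb_base [:k:]) ?g Y)"
      by (intro cong_in_diff cong_in_refl evp_spec_cong) (auto intro: gen_intros)
    also have "p - evp (\<lambda>k. emb_base [:k:]) ?g Y = (p - emb_base [:coeff ?g 0:]) + emb_base [:- coeff ?g 1:] * Y"
      unfolding evp_degree_1[OF ring_hom_lift atc[OF l]] by (simp add: ring_homD(5)[OF ring_hom_lift])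
    finally have "cong_in (gen {Y, p, var_u}) (pix l) (emb_base c * var_z) ((p - emb_base [:coeff ?g 0:]) + emb_base [:- coeff ?g 1:] * Y)"
      unfolding t1 .
    moreover have "p - emb_base [:coeff ?g 0:] \<in> ?B" by (auto intro!: gen_ops intro: gen_incl)
    moreover have "- coeff ?g 1 \<noteq> 0" using atc[OF l] by (metis degree_0 leading_coeff_0_iff neg_equal_0_iff_equal zero_neq_one)
    ultimately show ?thesis by blast
  qed
  have "emb_base c * var_z \<in> gen {Y, p, var_u}" unfolding t1 by (auto intro!: gen_ops gen_evp intro: gen_incl)
  then obtain S V where SV: "S \<in> ?B" "Y = S + emb_base c * V" "gen {V, p, var_u} = gen {Y, var_z, p, var_u}"
  proof (rule gen_dilation[OF c0 _ loc1, where Q = 1])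
    fix S V assume *: "S \<in> ?B" "Y = emb_base 1 * S + emb_base c * V" "gen {V, p, var_u} = gen {Y, var_z, p, var_u}"
    show thesis by (rule that[OF *(1) _ *(3)]) (use *(2) in \<open>simp add: emb_base_simps\<close>)
  qed auto
  let ?R = "gen {V, p, var_u}"
  have R: "over ?R" by simp
  have BR: "?B \<subseteq> ?R" by (rule gen_mono) auto
  have YR: "Y \<in> ?R" and zR: "var_z \<in> ?R" unfolding SV(3) by (auto intro: gen_incl)
  have pR: "p \<in> ?R" "V \<in> ?R" by (auto intro: gen_incl)
  have t2: "emb_base D * var_y = Y + evp emb_base R var_z" by (simp add: Y_def)
  have loc2: "\<exists>b\<in>?B. \<exists>k. k \<noteq> 0 \<and> cong_in ?R (pix l) (emb_base D * var_y) (b + emb_base [:k:] * V)"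
    if l: "poly D l = 0" for l
  proof -
    let ?k = "poly c l"
    have k0: "?k \<noteq> 0" using atD[OF l] by simp
    obtain a where a: "specialize_xy l Gh = [:a:]" using atD[OF l] by (auto elim: degree_eq_zeroE)
    define Zl where "Zl = emb_base [:1 / ?k:] * (p - emb_base [:a:])"
    have Zl: "Zl \<in> ?B" "Zl \<in> ?R" unfolding Zl_def by (auto intro!: gen_ops intro: gen_incl)
    have "cong_in ?R (pix l) (p - evp emb_base Gh Y) (p - emb_base [:a:])"
      using evp_spec_cong[OF R YR, of l Gh] unfolding a evp_const[OF ring_hom_lift] using R pR
      by (intro cong_in_diff cong_in_refl) auto
    then have 1: "cong_in ?R (pix l) (emb_base c * var_z) (p - emb_base [:a:])" unfolding t1 .
    have "cong_in ?R (pix l) (emb_base [:?k:] * var_z) (emb_base c * var_z)"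
      by (rule cong_in_mult[OF _ cong_in_sym[OF _ base_spec_cong[OF R]] cong_in_refl]) (auto intro: zR gen_ops)
    then have "cong_in ?R (pix l) (emb_base [:?k:] * var_z) (p - emb_base [:a:])"
      using 1 R cong_in_trans by blast
    moreover have "p - emb_base [:a:] \<in> ?R" using pR by (intro gen_ops)
    ultimately have "cong_in ?R (pix l) (emb_base [:1 / ?k:] * (emb_base [:?k:] * var_z)) Zl"
      unfolding Zl_def by (intro cong_in_mult cong_in_refl over_gen gen_ops pR)
    moreover have "emb_base [:1 / ?k:] * (emb_base [:?k:] * var_z) = var_z"
      using k0 by (simp add: mult.assoc[symmetric] flip: emb_base_simps(3)) (simp add: one_pCons[symmetric] emb_base_simps)
    ultimately have "cong_in ?R (pix l) var_z Zl" by simp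
    then have 2: "cong_in ?R (pix l) (evp emb_base R var_z) (evp emb_base R Zl)"
      using R zR Zl by (intro cong_in_evp)
    have "cong_in ?R (pix l) (S + emb_base c * V) (S + emb_base [:?k:] * V)"
      using R SV(1) BR pR by (intro cong_in_add cong_in_mult cong_in_refl base_spec_cong) (auto intro: gen_ops(1))
    then have "cong_in ?R (pix l) (Y + evp emb_base R var_z) ((S + emb_base [:?k:] * V) + evp emb_base R Zl)"
      using 2 R unfolding SV(2)[symmetric] by (intro cong_in_add) auto
    then have "cong_in ?R (pix l) (emb_base D * var_y) ((S + evp emb_base R Zl) + emb_base [:?k:] * V)"
      unfolding t2 by (simp add: algebra_simps)
    moreover have "S + evp emb_base R Zl \<in> ?B" using SV(1) Zl(1) by (intro gen_ops gen_evp)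
    ultimately show ?thesis using k0 by blast
  qed
  have "emb_base D * var_y \<in> ?R" unfolding t2 using YR zR by (intro gen_ops gen_evp)
  then obtain w where w: "gen {w, p, var_u} = gen {V, var_y, p, var_u}"
    by (rule gen_dilation[OF D0 _ loc2, where Q = 1]) auto
  have "gen {w, p, var_u} = UNIV"
  proof (rule gen_top)
    have "?R \<subseteq> gen {w, p, var_u}" unfolding w by (rule gen_mono) auto
    then show "var_z \<in> gen {w, p, var_u}" using zR by blast
    show "var_y \<in> gen {w, p, var_u}" unfolding w by (auto intro: gen_incl)
    show "var_u \<in> gen {w, p, var_u}" by (auto intro: gen_incl)
  qed
  then have "gen {p, w, var_u} = UNIV" by (simp add: insert_commute)
  then show ?thesis by (rule variable_if_generating)
qed

section \<open>Hensel coordinates and special fibres\<close>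

lemma hensel_root:
  fixes D :: "'r::idom"
  assumes B: "subring B" and mem: "D \<in> B" "m \<in> B" "b \<in> B" "c \<in> B" "coeffs_in B K" and nilp: "m ^ k = D * c"
  obtains c0 where "c0 \<in> B" "b - hensel_iter (-1) b m K k + m * poly K (hensel_iter (-1) b m K k) = D * c0"
proof -
  have m1: "-1 \<in> B" "0 \<in> B" using B subringD(5)[OF B subringD(1)[OF B]] subringD(2) by auto
  obtain e f where "e \<in> B" "f \<in> B" "b + (-1) * hensel_iter (-1) b m K k + m * poly K (hensel_iter (-1) b m K k) = m ^ k * e + D * f"
    using hensel_iter_residue[OF B m1(1) m1(1) mem(3,2,1) m1(2) mem(5), of k] by auto
  then have "b - hensel_iter (-1) b m K k + m * poly K (hensel_iter (-1) b m K k) = D * (c * e + f)" "c * e + f \<in> B"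
    using B mem by (auto simp: nilp algebra_simps subringD)
  then show ?thesis using that by blast
qed

text \<open>The case \<open>a = - 1\<close> of \<open>dilation\<close>, together with the resulting formula for \<open>t\<close> in terms of \<open>V\<close>.\<close>

lemma hensel_coordinates:
  fixes D :: "'r::idom"
  assumes B: "subring B" and mem: "D \<in> B" "m \<in> B" "b \<in> B" "c \<in> B" "coeffs_in B K" "S \<in> B" "c0 \<in> B"
    and nilp: "m ^ k = D * c" and D: "D \<noteq> 0" and root: "b - S + m * poly K S = D * c0"
    and eq: "D * t = b - s + m * poly K s"
  obtains V j where "s = S + D * V" "rhull (insert V B) = rhull (insert s (insert t B))"
    "j \<in> rhull (insert V B)" "t = c0 + V * (m * j - 1)"
proof -
  have m1: "-1 \<in> B" "0 \<in> B" using B subringD(5)[OF B subringD(1)[OF B]] subringD(2) by auto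
  obtain V where V: "s = S + D * V" "rhull (insert V B) = rhull (insert s (insert t B))"
    using dilation[OF B m1(1) m1(1) mem(2,1) m1(2) mem(4,6,7,5) D _ nilp, of t b s] eq root by auto
  let ?R = "rhull (insert V B)"
  have R: "subring ?R" "B \<subseteq> ?R" by (auto intro: rhull_incl)
  have sR: "s \<in> ?R" unfolding V(2) by (auto intro: rhull_incl)
  obtain j where j: "j \<in> ?R" "poly K s - poly K S = (s - S) * j"
    using poly_diff_factor[OF R(1) sR, of S K] mem R(2) coeffs_in_mono by blast
  have "poly K s = poly K S + D * V * j" using j(2) V(1) by (simp add: algebra_simps)
  then have "D * t = D * c0 + D * (V * (m * j - 1))" unfolding eq root[symmetric] V(1) by (simp add: algebra_simps)
  then have "D * t = D * (c0 + V * (m * j - 1))" by (simp add: algebra_simps)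
  then have "t = c0 + V * (m * j - 1)" using D mult_left_cancel by blast
  then show ?thesis using that V j(1) by blast
qed

text \<open>The converse construction: coordinates \<open>s = S + D V\<close> and \<open>t\<close> are made from a given \<open>V\<close>.\<close>

lemma hensel_lift:
  fixes D :: "'r::idom"
  assumes B: "subring B" and mem: "D \<in> B" "m \<in> B" "b \<in> B" "c \<in> B" "coeffs_in B K" "S \<in> B" "c0 \<in> B"
    and nilp: "m ^ k = D * c" and D: "D \<noteq> 0" and root: "b - S + m * poly K S = D * c0"
  obtains t where "D * t = b - (S + D * V) + m * poly K (S + D * V)"
    "rhull (insert V B) = rhull (insert (S + D * V) (insert t B))"
proof -
  let ?R = "rhull (insert V B)" let ?s = "S + D * V"
  have R: "subring ?R" "B \<subseteq> ?R" "V \<in> ?R" by (auto intro: rhull_incl)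
  have sR: "?s \<in> ?R" using mem R by (auto intro!: subringD(4,6)[OF R(1)])
  obtain j where j: "j \<in> ?R" "poly K ?s - poly K S = (?s - S) * j"
    using poly_diff_factor[OF R(1) sR, of S K] mem R(2) coeffs_in_mono by blast
  define t where "t = c0 + V * (m * j - 1)"
  have "poly K ?s = poly K S + D * V * j" using j(2) by (simp add: algebra_simps)
  then have t: "D * t = b - ?s + m * poly K ?s" unfolding t_def distrib_left root[symmetric] by (simp add: algebra_simps)
  obtain V' j' where V': "?s = S + D * V'" "rhull (insert V' B) = rhull (insert ?s (insert t B))"
    using hensel_coordinates[OF B mem nilp D root t] by metis
  then have "V' = V" using D by simp
  then show ?thesis using that[OF t] V'(2) by simp
qed

lemma hensel_iter_cong:
  assumes S: "subring S" and "cong_in S q b b'" "cong_in S q m m'" "\<And>n. cong_in S q (coeff K n) (coeff K' n)"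
    and "b \<in> S" "b' \<in> S" "m \<in> S" "m' \<in> S" "coeffs_in S K" "coeffs_in S K'"
  shows "cong_in S q (hensel_iter (-1) b m K j) (hensel_iter (-1) b' m' K' j)"
proof (induction j)
  case 0 then show ?case by (simp add: cong_in_refl S)
next
  case (Suc j)
  have m1: "-1 \<in> S" using subringD(5)[OF S subringD(1)[OF S]] by simp
  have h: "hensel_iter (-1) b m K j \<in> S" "hensel_iter (-1) b' m' K' j \<in> S"
    using hensel_iter_in assms m1 by blast+
  have "cong_in S q (poly K (hensel_iter (-1) b m K j)) (poly K' (hensel_iter (-1) b' m' K' j))"
    by (rule cong_in_poly[OF S Suc h assms(9,10,4)])
  then have "cong_in S q (b + m * poly K (hensel_iter (-1) b m K j)) (b' + m' * poly K' (hensel_iter (-1) b' m' K' j))"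
    using assms h by (intro cong_in_add cong_in_mult) (auto intro: poly_in_subring)
  then show ?case by simp
qed

lemma separate_roots:
  fixes P :: "complex poly"
  assumes "P \<noteq> 0"
  shows "\<exists>P1 P2. P = P1 * P2 \<and> (\<forall>l. poly P2 l = 0 \<longrightarrow> l \<in> Z) \<and> (\<forall>l\<in>Z. poly P1 l \<noteq> 0)"
  using assms
proof (induction "degree P" arbitrary: P rule: less_induct)
  case less
  show ?case
  proof (cases "\<exists>l\<in>Z. poly P l = 0")
    case True
    then obtain l where l: "l \<in> Z" "poly P l = 0" by blast
    then obtain P' where P: "P = [:-l, 1:] * P'" using poly_eq_0_iff_dvd by (metis dvdE)
    have "P' \<noteq> 0" "degree P' < degree P"
      using less.prems unfolding P by (auto simp: degree_mult_eq simp del: mult_pCons_left)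
    then obtain P1 P2 where "P' = P1 * P2" "\<forall>l. poly P2 l = 0 \<longrightarrow> l \<in> Z" "\<forall>l\<in>Z. poly P1 l \<noteq> 0"
      using less.hyps by blast
    then have "P = P1 * ([:-l, 1:] * P2)" "\<forall>k. poly ([:-l, 1:] * P2) k = 0 \<longrightarrow> k \<in> Z" "\<forall>k\<in>Z. poly P1 k \<noteq> 0"
      using l unfolding P by (simp_all only: mult.left_commute, auto)
    then show ?thesis by blast
  next
    case False
    then have "P = P * 1 \<and> (\<forall>l. poly (1 :: complex poly) l = 0 \<longrightarrow> l \<in> Z) \<and> (\<forall>l\<in>Z. poly P l \<noteq> 0)" by simp
    then show ?thesis by blast
  qed
qed

lemma ev2_spec_cong:
  assumes "over S" "a \<in> S" "b \<in> S"
  shows "cong_in S (pix l) (ev2 emb_base P a b) (ev2 (\<lambda>k. emb_base [:k:]) (spec_yz l P) a b)"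
proof -
  let ?L = "map_poly (map_poly (\<lambda>k. [:k:])) (spec_yz l P)"
  have "spec_yz l (P - ?L) = 0"
    by (simp add: poly_eq_iff coeff_spec_yz coeff_specialize_xy coeff_map_poly)
  then obtain Q where "P - ?L = [:[:[:-l, 1:]:]:] * Q" using spec_yz_0_dvd by (blast elim: dvdE)
  then have P: "P = ?L + [:[:[:-l, 1:]:]:] * Q" by (simp add: diff_eq_eq add.commute)
  note h = ring_hom_ev2[OF ring_hom_emb_base, of a b]
  have "ev2 emb_base [:[:[:-l, 1:]:]:] a b = pix l"
    by (simp add: ev2_def evp_const[OF ring_hom_evp[OF ring_hom_emb_base]] evp_const[OF ring_hom_emb_base])
  then have "ev2 emb_base P a b = ev2 emb_base ?L a b + pix l * ev2 emb_base Q a b"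
    by (subst P) (simp only: ring_homD(2,3)[OF h])
  moreover have "ev2 emb_base ?L a b = ev2 (\<lambda>k. emb_base [:k:]) (spec_yz l P) a b"
    unfolding ev2_def evp_map_poly[OF ring_hom_map_poly[OF ring_hom_const] ring_hom_evp[OF ring_hom_emb_base]]
      evp_map_poly[OF ring_hom_const ring_hom_emb_base] ..
  ultimately show ?thesis unfolding cong_in_def using ev2_over[OF assms] by auto
qed

lemma gen_transfer:
  assumes S: "over S" and c: "cong_in S m a a'" and mem: "p \<in> S" "a \<in> S" "a' \<in> S" and b: "b \<in> gen {p, a}"
  shows "\<exists>b'\<in>gen {p, a'}. cong_in S m b b'"
proof -
  have GS: "gen {p, a} \<subseteq> S" "gen {p, a'} \<subseteq> S" using S mem by (intro gen_over; auto)+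
  from b show ?thesis unfolding gen_def[of "{p, a}"]
  proof induction
    case (rhull_incl x)
    then consider "x \<in> range emb_base" | "x = p" | "x = a" by blast
    then show ?case
    proof cases
      case 1 then show ?thesis using S by (intro bexI[of _ x]) (auto intro: cong_in_refl gen_ops)
    next
      case 2 then show ?thesis using S by (intro bexI[of _ x]) (auto intro: cong_in_refl gen_incl)
    next
      case 3 then show ?thesis using c by (intro bexI[of _ a']) (auto intro: gen_incl)
    qed
  next
    case rhull_one then show ?case using S by (intro bexI[of _ 1]) (auto intro: cong_in_refl gen_ops)
  next
    case (rhull_diff x y)
    then obtain x' y' where "x' \<in> gen {p, a'}" "cong_in S m x x'" "y' \<in> gen {p, a'}" "cong_in S m y y'" by blast
    then show ?case using S by (intro bexI[of _ "x' - y'"] cong_in_diff gen_ops) auto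
  next
    case (rhull_mult x y)
    then obtain x' y' where *: "x' \<in> gen {p, a'}" "cong_in S m x x'" "y' \<in> gen {p, a'}" "cong_in S m y y'" by blast
    moreover have "x \<in> S" "y' \<in> S" using GS rhull_mult.hyps * by (auto simp: gen_def)
    ultimately show ?case using S by (intro bexI[of _ "x' * y'"] cong_in_mult gen_ops) auto
  qed
qed

lemma emb_const_mult: "emb_base [:a:] * emb_base [:b:] = emb_base [:a * b:]"
  by (simp add: mult.commute flip: emb_base_simps(3))

lemma emb_const_1 [simp]: "emb_base [:1:] = 1"
  by (simp add: emb_base_simps flip: one_pCons)

lemma emb_const_inverse:
  fixes k :: complex
  assumes "k \<noteq> 0" shows "emb_base [:1 / k:] * (emb_base [:k:] * x) = x"
proof -
  have "1 / k * k = 1" using assms by simp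
  then show ?thesis by (simp only: mult.assoc[symmetric] emb_const_mult emb_const_1 mult_1)
qed

text \<open>On the fibre \<open>x = l\<close> the variable \<open>p\<close> is \<open>N(y, h z)\<close>. By \<open>variable_shape\<close> it is a sheared linear
  form in \<open>y\<close> and \<open>z\<close>, and \<open>h(l) \<noteq> 0\<close> allows to express it by \<open>y\<close> and \<open>h z\<close>. As an identity of polynomials
  it may be evaluated at any \<open>a\<close> and \<open>b\<close>.\<close>

lemma fibre_shape:
  fixes N :: "complex poly poly poly"
  assumes res: "residual_x_variable p"
    and p: "p = emb_base k * emb_y F * var_u + emb_yz (pcompose N [:0, [:h:]:])"
    and kl: "poly k l = 0" and N1: "coeff N 1 = [:q:]" and qh: "poly q l \<noteq> 0" "poly h l \<noteq> 0"
  obtains R where "\<And>S a b. over S \<Longrightarrow> a \<in> S \<Longrightarrow> b \<in> S \<Longrightarrow> cong_in S (pix l) (ev2 emb_base N a b)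
    (emb_base [:poly q l:] * b + evp (\<lambda>k. emb_base [:k:]) (specialize_xy l (coeff N 0)) (a - evp (\<lambda>k. emb_base [:k:]) R b))"
proof -
  let ?g = "pcompose N [:0, [:h:]:]" let ?G = "specialize_xy l (coeff N 0)"
  have cg: "coeff ?g n = [:h:] ^ n * coeff N n" for n by (rule coeff_pcompose_linear)
  have "specialize_x l p = emb_yz (spec_yz l ?g)"
    unfolding p ring_homD[OF ring_hom_specialize_x] specialize_atoms kl by (simp add: emb_base_simps emb_base_def)
  then have var: "is_variable (emb_yz (spec_yz l ?g))" using res by (metis residual_x_variable_def)
  have "coeff (spec_yz l ?g) 1 = [:poly q l * poly h l:]"
    using cg[of 1] by (simp add: coeff_spec_yz N1[simplified] specialize_xy_simps mult.commute)
  moreover have "coeff (spec_yz l ?g) 0 = ?G" using cg[of 0] by (simp add: coeff_spec_yz)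
  ultimately obtain R where R: "\<And>y z. pt2 (spec_yz l ?g) y z = poly q l * poly h l * z + poly ?G (y - poly R z)"
    using variable_shape[OF var, of "poly q l * poly h l"] qh by auto
  have gN: "pt2 (spec_yz l ?g) y z = pt2 (spec_yz l N) y (poly h l * z)" for y z
  proof -
    have "spec_yz l ?g = pcompose (spec_yz l N) [:0, [:poly h l:]:]"
    proof (rule poly_eqI)
      fix n
      have "specialize_xy l ([:h:] ^ n * coeff N n) = [:poly h l:] ^ n * specialize_xy l (coeff N n)"
        by (simp add: ring_homD(3,7)[OF ring_hom_specialize_xy] specialize_xy_simps)
      then show "coeff (spec_yz l ?g) n = coeff (pcompose (spec_yz l N) [:0, [:poly h l:]:]) n"
        by (simp only: coeff_spec_yz cg coeff_pcompose_linear)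
    qed
    moreover have "poly (pcompose P [:0, [:k:]:]) [:z:] = poly P [:k * z:]" for P :: "complex poly poly" and k
      by (simp add: poly_pcompose mult.commute)
    ultimately show ?thesis by (simp flip: poly_poly_const)
  qed
  define R' where "R' = pcompose R [:0, 1 / poly h l:]"
  have N: "pt2 (spec_yz l N) y x = poly q l * x + poly ?G (y - poly R' x)" for y x
    using R[of y "x / poly h l"] gN[of y "x / poly h l"] qh by (simp add: R'_def poly_pcompose)
  let ?c = "\<lambda>k::complex. [:[:k:]:]"
  have ptc: "pt2 (evp ?c P a) y x = poly P (pt2 a y x)" for P a y x
    unfolding evp_comp[OF ring_hom_const2 ring_hom_pt2] by (simp add: pt2_atoms evp_id)
  have Npoly: "spec_yz l N = ?c (poly q l) * [:0, 1:] + evp ?c ?G ([:[:0, 1:]:] - evp ?c R' [:0, 1:])"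
    by (rule pt2_eqI) (simp only: N ring_homD[OF ring_hom_pt2] ptc pt2_atoms)
  show ?thesis
  proof (rule that[of R'])
    fix S a b assume S: "over S" "a \<in> S" "b \<in> S"
    let ?i = "\<lambda>k. emb_base [:k:]"
    note h = ring_hom_ev2[OF ring_hom_lift, of a b]
    have atoms: "ev2 ?i (?c k) a b = ?i k" "ev2 ?i [:[:0, 1:]:] a b = a" "ev2 ?i [:0, 1:] a b = b" for k
      by (simp_all only: ev2_def evp_const[OF ring_hom_evp[OF ring_hom_lift]] evp_const[OF ring_hom_lift]
        evp_X[OF ring_hom_evp[OF ring_hom_lift]] evp_X[OF ring_hom_lift])
    have evc: "ev2 ?i (evp ?c P x) a b = evp ?i P (ev2 ?i x a b)" for P x
      unfolding evp_comp[OF ring_hom_const2 h] atoms ..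
    have "ev2 ?i (spec_yz l N) a b = ?i (poly q l) * b + evp ?i ?G (a - evp ?i R' b)"
      unfolding Npoly by (simp only: ring_homD[OF h] evc atoms)
    then show "cong_in S (pix l) (ev2 emb_base N a b) (?i (poly q l) * b + evp ?i ?G (a - evp ?i R' b))"
      using ev2_spec_cong[OF S, of l N] by simp
  qed
qed

section \<open>Lifting coordinates from the fibres over \<open>q = 0\<close>\<close>

text \<open>The polynomial \<open>- \<kappa>(a, X)\<close>; the sign fits the form \<open>b - s + m K(s)\<close> of \<open>hensel_coordinates\<close>.\<close>

definition kap_at :: "complex poly poly poly \<Rightarrow> complex poly poly poly poly \<Rightarrow> complex poly poly poly poly poly"
  where "kap_at kap a = - map_poly (\<lambda>c. evp emb_base c a) kap"

lemma poly_kap_at: "poly (kap_at kap a) x = - ev2 emb_base kap a x"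
  by (simp add: kap_at_def ev2_def evp_def)

lemma coeff_kap_at: "coeff (kap_at kap a) n = - evp emb_base (coeff kap n) a"
  by (simp add: kap_at_def coeff_map_poly)

lemma coeffs_in_kap_at: "a \<in> gen X \<Longrightarrow> coeffs_in (gen X) (kap_at kap a)"
  unfolding coeffs_in_def coeff_kap_at by (intro allI gen_ops gen_evp)

lemma pix_prime: "prime_elem (pix l)"
  by (simp add: emb_base_def prime_elem_const_poly_iff prime_elem_linear_field_poly)

lemma specialize_pix: "specialize_x l (pix l) = 0"
  by (simp add: specialize_atoms)

lemma lin_prod_cong_in: "over S \<Longrightarrow> finite Z \<Longrightarrow> l \<in> Z \<Longrightarrow> cong_in S (emb_base (lin_prod Z)) a b \<Longrightarrow> cong_in S (pix l) a b"
proof -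
  assume S: "over S" "finite Z" "l \<in> Z" "cong_in S (emb_base (lin_prod Z)) a b"
  then obtain e where e: "e \<in> S" "a - b = emb_base (lin_prod Z) * e" by (auto simp: cong_in_def)
  have "[:-l, 1:] dvd lin_prod Z" unfolding poly_eq_0_iff_dvd[symmetric] using S by (simp add: poly_lin_prod)
  then obtain k where "lin_prod Z = [:-l, 1:] * k" by (rule dvdE)
  then have "a - b = pix l * (emb_base k * e)" using e by (simp add: emb_base_simps mult.assoc del: mult_pCons_left)
  then show ?thesis unfolding cong_in_def using S e by (auto intro!: bexI[of _ "emb_base k * e"] subringD(4))
qed

text \<open>Modulo \<open>Q\<close> the variable \<open>y\<close> agrees with \<open>yy = n (p - a0) \<in> A[p]\<close>, so there the coordinates \<open>s\<close>, \<open>t\<close>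
  arise from \<open>W\<close> and \<open>V\<close> by the Hensel construction over \<open>A[p]\<close> with \<open>y\<close> replaced by \<open>yy\<close>. That
  construction makes sense over all of \<open>A\<close>. The obstacle is that \<open>W\<close>, \<open>V\<close> are coordinates modulo \<open>Q\<close>
  whose determinant \<open>e = - a1 D1\<close> relative to \<open>y2\<close>, \<open>w\<close> is not constant. It is absorbed by replacing \<open>ft\<close> by \<open>e ft\<close>, which divides
  \<open>t\<close> by \<open>e\<close>, and \<open>\<eta>\<close> by a multiple that is nilpotent also modulo \<open>e\<close>.\<close>

lemma congruent_coordinates:
  fixes ft eta g0 :: "complex poly poly" and n m a0 a1 D1 h r Q :: "complex poly"
    and w p y2 W V s t :: "complex poly poly poly poly" and kap :: "complex poly poly poly"
  defines "E \<equiv> gen {w, p, y2}"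
  defines "b \<equiv> W - emb_y g0 * var_y ^ 2"
  assumes Z: "finite Z" "Z \<noteq> {}" and Q: "Q = lin_prod Z"
    and atZ: "\<And>l. l \<in> Z \<Longrightarrow> poly a1 l \<noteq> 0 \<and> poly n l \<noteq> 0 \<and> poly D1 l \<noteq> 0 \<and> specialize_xy l ft \<noteq> 0"
    and mem: "var_y \<in> E" "W \<in> E" "V \<in> E" "s \<in> E" "t \<in> E"
    and ind: "emb_base h * var_z \<in> E" "emb_base r * var_u \<in> E" "h \<noteq> 0" "r \<noteq> 0"
    and cy: "cong_in E (emb_base Q) var_y (emb_base n * (p - emb_base a0))"
    and cW: "cong_in E (emb_base Q) W (emb_base m * (p - emb_base a0) - emb_base a1 * y2)"
    and cV: "cong_in E (emb_base Q) V (emb_base D1 * w)"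
    and eta: "eta ^ Suc k = ft * th"
    and s: "s = hensel_iter (-1) b (emb_y eta) (kap_at kap var_y) (Suc k) + emb_y ft * V"
    and t: "emb_y ft * t = b - s + emb_y eta * poly (kap_at kap var_y) s"
  obtains s' t' e where "gen {s', t', p} = E" "cong_in E (emb_base Q) s s'" "cong_in E (emb_base Q) t (emb_base e * t')"
    "\<And>l. l \<in> Z \<Longrightarrow> poly e l \<noteq> 0"
proof -
  have E: "over E" and Es: "subring E" by (simp_all add: E_def)
  have wE: "w \<in> E" "p \<in> E" "y2 \<in> E" by (auto simp: E_def intro: gen_incl)
  note Eops = gen_ops[where X = "{w, p, y2}", folded E_def] gen_evp[where X = "{w, p, y2}", folded E_def]
  let ?Q = "emb_base Q"
  have rootQ: "poly Q l = 0 \<longleftrightarrow> l \<in> Z" for l using Z by (simp add: Q poly_lin_prod)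
  \<comment> \<open>A change of coordinates of determinant \<open>1\<close> that is \<open>diag(- a1, - 1/a1)\<close> modulo \<open>Q\<close>; \<open>Q\<^sup>2\<close> makes room for the two off-diagonal entries.\<close>
  obtain d b' where db: "a1 * d + Q * Q * b' = -1"
  proof -
    obtain U V where UV: "a1 * U + (Q * Q) * V = 1" using complex_bezout[of a1 "Q * Q"] atZ rootQ by (metis mult_eq_0_iff poly_mult)
    have "a1 * (- U) + Q * Q * (- V) = - (a1 * U + (Q * Q) * V)" by simp
    then have "a1 * (- U) + Q * Q * (- V) = - 1" unfolding UV .
    then show ?thesis using that by blast
  qed
  have dbE: "emb_base a1 * emb_base d + ?Q * ?Q * emb_base b' = -1"
  proof -
    have "emb_base (a1 * d + Q * Q * b') = emb_base (-1)" by (simp only: db)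
    then show ?thesis by (simp add: emb_base_simps)
  qed
  define X where "X = ?Q * emb_base b' * w - emb_base a1 * y2"
  define W' where "W' = emb_base m * (p - emb_base a0) + X"
  define V' where "V' = ?Q * y2 + emb_base d * w"
  have y2E: "y2 = emb_base d * X - ?Q * emb_base b' * V'"
  proof -
    have "emb_base d * X - ?Q * emb_base b' * V' = - ((emb_base a1 * emb_base d + ?Q * ?Q * emb_base b') * y2)"
      by (simp add: X_def V'_def algebra_simps)
    then show ?thesis unfolding dbE by simp
  qed
  have wE': "w = - ?Q * X - emb_base a1 * V'"
  proof -
    have "- ?Q * X - emb_base a1 * V' = - ((emb_base a1 * emb_base d + ?Q * ?Q * emb_base b') * w)"
      by (simp add: X_def V'_def algebra_simps)
    then show ?thesis unfolding dbE by simp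
  qed
  have XE: "X \<in> E" "W' \<in> E" "V' \<in> E" unfolding X_def W'_def V'_def by (intro Eops wE)+
  have EVW: "gen {V', p, W'} = E"
    unfolding E_def
  proof (rule gen_eqI)
    show "{V', p, W'} \<subseteq> gen {w, p, y2}" using XE wE by (simp add: E_def)
    have in': "V' \<in> gen {V', p, W'}" "p \<in> gen {V', p, W'}" "W' \<in> gen {V', p, W'}" by (auto intro: gen_incl)
    have "X = W' - emb_base m * (p - emb_base a0)" by (simp add: W'_def)
    then have X': "X \<in> gen {V', p, W'}" by (simp only:) (intro gen_ops in')
    have "y2 \<in> gen {V', p, W'}" by (subst y2E) (intro gen_ops in' X')
    moreover have "w \<in> gen {V', p, W'}" by (subst wE') (intro gen_ops in' X')
    ultimately show "{w, p, y2} \<subseteq> gen {V', p, W'}" using in' by simp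
  qed
  have cWW: "cong_in E ?Q W W'"
  proof -
    have "cong_in E ?Q (emb_base m * (p - emb_base a0) - emb_base a1 * y2) W'"
      unfolding cong_in_def
      by (intro bexI[of _ "- (emb_base b' * w)"]) (simp_all add: W'_def X_def algebra_simps, intro Eops wE)
    then show ?thesis using cong_in_trans[OF Es cW] by blast
  qed
  define e where "e = - a1 * D1"
  have e0: "poly e l \<noteq> 0" if "l \<in> Z" for l using atZ[OF that] by (simp add: e_def)
  have cVV: "cong_in E ?Q V (emb_base e * V')"
  proof -
    have "cong_in E ?Q (emb_base D1 * w) (emb_base e * V')"
      unfolding cong_in_def
      by (intro bexI[of _ "- (emb_base D1 * X)"])
        (subst wE', simp add: e_def emb_base_simps algebra_simps, intro Eops XE)
    then show ?thesis using cong_in_trans[OF Es cV] by blast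
  qed
  \<comment> \<open>As \<open>ee\<close> is \<open>1\<close> modulo \<open>Q\<close> and \<open>0\<close> modulo \<open>e\<close>, the product \<open>ee hh\<close> is nilpotent modulo \<open>e ff\<close> and unchanged modulo \<open>Q\<close>.\<close>
  obtain e1 e2 where ee: "e * e1 + Q * e2 = 1" using complex_bezout[of e Q] e0 rootQ by metis
  define ee where "ee = emb_base (e * e1)"
  have cee: "cong_in E ?Q 1 ee"
  proof -
    have "1 - ee = emb_base (e * e1 + Q * e2) - ee" unfolding ee by (simp add: emb_base_simps)
    also have "\<dots> = ?Q * emb_base e2" by (simp add: ee_def emb_base_simps)
    finally show ?thesis unfolding cong_in_def using E by auto
  qed
  define yy where "yy = emb_base n * (p - emb_base a0)"
  let ?B = "gen {p, W'}"
  have inB: "p \<in> ?B" "W' \<in> ?B" by (auto intro: gen_incl)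
  have yyB: "yy \<in> ?B" unfolding yy_def by (intro gen_ops inB)
  have BE: "?B \<subseteq> E" unfolding EVW[symmetric] by (rule gen_mono) auto
  have yyE: "yy \<in> E" using yyB BE by auto
  define ff where "ff = evp emb_base ft yy"
  define hh where "hh = evp emb_base eta yy"
  define bb where "bb = W' - evp emb_base g0 yy * yy ^ 2"
  define KK where "KK = kap_at kap yy"
  define mm where "mm = ee * hh"
  define D where "D = emb_base e * ff"
  have memB: "ff \<in> ?B" "hh \<in> ?B" "bb \<in> ?B" "coeffs_in ?B KK" "ee \<in> ?B"
    unfolding ff_def hh_def bb_def KK_def ee_def by (intro coeffs_in_kap_at gen_ops gen_evp yyB inB)+
  have memB': "mm \<in> ?B" "D \<in> ?B" unfolding mm_def D_def by (intro gen_ops memB)+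
  \<comment> \<open>To cancel \<open>ff\<close> modulo \<open>pix l\<close> inside \<open>E\<close>, pull everything back to the polynomial ring, where \<open>pix l\<close> is prime.\<close>
  define P0 where "P0 = evp emb_base ft (emb_base n * (var_y - emb_base a0))"
  have ffP: "ff = ev3 emb_base P0 p y2 w"
    unfolding P0_def evp_comp[OF ring_hom_emb_base ring_hom_ev3[OF ring_hom_emb_base]]
    by (simp add: ring_homD[OF ring_hom_ev3[OF ring_hom_emb_base]] ev3_emb_base ev3_vars ring_hom_emb_base ff_def yy_def)
  have E': "E = gen {p, y2, w}" unfolding E_def by (simp add: insert_commute)
  have inj: "P = 0" if "ev3 emb_base P p y2 w = 0" for P
    using ev3_injective[of p y2 w h r P] mem ind that by (simp add: E')
  note ev = ring_homD[OF ring_hom_ev3[OF ring_hom_emb_base, of p y2 w]]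
  have ndvd: "\<not> pix l dvd P0" if l: "l \<in> Z" for l
  proof
    assume "pix l dvd P0"
    then obtain k where "P0 = pix l * k" by (rule dvdE)
    then have 0: "specialize_x l P0 = 0" by (simp add: ring_homD[OF ring_hom_specialize_x] specialize_pix)
    have "poly (specialize_xy l ft) x = 0" for x
    proof -
      have "ev3 (at_x l) P0 (x / poly n l + poly a0 l) 0 0 = 0"
        unfolding pt3_specialize_x[symmetric] 0 by (simp add: ring_homD[OF ring_hom_pt3])
      then show ?thesis unfolding P0_def at_evp using atZ[OF l] by (simp add: ring_homD[OF ring_hom_at] at_atoms)
    qed
    then have "specialize_xy l ft = 0" by (intro poly_eqI_all) simp
    then show False using atZ[OF l] by simp
  qed
  have cancel: "cong_in E (pix l) x x'" if l: "l \<in> Z" and x: "x \<in> E" "x' \<in> E" "cong_in E (pix l) (ff * x) (ff * x')" for l x x'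
  proof -
    have "x - x' \<in> E" using x by (intro Eops)
    then obtain P1 where P1: "x - x' = ev3 emb_base P1 p y2 w" using gen_is_ev3 unfolding E' by blast
    obtain z where "z \<in> E" "ff * x - ff * x' = pix l * z" using x by (auto simp: cong_in_def)
    then obtain P2 where P2: "ff * x - ff * x' = pix l * ev3 emb_base P2 p y2 w" using gen_is_ev3 unfolding E' by metis
    have "ev3 emb_base (P0 * P1 - pix l * P2) p y2 w = ff * (x - x') - pix l * ev3 emb_base P2 p y2 w"
      by (simp add: ev ffP P1 ev3_emb_base ring_hom_emb_base)
    also have "\<dots> = 0" using P2 by (simp add: algebra_simps)
    finally have "P0 * P1 = pix l * P2" using inj by (metis eq_iff_diff_eq_0)
    then have "pix l dvd P0 * P1" by (metis dvdI)
    then have "pix l dvd P1" using ndvd[OF l] pix_prime prime_elem_dvd_mult_iff by blast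
    then obtain P3 where "P1 = pix l * P3" by (rule dvdE)
    then have "x - x' = pix l * ev3 emb_base P3 p y2 w" unfolding P1 by (simp add: ev ev3_emb_base ring_hom_emb_base)
    moreover have "ev3 emb_base P3 p y2 w \<in> E"
      unfolding ev3_def by (rule evp_in_subring[OF Es]) (auto simp: ring_hom_ev2 ring_hom_emb_base wE intro!: ev2_over[OF E])
    ultimately show ?thesis unfolding cong_in_def by blast
  qed
  have ff0: "ff \<noteq> 0"
  proof
    assume "ff = 0"
    then have "P0 = 0" using ffP inj by simp
    then show False using ndvd Z(2) by auto
  qed
  have eQ: "e \<noteq> 0" using e0 Z(2) by auto
  have D0: "D \<noteq> 0" using ff0 eQ by (simp add: D_def)
  define cc where "cc = emb_base (e1 * (e * e1) ^ k) * evp emb_base th yy"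
  have ccB: "cc \<in> ?B" unfolding cc_def by (intro gen_ops gen_evp yyB)
  have nilp: "mm ^ Suc k = D * cc"
  proof -
    have "evp emb_base (eta ^ Suc k) yy = evp emb_base (ft * th) yy" by (simp only: eta)
    then have "hh ^ Suc k = ff * evp emb_base th yy"
      unfolding hh_def ff_def ring_homD(3,7)[OF ring_hom_evp[OF ring_hom_emb_base]] .
    then show ?thesis
      unfolding mm_def power_mult_distrib D_def cc_def ee_def by (simp add: emb_base_simps power_mult_distrib mult_ac)
  qed
  let ?S = "hensel_iter (-1) b (emb_y eta) (kap_at kap var_y) (Suc k)"
  define S' where "S' = hensel_iter (-1) bb mm KK (Suc k)"
  have Bs: "subring ?B" by simp
  have m1B: "-1 \<in> ?B" by (intro gen_ops)
  have S'B: "S' \<in> ?B" unfolding S'_def by (rule hensel_iter_in[OF Bs m1B memB(3) memB'(1) memB(4)])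
  obtain c0 where c0: "c0 \<in> ?B" "bb - S' + mm * poly KK S' = D * c0"
    unfolding S'_def by (rule hensel_root[OF Bs memB'(2,1) memB(3) ccB memB(4) nilp])
  define s' where "s' = S' + D * V'"
  obtain t' where t': "D * t' = bb - s' + mm * poly KK s'" "rhull (insert V' ?B) = rhull (insert s' (insert t' ?B))"
    unfolding s'_def by (rule hensel_lift[OF Bs memB'(2,1) memB(3) ccB memB(4) S'B c0(1) nilp D0 c0(2)])
  have g1: "gen {s', t', p, W'} = E" using t'(2) unfolding rhull_insert_gen rhull_insert2_gen EVW by simp
  have st'E: "s' \<in> E" "t' \<in> E" unfolding g1[symmetric] by (auto intro: gen_incl)
  have gE: "gen {s', t', p} = E"
    unfolding g1[symmetric]
  proof (rule gen_eqI)
    show "{s', t', p} \<subseteq> gen {s', t', p, W'}" by (auto intro: gen_incl)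
    let ?G = "gen {s', t', p}"
    have in3: "s' \<in> ?G" "t' \<in> ?G" "p \<in> ?G" by (auto intro: gen_incl)
    have yyG: "yy \<in> ?G" unfolding yy_def by (intro gen_ops in3)
    have "W' = D * t' + s' - mm * poly KK s' + evp emb_base g0 yy * yy ^ 2"
      unfolding t'(1) bb_def by simp
    also have "\<dots> = emb_base e * ff * t' + s' + ee * hh * ev2 emb_base kap yy s' + evp emb_base g0 yy * yy ^ 2"
      by (simp add: KK_def poly_kap_at mm_def D_def)
    also have "\<dots> \<in> ?G" unfolding ff_def hh_def ee_def by (intro gen_ops gen_evp gen_ev2 in3 yyG)
    finally show "{s', t', p, W'} \<subseteq> ?G" using in3 by simp
  qed
  have cyy: "cong_in E ?Q var_y yy" unfolding yy_def by (rule cy)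
  have cev: "cong_in E ?Q (emb_y P) (evp emb_base P yy)" for P
    unfolding evp_emb_base[symmetric] by (rule cong_in_evp[OF E cyy mem(1) yyE])
  have evE: "evp emb_base P yy \<in> E" "emb_y P \<in> E" for P
    using yyE mem(1) by (auto simp: evp_emb_base[symmetric] E evp_over)
  have memE: "ff \<in> E" "hh \<in> E" "bb \<in> E" "ee \<in> E" "mm \<in> E" using memB memB' BE by auto
  have cft: "cong_in E ?Q (emb_y ft) ff" unfolding ff_def by (rule cev)
  have cb: "cong_in E ?Q b bb"
    unfolding b_def bb_def using XE
    by (intro cong_in_diff cong_in_mult cong_in_power cWW cev cyy Es evE mem yyE subringD(7)[OF Es])
  have bE: "b \<in> E" unfolding b_def by (intro Eops evE mem)
  have cm: "cong_in E ?Q (emb_y eta) mm"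
  proof -
    have "cong_in E ?Q (1 * emb_y eta) (ee * hh)"
      unfolding hh_def by (intro cong_in_mult cee cev Es evE Eops)
    then show ?thesis by (simp add: mm_def)
  qed
  have KE: "coeffs_in E (kap_at kap var_y)" "coeffs_in E KK"
    unfolding KK_def using mem(1) yyE by (auto intro: coeffs_in_kap_at[where X = "{w, p, y2}", folded E_def])
  have cK: "cong_in E ?Q (coeff (kap_at kap var_y) n) (coeff KK n)" for n
  proof -
    have "cong_in E ?Q (0 - emb_y (coeff kap n)) (0 - evp emb_base (coeff kap n) yy)"
      by (intro cong_in_diff cev cong_in_refl Es)
    then show ?thesis by (simp add: KK_def coeff_kap_at evp_emb_base)
  qed
  have cS: "cong_in E ?Q ?S S'"
    unfolding S'_def by (rule hensel_iter_cong[OF Es cb cm cK bE memE(3) evE(2) memE(5) KE])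
  have cs: "cong_in E ?Q s s'"
  proof -
    have "cong_in E ?Q (?S + emb_y ft * V) (S' + ff * (emb_base e * V'))"
      by (intro cong_in_add cong_in_mult cS cft cVV Es evE Eops XE)
    then show ?thesis by (simp add: s s'_def D_def mult_ac)
  qed
  have ct: "cong_in E ?Q t (emb_base e * t')"
    unfolding Q
  proof (rule cong_in_lin_prod[OF E Z(1) mem(5)])
    show "emb_base e * t' \<in> E" by (intro Eops st'E)
    fix l assume l: "l \<in> Z"
    have "cong_in E ?Q (b - s + emb_y eta * poly (kap_at kap var_y) s) (bb - s' + mm * poly KK s')"
      by (intro cong_in_add cong_in_diff cong_in_mult cong_in_poly cb cs cm cK KE Es evE mem st'E poly_in_subring)
    then have 1: "cong_in E ?Q (emb_y ft * t) (ff * (emb_base e * t'))"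
      unfolding t[symmetric] t'(1)[symmetric] D_def by (simp add: mult_ac)
    have "cong_in E ?Q (ff * t) (emb_y ft * t)"
      by (intro cong_in_mult cong_in_sym[OF Es cft] cong_in_refl Es memE mem)
    then have "cong_in E ?Q (ff * t) (ff * (emb_base e * t'))" using 1 cong_in_trans[OF Es] by blast
    then have "cong_in E (pix l) (ff * t) (ff * (emb_base e * t'))"
      unfolding Q by (rule lin_prod_cong_in[OF E Z(1) l])
    then show "cong_in E (pix l) t (emb_base e * t')"
      by (intro cancel[OF l mem(5)] Eops st'E)
  qed
  show ?thesis using that[OF gE cs ct e0] .
qed

section \<open>The main construction\<close>

lemma cong_specialized:
  assumes "over S" "cong_in S (pix l) x x'" "x \<in> S" "x' \<in> S"
  shows "cong_in S (pix l) (emb_base k * x) (emb_base [:poly k l:] * x')"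
  using assms by (intro cong_in_mult base_spec_cong) auto

lemma emb_yz_pcompose: "emb_yz (pcompose N [:0, [:h:]:]) = ev2 emb_base N var_y (emb_base h * var_z)"
proof -
  have "emb_yz (evp (\<lambda>x. [:x:]) N [:0, [:h:]:]) = evp (\<lambda>x. emb_yz [:x:]) N (emb_yz [:0, [:h:]:])"
    by (rule evp_comp[OF ring_hom_const ring_hom_emb_yz])
  also have "emb_yz [:0, [:h:]:] = emb_base h * var_z"
    by (simp add: emb_yz_def emb_base_def var_z_def)
  also have "evp (\<lambda>x. emb_yz [:x:]) N (emb_base h * var_z) = evp (\<lambda>c. evp emb_base c var_y) N (emb_base h * var_z)"
    unfolding evp_emb_base by (simp add: emb_yz_def emb_y_def)
  finally show ?thesis unfolding ev2_def pcompose_altdef evp_def[of "\<lambda>x. [:x:]" N, symmetric] .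
qed

text \<open>Write \<open>1\<close> as a combination of \<open>a\<close> and \<open>b\<close>.\<close>

lemma coprime_multiples:
  assumes "over S" "emb_base a * x \<in> S" "emb_base b * x \<in> S" "\<And>l. poly a l = 0 \<Longrightarrow> poly b l \<noteq> 0"
  shows "x \<in> S"
proof -
  obtain U V where UV: "a * U + b * V = 1" using complex_bezout[of a b] assms(4) by metis
  have "x = emb_base (a * U + b * V) * x" by (simp add: UV emb_base_simps)
  also have "\<dots> = emb_base U * (emb_base a * x) + emb_base V * (emb_base b * x)"
    by (simp add: emb_base_simps algebra_simps)
  also have "\<dots> \<in> S"
  proof -
    have S: "subring S" and b: "emb_base k \<in> S" for k using assms(1) by auto
    show ?thesis by (rule subringD(6)[OF S subringD(4)[OF S b assms(2)] subringD(4)[OF S b assms(3)]])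
  qed
  finally show ?thesis .
qed

lemma degree_0_const: "degree (P :: 'a::zero poly) = 0 \<Longrightarrow> P = [:coeff P 0:]"
  by (auto elim: degree_eq_zeroE)

text \<open>With \<open>Z\<close> the set of \<open>l\<close> with \<open>q(l) = 0\<close> and \<open>ft(l, y) \<noteq> 0\<close>, split \<open>h = h1 hq\<close> and \<open>r = r1 rq\<close>, where
  \<open>hq\<close> and \<open>rq\<close> have their roots in \<open>Z\<close>, and \<open>h1\<close> and \<open>r1\<close> have none there. First \<open>s1 = s/h1\<close> and
  \<open>t1 = t/r1\<close> are adjoined together: \<open>h1\<close> and \<open>r1\<close> are coprime, so it is the same to adjoin the single
  element \<open>s1 + t1 = (r1 s + h1 t)/(h1 r1)\<close>, to which \<open>gen_dilation\<close> applies after shears that are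
  trivial on \<open>Z\<close>. The coordinates found in \<open>congruent_coordinates\<close> then allow to adjoin \<open>z\<close> and \<open>u\<close>,
  one after the other.\<close>

theorem residual_no_common_root:
  fixes q h r a0 a1 :: "complex poly" and ft eta g0 :: "complex poly poly" and kap :: "complex poly poly poly"
  assumes nz: "q \<noteq> 0" "h \<noteq> 0" "r \<noteq> 0" "ft \<noteq> 0"
    and ka: "coeff kap 0 = 0" "coeff kap 1 = 0"
    and eta: "ft dvd eta ^ k"
    and res: "residual_x_variable p"
    and p: "p = emb_base q * (emb_base r * emb_y ft * var_u + emb_base h * var_z
       + emb_y eta * ev2 emb_base kap var_y (emb_base h * var_z) + emb_y g0 * var_y ^ 2)
       + emb_base a0 + emb_base a1 * var_y"
    and C1: "\<And>l. poly h l = 0 \<Longrightarrow> specialize_xy l ft \<noteq> 0"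
    and C2: "\<And>l. poly h l = 0 \<Longrightarrow> poly q l \<noteq> 0 \<Longrightarrow> degree (specialize_xy l ft) = 0"
    and C3: "\<And>l. poly r l = 0 \<Longrightarrow> poly q l \<noteq> 0 \<Longrightarrow> degree (specialize_xy l ft) = 0"
    and C4: "\<And>l. poly q l \<noteq> 0 \<Longrightarrow> poly h l = 0 \<Longrightarrow> poly r l \<noteq> 0"
  shows "is_variable p"
proof -
  define s where "s = emb_base h * var_z"
  define t where "t = emb_base r * var_u"
  define W where "W = emb_y ft * t + s + emb_y eta * ev2 emb_base kap var_y s + emb_y g0 * var_y ^ 2"
  have pW: "p = emb_base q * W + emb_base a0 + emb_base a1 * var_y"
    by (simp add: p W_def s_def t_def algebra_simps)
  have a1q: "poly a1 l \<noteq> 0" if "poly q l = 0" for l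
  proof -
    have "specialize_x l p = evp emb_base [:poly a0 l, poly a1 l:] var_y"
      unfolding pW ring_homD[OF ring_hom_specialize_x] specialize_atoms that
      by (simp add: emb_base_simps evp_pCons ring_hom_emb_base mult.commute ring_homD[OF ring_hom_emb_base])
    then have "degree [:poly a0 l, poly a1 l:] = 1"
      using res variable_univariate[of _ var_y] by (metis insertI1 residual_x_variable_def)
    then show ?thesis by (auto split: if_splits)
  qed
  obtain m n where mn: "q * m + a1 * n = 1" using complex_bezout[of q a1] a1q by metis
  have bz: "emb_base q * emb_base m + emb_base a1 * emb_base n = 1"
    using mn by (metis emb_base_simps(1,3,7))
  have nq: "poly n l \<noteq> 0" if "poly q l = 0" for l
  proof
    assume "poly n l = 0"
    then have "poly (q * m + a1 * n) l = 0" using that by simp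
    then show False by (simp add: mn)
  qed
  define y2 where "y2 = emb_base m * var_y - emb_base n * W"
  have yE: "var_y = emb_base q * y2 + emb_base n * (p - emb_base a0)"
  proof -
    have "emb_base q * y2 + emb_base n * (p - emb_base a0) = (emb_base q * emb_base m + emb_base a1 * emb_base n) * var_y"
      by (simp add: y2_def pW algebra_simps)
    then show ?thesis by (simp add: bz)
  qed
  have WE: "W = emb_base m * (p - emb_base a0) - emb_base a1 * y2"
  proof -
    have "emb_base m * (p - emb_base a0) - emb_base a1 * y2 = (emb_base q * emb_base m + emb_base a1 * emb_base n) * W"
      by (simp add: y2_def pW algebra_simps)
    then show ?thesis by (simp add: bz)
  qed
  \<comment> \<open>The dilation along \<open>ft\<close>: \<open>A[y, s, t] = A[y, W, V] = A[p, y2, V]\<close>.\<close>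
  let ?B0 = "gen {var_y, W}"
  have in0: "var_y \<in> ?B0" "W \<in> ?B0" by (auto intro: gen_incl)
  define b where "b = W - emb_y g0 * var_y ^ 2"
  have emy: "emb_y P \<in> gen X" if "var_y \<in> gen X" for P X unfolding evp_emb_base[symmetric] using that by (rule gen_evp)
  have eq0: "emb_y ft * t = b - s + emb_y eta * poly (kap_at kap var_y) s"
    by (simp add: b_def W_def poly_kap_at)
  have "ft dvd eta ^ Suc k" using eta by simp
  then obtain th where th: "eta ^ Suc k = ft * th" by (rule dvdE)
  have nilp: "emb_y eta ^ Suc k = emb_y ft * emb_y th"
    using th by (metis ring_homD(3,7)[OF ring_hom_emb_y])
  define S where "S = hensel_iter (-1) b (emb_y eta) (kap_at kap var_y) (Suc k)"
  have B0s: "subring ?B0" by simp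
  have bB: "b \<in> ?B0" unfolding b_def by (intro gen_ops in0 emy)
  note mem0 = emy[OF in0(1), of ft] emy[OF in0(1), of eta] bB emy[OF in0(1), of th] coeffs_in_kap_at[OF in0(1), of kap]
  have m1: "-1 \<in> ?B0" by (intro gen_ops)
  have SB: "S \<in> ?B0" unfolding S_def by (rule hensel_iter_in[OF B0s m1 bB mem0(2) mem0(5)])
  obtain c0 where c0: "c0 \<in> ?B0" "b - S + emb_y eta * poly (kap_at kap var_y) S = emb_y ft * c0"
    unfolding S_def by (rule hensel_root[OF B0s mem0 nilp])
  have ft0: "emb_y ft \<noteq> 0" using nz(4) by (simp add: emb_y_def)
  obtain V j where Vj: "s = S + emb_y ft * V" "rhull (insert V ?B0) = rhull (insert s (insert t ?B0))"
    "j \<in> rhull (insert V ?B0)" "t = c0 + V * (emb_y eta * j - 1)"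
    by (rule hensel_coordinates[OF B0s mem0 SB c0(1) nilp ft0 c0(2) eq0])
  have gB: "?B0 = gen {p, y2}"
  proof (rule gen_eqI)
    have i: "p \<in> gen {p, y2}" "y2 \<in> gen {p, y2}" by (auto intro: gen_incl)
    have "var_y \<in> gen {p, y2}" by (subst yE) (intro gen_ops i)
    moreover have "W \<in> gen {p, y2}" by (subst WE) (intro gen_ops i)
    ultimately show "{var_y, W} \<subseteq> gen {p, y2}" by simp
    have "p \<in> ?B0" unfolding pW by (intro gen_ops in0)
    moreover have "y2 \<in> ?B0" unfolding y2_def by (intro gen_ops in0)
    ultimately show "{p, y2} \<subseteq> ?B0" by simp
  qed
  have gE0: "gen {V, p, y2} = gen {s, t, p, y2}"
    using Vj(2) unfolding gB rhull_insert_gen rhull_insert2_gen .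
  define Z where "Z = {l. poly q l = 0 \<and> specialize_xy l ft \<noteq> 0}"
  have Zf: "finite Z" using poly_roots_finite[OF nz(1)] by (rule rev_finite_subset) (auto simp: Z_def)
  define Q where "Q = lin_prod Z"
  have rootQ: "poly Q l = 0 \<longleftrightarrow> l \<in> Z" for l using Zf by (simp add: Q_def poly_lin_prod)
  obtain h1 hq where hh: "h = h1 * hq" "\<And>l. poly hq l = 0 \<Longrightarrow> l \<in> Z" "\<And>l. l \<in> Z \<Longrightarrow> poly h1 l \<noteq> 0"
    using separate_roots[OF nz(2), of Z] by blast
  obtain r1 rq where rr: "r = r1 * rq" "\<And>l. poly rq l = 0 \<Longrightarrow> l \<in> Z" "\<And>l. l \<in> Z \<Longrightarrow> poly r1 l \<noteq> 0"
    using separate_roots[OF nz(3), of Z] by blast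
  have nz1: "h1 \<noteq> 0" "hq \<noteq> 0" "r1 \<noteq> 0" "rq \<noteq> 0" using nz hh(1) rr(1) by auto
  define D1 where "D1 = h1 * r1"
  have D10: "D1 \<noteq> 0" using nz1 by (simp add: D1_def)
  have D1Z: "poly D1 l \<noteq> 0" if "l \<in> Z" for l using hh(3) rr(3) that by (simp add: D1_def)
  define s1 where "s1 = emb_base hq * var_z"
  define t1 where "t1 = emb_base rq * var_u"
  have s1: "s = emb_base h1 * s1" and t1: "t = emb_base r1 * t1"
    by (simp_all add: s_def t_def s1_def t1_def hh(1) rr(1) emb_base_simps mult_ac)
  have roots_h1: "poly q l \<noteq> 0 \<and> degree (specialize_xy l ft) = 0 \<and> specialize_xy l ft \<noteq> 0 \<and> poly r1 l \<noteq> 0" if l: "poly h1 l = 0" for l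
  proof -
    have hl: "poly h l = 0" using l hh(1) by simp
    have "poly q l \<noteq> 0" using C1[OF hl] hh(3)[of l] l by (auto simp: Z_def)
    then show ?thesis using C1[OF hl] C2[OF hl] C4[OF _ hl] rr(1) by auto
  qed
  define sp where "sp = (\<lambda>l. poly r1 l = 0 \<and> specialize_xy l ft \<noteq> 0)"
  have roots_sp: "poly q l \<noteq> 0 \<and> degree (specialize_xy l ft) = 0 \<and> poly h l \<noteq> 0 \<and> poly r l = 0" if l: "sp l" for l
  proof -
    have rl: "poly r l = 0" using l rr(1) by (simp add: sp_def)
    have ql: "poly q l \<noteq> 0" using l rr(3)[of l] by (auto simp: Z_def sp_def)
    then show ?thesis using C3[OF rl ql] C4[OF ql] rl by blast
  qed
  define cl where "cl = (\<lambda>l. coeff (specialize_xy l ft) 0)"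
  have cl: "specialize_xy l ft = [:cl l:]" if "degree (specialize_xy l ft) = 0" for l
    using degree_0_const[OF that] by (simp add: cl_def)
  \<comment> \<open>\<open>p\<close> without its term in \<open>u\<close>, as a polynomial in \<open>y\<close> and \<open>s\<close>\<close>
  define N where "N = [:[:a0, a1:] + [:q:] * g0 * [:0, 0, 1:], [:q:]:] + [:[:q:] * eta:] * kap"
  define N0 where "N0 = coeff N 0"
  have N1: "coeff N 1 = [:q:]" using ka(2) by (simp add: N_def)
  have evN: "ev2 emb_base N var_y x = emb_base a0 + emb_base a1 * var_y + emb_base q * emb_y g0 * var_y ^ 2
      + emb_base q * x + emb_base q * emb_y eta * ev2 emb_base kap var_y x" for x
  proof -
    note h2 = ring_hom_ev2[OF ring_hom_emb_base, of var_y x]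
    have c: "ev2 emb_base [:P:] var_y x = emb_y P" "ev2 emb_base (pCons P L) var_y x = emb_y P + x * ev2 emb_base L var_y x" for P L
      by (simp_all only: ev2_def evp_emb_base evp_pCons[OF ring_hom_emb_y] evp_const[OF ring_hom_emb_y] evp_0 mult_zero_right add_0_right)
    have e: "emb_y [:k:] = emb_base k" "emb_y (pCons k P) = emb_base k + var_y * emb_y P" for k P
      by (simp_all only: evp_emb_base[symmetric] evp_pCons[OF ring_hom_emb_base] evp_0 mult_zero_right add_0_right)
    have e0: "emb_y 0 = 0" by (simp add: emb_y_def)
    show ?thesis
      unfolding N_def ring_homD(2,3)[OF h2] c ring_homD(2,3)[OF ring_hom_emb_y] e e0
      by (simp add: ring_homD(4)[OF h2] emb_base_simps power2_eq_square algebra_simps)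
  qed
  have pN: "p = emb_base (q * r) * emb_y ft * var_u + emb_yz (pcompose N [:0, [:h:]:])"
    unfolding emb_yz_pcompose evN p by (simp add: emb_base_simps algebra_simps)
  have ptN: "p = emb_base q * (emb_y ft * t) + ev2 emb_base N var_y s"
    unfolding evN p s_def t_def by (simp add: emb_base_simps algebra_simps)
  have "\<forall>l. \<exists>R. sp l \<longrightarrow> (\<forall>S a b. over S \<longrightarrow> a \<in> S \<longrightarrow> b \<in> S \<longrightarrow> cong_in S (pix l) (ev2 emb_base N a b)
    (emb_base [:poly q l:] * b + evp (\<lambda>k. emb_base [:k:]) (specialize_xy l N0) (a - evp (\<lambda>k. emb_base [:k:]) R b)))"
  proof
    fix l
    show "\<exists>R. sp l \<longrightarrow> (\<forall>S a b. over S \<longrightarrow> a \<in> S \<longrightarrow> b \<in> S \<longrightarrow> cong_in S (pix l) (ev2 emb_base N a b)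
      (emb_base [:poly q l:] * b + evp (\<lambda>k. emb_base [:k:]) (specialize_xy l N0) (a - evp (\<lambda>k. emb_base [:k:]) R b)))"
    proof (cases "sp l")
      case True
      note rs = roots_sp[OF True]
      have "poly (q * r) l = 0" using rs by simp
      then obtain R where "\<And>S a b. over S \<Longrightarrow> a \<in> S \<Longrightarrow> b \<in> S \<Longrightarrow> cong_in S (pix l) (ev2 emb_base N a b)
        (emb_base [:poly q l:] * b + evp (\<lambda>k. emb_base [:k:]) (specialize_xy l (coeff N 0)) (a - evp (\<lambda>k. emb_base [:k:]) R b))"
        using fibre_shape[OF res pN _ N1, of l] rs by metis
      then show ?thesis unfolding N0_def by blast
    qed simp
  qed
  then obtain Rf where Rf: "\<And>l S a b. sp l \<Longrightarrow> over S \<Longrightarrow> a \<in> S \<Longrightarrow> b \<in> S \<Longrightarrow> cong_in S (pix l) (ev2 emb_base N a b)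
    (emb_base [:poly q l:] * b + evp (\<lambda>k. emb_base [:k:]) (specialize_xy l N0) (a - evp (\<lambda>k. emb_base [:k:]) (Rf l) b))"
    by metis
  \<comment> \<open>The shear by \<open>tau\<close> turns \<open>s\<close> into a multiple of \<open>Vh\<close>, the shear by \<open>rho\<close> undoes \<open>R\<close>. Among the special fibres both are nontrivial on those in \<open>sp\<close> only.\<close>
  let ?L = "\<lambda>k::complex. emb_base [:k:]"
  define ZZ where "ZZ = Z \<union> {l. poly D1 l = 0}"
  have ZZf: "finite ZZ" using Zf poly_roots_finite[OF D10] by (simp add: ZZ_def)
  have SB': "S \<in> gen {p, y2}" using SB unfolding gB .
  obtain tau where tau: "tau \<in> gen {p, y2}"
    "\<And>l. l \<in> ZZ \<Longrightarrow> cong_in (gen {p, y2}) (pix l) tau (if sp l then ?L (1 / cl l) * S else 0)"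
    by (rule chinese_remainder[of "gen {p, y2}" ZZ "\<lambda>l. if sp l then ?L (1 / cl l) * S else 0"])
      (auto simp: ZZf intro: gen_ops SB')
  define Vh where "Vh = V + tau"
  define R2 where "R2 = (\<lambda>l. smult (1 / poly q l) (pcompose (Rf l) [:0, cl l:]))"
  have VhV: "Vh \<in> gen {Vh}" by (auto intro: gen_incl)
  have liftV: "evp ?L P Vh \<in> gen {Vh}" for P by (intro evp_lift_over) (auto intro: gen_incl)
  obtain rho where rho: "rho \<in> gen {Vh}"
    "\<And>l. l \<in> ZZ \<Longrightarrow> cong_in (gen {Vh}) (pix l) rho (if sp l then evp ?L (R2 l) Vh else 0)"
    by (rule chinese_remainder[of "gen {Vh}" ZZ "\<lambda>l. if sp l then evp ?L (R2 l) Vh else 0"])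
      (auto simp: ZZf intro: gen_ops liftV)
  define yh where "yh = y2 - rho"
  define E0 where "E0 = gen {Vh, p, yh}"
  have E0: "over E0" and E0s: "subring E0" by (simp_all add: E0_def)
  note E0ops = gen_ops[where X = "{Vh, p, yh}", folded E0_def] gen_evp[where X = "{Vh, p, yh}", folded E0_def]
  have atoms0: "Vh \<in> E0" "p \<in> E0" "yh \<in> E0" by (auto simp: E0_def intro: gen_incl)
  have VhE: "gen {Vh} \<subseteq> E0" unfolding E0_def by (rule gen_mono) auto
  have rhoE: "rho \<in> E0" using rho VhE by auto
  have y2E0: "y2 \<in> E0"
  proof -
    have "y2 = yh + rho" by (simp add: yh_def)
    then show ?thesis by (simp only:) (intro E0ops atoms0 rhoE)
  qed
  have py2E0: "gen {p, y2} \<subseteq> E0" using y2E0 atoms0 E0 by (intro gen_over) auto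
  have tauE: "tau \<in> E0" "S \<in> E0" "c0 \<in> E0" using tau SB' c0(1) py2E0 unfolding gB by auto
  have VE: "V \<in> E0"
  proof -
    have "V = Vh - tau" by (simp add: Vh_def)
    then show ?thesis by (simp only:) (intro E0ops atoms0 tauE)
  qed
  have yW0: "var_y \<in> E0" "W \<in> E0" using in0 py2E0 unfolding gB by auto
  have VpE0: "gen {V, p, y2} \<subseteq> E0" using VE y2E0 atoms0 E0 by (intro gen_over) auto
  have stE0: "s \<in> E0" "t \<in> E0" using VpE0 unfolding gE0 by (auto intro: gen_incl)
  have jE0: "j \<in> E0" using Vj(3) VpE0 unfolding gB rhull_insert_gen by auto
  have emE0: "emb_y P \<in> E0" for P unfolding E0_def by (rule emy) (use yW0 in \<open>simp add: E0_def\<close>)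
  have liftE0: "x \<in> E0 \<Longrightarrow> evp ?L P x \<in> E0" for P x using E0 by (intro evp_lift_over)
  define T where "T = emb_base D1 * (s1 + t1)"
  have Tst: "T = emb_base r1 * s + emb_base h1 * t"
    by (simp add: T_def s1 t1 D1_def emb_base_simps algebra_simps)
  have TE0: "T \<in> E0" unfolding Tst by (intro E0ops stE0)
  have cft: "cong_in E0 (pix l) (emb_y P) (evp ?L (specialize_xy l P) var_y)" for P l
    unfolding evp_emb_base[symmetric] by (rule evp_spec_cong[OF E0 yW0(1)])
  have loc: "\<exists>b\<in>gen {p, yh}. \<exists>c. c \<noteq> 0 \<and> cong_in E0 (pix l) T (b + ?L c * Vh)"
    if l: "poly D1 l = 0" for l
  proof -
    let ?C = "cong_in E0 (pix l)"
    note ref = cong_in_refl[OF E0s] and tr = cong_in_trans[OF E0s] and sy = cong_in_sym[OF E0s]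
    have lZZ: "l \<in> ZZ" using l by (simp add: ZZ_def)
    have ctau: "?C tau (if sp l then ?L (1 / cl l) * S else 0)"
      by (rule cong_in_mono[OF tau(2)[OF lZZ] py2E0])
    have crho: "?C rho (if sp l then evp ?L (R2 l) Vh else 0)"
      by (rule cong_in_mono[OF rho(2)[OF lZZ] VhE])
    have cs: "?C s (S + ?L (cl l) * V)" if "degree (specialize_xy l ft) = 0"
    proof -
      have "?C (emb_y ft) (?L (cl l))" using cft[of l ft] unfolding cl[OF that] evp_const[OF ring_hom_lift] .
      then show ?thesis unfolding Vj(1) by (intro cong_in_add cong_in_mult ref E0s emE0 VE)
    qed
    have CT: "?C T (?L (poly r1 l) * x + ?L (poly h1 l) * y)" if "?C s x" "?C t y" "x \<in> E0" "y \<in> E0" for x y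
      unfolding Tst using that stE0 by (intro cong_in_add cong_specialized E0 E0s)
    show ?thesis
    proof (cases "sp l")
      case False
      have cV: "?C V Vh"
      proof -
        have "?C tau 0" using ctau False by simp
        then have "?C (V + 0) (V + tau)" using cong_in_add[OF E0s ref sy] by blast
        then show ?thesis by (simp add: Vh_def)
      qed
      have cy2: "?C y2 yh"
      proof -
        have "?C rho 0" using crho False by simp
        then have "?C (y2 - 0) (y2 - rho)" using cong_in_diff[OF E0s ref sy] by blast
        then show ?thesis by (simp add: yh_def)
      qed
      show ?thesis
      proof (cases "poly h1 l = 0")
        case True
        note rh = roots_h1[OF True]
        have d0: "degree (specialize_xy l ft) = 0" using rh by simp
        have clnz: "cl l \<noteq> 0" using rh cl[OF d0] by auto
        obtain S' where S': "S' \<in> gen {p, yh}" "?C S S'"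
          using gen_transfer[OF E0 cy2 atoms0(2) y2E0 atoms0(3) SB'] by blast
        have S'E: "S' \<in> E0" using S'(1) gen_mono[of "{p, yh}" "{Vh, p, yh}"] by (auto simp: E0_def)
        have "?C (S + ?L (cl l) * V) (S' + ?L (cl l) * Vh)"
          by (intro cong_in_add cong_in_mult S' cV ref E0s E0ops atoms0)
        then have "?C s (S' + ?L (cl l) * Vh)" using tr[OF cs[OF d0]] by blast
        then have "?C T (?L (poly r1 l) * (S' + ?L (cl l) * Vh) + ?L (poly h1 l) * t)"
          by (intro CT ref E0ops atoms0 S'E stE0)
        also have "?L (poly r1 l) * (S' + ?L (cl l) * Vh) + ?L (poly h1 l) * t = ?L (poly r1 l) * S' + ?L (poly r1 l * cl l) * Vh"
          using True by (simp add: algebra_simps emb_base_simps flip: emb_const_mult)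
        finally have "?C T (?L (poly r1 l) * S' + ?L (poly r1 l * cl l) * Vh)" .
        moreover have "poly r1 l * cl l \<noteq> 0" using rh clnz by simp
        moreover have "?L (poly r1 l) * S' \<in> gen {p, yh}" by (intro gen_ops S'(1))
        ultimately show ?thesis by blast
      next
        case h1l: False
        then have r1l: "poly r1 l = 0" using l by (simp add: D1_def)
        then have ftl: "specialize_xy l ft = 0" using False by (simp add: sp_def)
        have "[:[:-l, 1:]:] dvd eta ^ k" using specialize_xy_0_dvd[OF ftl] eta by (rule dvd_trans)
        moreover have "prime_elem [:[:-l, 1:]:]"
          by (simp add: prime_elem_const_poly_iff prime_elem_linear_field_poly)
        ultimately have "[:[:-l, 1:]:] dvd eta" using prime_elem_dvd_power by blast
        then obtain e' where "eta = [:[:-l, 1:]:] * e'" by (rule dvdE)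
        then have eta': "emb_y eta = pix l * emb_y e'"
          by (simp only: ring_homD(3)[OF ring_hom_emb_y]) (simp add: emb_y_def emb_base_def)
        have ct: "?C t (c0 - V)"
          unfolding cong_in_def
        proof (intro bexI)
          show "t - (c0 - V) = pix l * (V * emb_y e' * j)" unfolding Vj(4) eta' by (simp add: algebra_simps)
          show "V * emb_y e' * j \<in> E0" by (intro E0ops VE emE0 jE0)
        qed
        obtain c' where c': "c' \<in> gen {p, yh}" "?C c0 c'"
          using gen_transfer[OF E0 cy2 atoms0(2) y2E0 atoms0(3), of c0] c0(1) unfolding gB by blast
        have c'E: "c' \<in> E0" using c'(1) gen_mono[of "{p, yh}" "{Vh, p, yh}"] by (auto simp: E0_def)
        have "?C (c0 - V) (c' - Vh)" by (intro cong_in_diff c' cV E0s)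
        then have "?C t (c' - Vh)" using tr[OF ct] by blast
        then have "?C T (?L (poly r1 l) * s + ?L (poly h1 l) * (c' - Vh))"
          by (intro CT ref E0ops atoms0 c'E stE0)
        also have "?L (poly r1 l) * s + ?L (poly h1 l) * (c' - Vh) = ?L (poly h1 l) * c' + ?L (- poly h1 l) * Vh"
          using r1l by (simp add: algebra_simps emb_base_simps ring_homD(5)[OF ring_hom_lift])
        finally have "?C T (?L (poly h1 l) * c' + ?L (- poly h1 l) * Vh)" .
        moreover have "- poly h1 l \<noteq> 0" using h1l by simp
        moreover have "?L (poly h1 l) * c' \<in> gen {p, yh}" by (intro gen_ops c'(1))
        ultimately show ?thesis by blast
      qed
    next
      case True
      note rs = roots_sp[OF True]
      have d0: "degree (specialize_xy l ft) = 0" using rs by simp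
      have clnz: "cl l \<noteq> 0" using True cl[OF d0] by (auto simp: sp_def)
      have r1l: "poly r1 l = 0" using True by (simp add: sp_def)
      have h1l: "poly h1 l \<noteq> 0" using rs hh(1) by auto
      let ?q = "poly q l" and ?c = "cl l"
      have cVh: "?C (?L ?c * Vh) s"
      proof -
        have "?C (?L ?c * (V + tau)) (?L ?c * (V + ?L (1 / ?c) * S))"
          using ctau True by (intro cong_in_mult cong_in_add ref E0s E0ops VE tauE) simp_all
        also have "?L ?c * (V + ?L (1 / ?c) * S) = S + ?L ?c * V"
          using emb_const_inverse[of "1 / ?c" S] clnz by (simp add: algebra_simps)
        finally show ?thesis unfolding Vh_def using tr sy[OF cs[OF d0]] by blast
      qed
      define x where "x = ?L ?q * yh + emb_base n * (p - emb_base a0)"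
      have xB: "x \<in> gen {p, yh}" unfolding x_def by (intro gen_ops) (auto intro: gen_incl)
      have xE: "x \<in> E0" unfolding x_def by (intro E0ops atoms0)
      have cx: "?C (var_y - evp ?L (Rf l) s) x"
      proof -
        have 1: "?C (evp ?L (Rf l) (?L ?c * Vh)) (evp ?L (Rf l) s)"
          unfolding evp_def
          by (intro cong_in_poly cVh E0s stE0 E0ops atoms0)
            (auto simp: coeffs_in_def coeff_map_poly emb_base_simps E0_def intro: gen_ops cong_in_refl)
        have "evp ?L (Rf l) (?L ?c * Vh) = ?L ?q * evp ?L (R2 l) Vh"
        proof -
          have "evp ?L (pcompose (Rf l) [:0, ?c:]) Vh = evp ?L (Rf l) (?L ?c * Vh)"
          proof -
            note h = ring_hom_evp[OF ring_hom_lift, of Vh]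
            have "evp ?L (evp (\<lambda>x. [:x:]) (Rf l) [:0, ?c:]) Vh = evp (\<lambda>x. evp ?L [:x:] Vh) (Rf l) (evp ?L [:0, ?c:] Vh)"
              by (rule evp_comp[OF ring_hom_const h])
            moreover have "evp ?L [:0, ?c:] Vh = ?L ?c * Vh"
              by (simp add: evp_pCons[OF ring_hom_lift] emb_base_simps mult.commute)
            ultimately show ?thesis by (simp add: evp_const[OF ring_hom_lift] pcompose_altdef evp_def[of "\<lambda>x. [:x:]"])
          qed
          moreover have "pcompose (Rf l) [:0, ?c:] = smult ?q (R2 l)" using rs by (simp add: R2_def)
          ultimately show ?thesis by (simp add: evp_smult[OF ring_hom_lift])
        qed
        with 1 have 2: "?C (?L ?q * evp ?L (R2 l) Vh) (evp ?L (Rf l) s)" by simp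
        have "?C (emb_base q * rho) (?L ?q * evp ?L (R2 l) Vh)"
          using crho True rhoE liftE0[OF atoms0(1)] by (intro cong_specialized E0) simp_all
        then have 3: "?C (emb_base q * rho) (evp ?L (Rf l) s)" using tr 2 by blast
        have "var_y - emb_base q * rho = emb_base q * yh + emb_base n * (p - emb_base a0)"
          by (subst yE) (simp add: yh_def algebra_simps)
        moreover have "?C (emb_base q * yh + emb_base n * (p - emb_base a0)) x"
          unfolding x_def by (intro cong_in_add cong_specialized ref E0 E0s atoms0)
        ultimately have "?C (var_y - emb_base q * rho) x" by simp
        moreover have "?C (var_y - evp ?L (Rf l) s) (var_y - emb_base q * rho)"
          by (intro cong_in_diff ref E0s sy[OF 3])
        ultimately show ?thesis using tr by blast
      qed
      let ?G = "specialize_xy l N0"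
      have "?C (evp ?L ?G (var_y - evp ?L (Rf l) s)) (evp ?L ?G x)"
        unfolding evp_def[of _ ?G]
        by (intro cong_in_poly cx E0s xE E0ops yW0 liftE0 stE0)
          (auto simp: coeffs_in_def coeff_map_poly emb_base_simps E0_def intro: gen_ops cong_in_refl)
      then have "?C (?L ?q * s + evp ?L ?G (var_y - evp ?L (Rf l) s)) (?L ?q * (?L ?c * Vh) + evp ?L ?G x)"
        by (intro cong_in_add cong_in_mult ref E0s sy[OF cVh] E0ops atoms0)
      then have cN: "?C (ev2 emb_base N var_y s) (?L ?q * (?L ?c * Vh) + evp ?L ?G x)"
        using tr[OF Rf[OF True E0 yW0(1) stE0(1)]] by blast
      have "?C (emb_base q * (emb_y ft * t)) (p - (?L ?q * (?L ?c * Vh) + evp ?L ?G x))"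
      proof -
        have "emb_base q * (emb_y ft * t) = p - ev2 emb_base N var_y s" using ptN by (simp add: algebra_simps)
        then show ?thesis using cong_in_diff[OF E0s ref cN] by simp
      qed
      moreover have "?C (emb_base q * (emb_y ft * t)) (?L ?q * (?L ?c * t))"
      proof -
        have "?C (emb_y ft) (?L ?c)" using cft[of l ft] unfolding cl[OF d0] evp_const[OF ring_hom_lift] .
        then have "?C (emb_y ft * t) (?L ?c * t)" by (intro cong_in_mult ref E0s emE0 stE0)
        then show ?thesis by (intro cong_specialized E0 E0ops emE0 stE0)
      qed
      ultimately have ct: "?C (?L ?q * (?L ?c * t)) (p - (?L ?q * (?L ?c * Vh) + evp ?L ?G x))" using tr sy by blast
      have inv: "?L (1 / (?q * ?c)) * (?L ?q * (?L ?c * z)) = z" for z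
      proof -
        have e: "?L ?q * (?L ?c * z) = ?L (?q * ?c) * z" by (simp only: mult.assoc[symmetric] emb_const_mult)
        have "?q * ?c \<noteq> 0" using rs clnz by simp
        then show ?thesis unfolding e by (rule emb_const_inverse)
      qed
      define bb where "bb = ?L (1 / (?q * ?c)) * (p - evp ?L ?G x)"
      have bbB: "bb \<in> gen {p, yh}" unfolding bb_def
        by (intro gen_ops evp_lift_over conjI over_gen xB) (auto intro: gen_incl)
      have bbE: "bb \<in> E0" unfolding bb_def by (intro E0ops atoms0 liftE0 xE)
      have "?C (?L (1 / (?q * ?c)) * (?L ?q * (?L ?c * t))) (?L (1 / (?q * ?c)) * (p - (?L ?q * (?L ?c * Vh) + evp ?L ?G x)))"
        by (intro cong_in_mult ref E0s ct E0ops atoms0 liftE0 xE)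
      also have "?L (1 / (?q * ?c)) * (p - (?L ?q * (?L ?c * Vh) + evp ?L ?G x)) = bb - ?L (1 / (?q * ?c)) * (?L ?q * (?L ?c * Vh))"
        by (simp add: bb_def algebra_simps)
      finally have "?C t (bb - Vh)" unfolding inv .
      then have "?C T (?L (poly r1 l) * s + ?L (poly h1 l) * (bb - Vh))"
        by (intro CT ref E0ops atoms0 bbE stE0)
      also have "?L (poly r1 l) * s + ?L (poly h1 l) * (bb - Vh) = ?L (poly h1 l) * bb + ?L (- poly h1 l) * Vh"
        using r1l by (simp add: algebra_simps emb_base_simps ring_homD(5)[OF ring_hom_lift])
      finally have "?C T (?L (poly h1 l) * bb + ?L (- poly h1 l) * Vh)" .
      moreover have "- poly h1 l \<noteq> 0" using h1l by simp
      moreover have "?L (poly h1 l) * bb \<in> gen {p, yh}" by (intro gen_ops bbB)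
      ultimately show ?thesis by blast
    qed
  qed
  obtain S1 w where Sw: "S1 \<in> gen {p, yh}" "Vh = emb_base Q * S1 + emb_base D1 * w"
    "gen {w, p, yh} = gen {Vh, s1 + t1, p, yh}"
  proof (rule gen_dilation[of D1 "s1 + t1" Vh "{p, yh}" Q])
    show "D1 \<noteq> 0" by (rule D10)
    show "emb_base D1 * (s1 + t1) \<in> gen {Vh, p, yh}" using TE0 by (simp add: T_def E0_def)
    show "\<And>l. poly D1 l = 0 \<Longrightarrow> \<exists>b\<in>gen {p, yh}. \<exists>c. c \<noteq> 0 \<and> cong_in (gen {Vh, p, yh}) (pix l) (emb_base D1 * (s1 + t1)) (b + ?L c * Vh)"
      using loc by (simp add: T_def E0_def)
    show "\<And>l. poly D1 l = 0 \<Longrightarrow> poly Q l \<noteq> 0" using D1Z rootQ by blast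
  qed
  define E1 where "E1 = gen {w, p, yh}"
  have E1: "over E1" and E1s: "subring E1" by (simp_all add: E1_def)
  note E1ops = gen_ops[where X = "{w, p, yh}", folded E1_def]
  have E01: "E0 \<subseteq> E1" unfolding E0_def E1_def Sw(3) by (rule gen_mono) auto
  have sumE1: "s1 + t1 \<in> E1" unfolding E1_def Sw(3) by (auto intro: gen_incl)
  have s1E: "s1 \<in> E1"
  proof (rule coprime_multiples[OF E1, of h1 s1 r1])
    show "emb_base h1 * s1 \<in> E1" using stE0 E01 s1 by auto
    have "emb_base r1 * s1 = emb_base r1 * (s1 + t1) - t" by (simp add: t1 algebra_simps)
    also have "\<dots> \<in> E1" using stE0 E01 by (intro E1ops sumE1) auto
    finally show "emb_base r1 * s1 \<in> E1" .
  qed (use roots_h1 in auto)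
  have t1E: "t1 \<in> E1"
  proof -
    have "(s1 + t1) - s1 \<in> E1" by (rule E1ops(5)[OF sumE1 s1E])
    then show ?thesis by simp
  qed
  have E1at: "w \<in> E1" "p \<in> E1" "yh \<in> E1" by (auto simp: E1_def intro: gen_incl)
  have fin: "is_variable p"
    if g: "gen {s', t', p} = E1" and cs: "cong_in E1 (emb_base Q) s s'" and ct: "cong_in E1 (emb_base Q) t (emb_base e * t')"
      and e: "\<And>l. l \<in> Z \<Longrightarrow> poly e l \<noteq> 0" for s' t' e
  proof -
    have in1: "s' \<in> E1" "t' \<in> E1" unfolding g[symmetric] by (auto intro: gen_incl)
    have gs: "gen {s', p, t'} = E1" using g by (simp add: insert_commute)
    obtain w1 where w1: "gen {w1, p, t'} = gen {s', emb_base h1 * var_z, p, t'}"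
    proof (rule gen_dilation[of hq "emb_base h1 * var_z" s' "{p, t'}" 1])
      have hs: "emb_base hq * (emb_base h1 * var_z) = s" by (simp add: s1 s1_def mult_ac)
      show "emb_base hq * (emb_base h1 * var_z) \<in> gen {s', p, t'}" unfolding hs gs using stE0 E01 by auto
      fix l assume "poly hq l = 0"
      then have "cong_in E1 (pix l) s s'" using hh(2) cs lin_prod_cong_in[OF E1 Zf] unfolding Q_def by blast
      then have "cong_in E1 (pix l) s (0 + ?L 1 * s')" by simp
      then show "\<exists>b\<in>gen {p, t'}. \<exists>c. c \<noteq> 0 \<and> cong_in (gen {s', p, t'}) (pix l) (emb_base hq * (emb_base h1 * var_z)) (b + ?L c * s')"
        unfolding hs gs by (intro bexI[of _ 0] exI[of _ 1]) (auto intro: gen_ops)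
    qed (use nz1 in auto)
    define E2 where "E2 = gen {w1, p, t'}"
    have E2: "over E2" by (simp add: E2_def)
    have E12: "E1 \<subseteq> E2" unfolding gs[symmetric] E2_def w1 by (rule gen_mono) auto
    have zE2: "var_z \<in> E2"
    proof (rule coprime_multiples[OF E2, of hq var_z h1])
      show "emb_base hq * var_z \<in> E2" using s1E E12 by (auto simp: s1_def)
      show "emb_base h1 * var_z \<in> E2" unfolding E2_def w1 by (auto intro: gen_incl)
    qed (use hh in auto)
    have gt: "gen {t', p, w1} = E2" by (simp add: E2_def insert_commute)
    obtain w2 where w2: "gen {w2, p, w1} = gen {t', emb_base r1 * var_u, p, w1}"
    proof (rule gen_dilation[of rq "emb_base r1 * var_u" t' "{p, w1}" 1])
      have rt: "emb_base rq * (emb_base r1 * var_u) = t" by (simp add: t1 t1_def mult_ac)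
      show "emb_base rq * (emb_base r1 * var_u) \<in> gen {t', p, w1}" unfolding rt gt using stE0 E01 E12 by auto
      fix l assume l: "poly rq l = 0"
      then have lZ: "l \<in> Z" by (rule rr(2))
      have "cong_in E1 (pix l) t (emb_base e * t')" using lZ ct lin_prod_cong_in[OF E1 Zf] unfolding Q_def by blast
      moreover have "cong_in E1 (pix l) (emb_base e * t') (?L (poly e l) * t')"
        by (intro cong_specialized E1 cong_in_refl[OF E1s] in1)
      ultimately have "cong_in E2 (pix l) t (0 + ?L (poly e l) * t')"
        using cong_in_trans[OF E1s] cong_in_mono[OF _ E12] by (metis add_0)
      then show "\<exists>b\<in>gen {p, w1}. \<exists>c. c \<noteq> 0 \<and> cong_in (gen {t', p, w1}) (pix l) (emb_base rq * (emb_base r1 * var_u)) (b + ?L c * t')"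
        unfolding rt gt using e[OF lZ] by (intro bexI[of _ 0] exI[of _ "poly e l"]) (auto intro: gen_ops)
    qed (use nz1 in auto)
    have E23: "E2 \<subseteq> gen {w2, p, w1}" unfolding gt[symmetric] w2 by (rule gen_mono) auto
    have "var_u \<in> gen {w2, p, w1}"
    proof (rule coprime_multiples[of _ rq var_u r1])
      show "emb_base rq * var_u \<in> gen {w2, p, w1}" using t1E E12 E23 by (auto simp: t1_def)
      show "emb_base r1 * var_u \<in> gen {w2, p, w1}" unfolding w2 by (auto intro: gen_incl)
    qed (use rr in auto)
    then have "gen {w2, p, w1} = UNIV" using zE2 yW0(1) E01 E12 E23 by (intro gen_top) auto
    then have "gen {p, w2, w1} = UNIV" by (simp add: insert_commute)
    then show ?thesis by (rule variable_if_generating)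
  qed
  show ?thesis
  proof (cases "Z = {}")
    case True
    have "poly hq l \<noteq> 0" "poly rq l \<noteq> 0" for l using hh(2) rr(2) True by auto
    then have "var_z \<in> E1" "var_u \<in> E1"
      using coprime_multiples[OF E1, of hq var_z hq] coprime_multiples[OF E1, of rq var_u rq] s1E t1E
      by (auto simp: s1_def t1_def)
    then have "gen {w, p, yh} = UNIV" using yW0(1) E01 unfolding E1_def by (intro gen_top) auto
    then have "gen {p, w, yh} = UNIV" by (simp add: insert_commute)
    then show ?thesis by (rule variable_if_generating)
  next
    case False
    have nosp: "\<not> sp l" if "l \<in> Z" for l using roots_sp[of l] that by (auto simp: Z_def)
    have ctau: "cong_in E1 (emb_base Q) tau 0"
      unfolding Q_def
    proof (rule cong_in_lin_prod[OF E1 Zf])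
      show "tau \<in> E1" "0 \<in> E1" using tauE E01 by (auto intro: E1ops)
      fix l assume "l \<in> Z"
      then have "cong_in (gen {p, y2}) (pix l) tau 0" using tau(2)[of l] nosp by (simp add: ZZ_def)
      then show "cong_in E1 (pix l) tau 0" using cong_in_mono py2E0 E01 by (metis subset_trans)
    qed
    have crho: "cong_in E1 (emb_base Q) rho 0"
      unfolding Q_def
    proof (rule cong_in_lin_prod[OF E1 Zf])
      show "rho \<in> E1" "0 \<in> E1" using rhoE E01 by (auto intro: E1ops)
      fix l assume "l \<in> Z"
      then have "cong_in (gen {Vh}) (pix l) rho 0" using rho(2)[of l] nosp by (simp add: ZZ_def)
      then show "cong_in E1 (pix l) rho 0" using cong_in_mono VhE E01 by (metis subset_trans)
    qed
    have "Q dvd q" unfolding Q_def by (rule lin_prod_dvd[OF Zf]) (simp add: Z_def)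
    then obtain q' where q': "q = Q * q'" by (rule dvdE)
    have cy: "cong_in E1 (emb_base Q) var_y (emb_base n * (p - emb_base a0))"
      unfolding cong_in_def
    proof (intro bexI)
      show "var_y - emb_base n * (p - emb_base a0) = emb_base Q * (emb_base q' * y2)"
        by (subst yE) (simp add: q' emb_base_simps mult.assoc)
      show "emb_base q' * y2 \<in> E1" using y2E0 E01 by (intro E1ops) auto
    qed
    have cW: "cong_in E1 (emb_base Q) W (emb_base m * (p - emb_base a0) - emb_base a1 * yh)"
    proof -
      have "cong_in E1 (emb_base Q) (y2 - 0) (y2 - rho)"
        by (intro cong_in_diff cong_in_refl cong_in_sym[OF E1s crho] E1s)
      then have "cong_in E1 (emb_base Q) (emb_base m * (p - emb_base a0) - emb_base a1 * y2) (emb_base m * (p - emb_base a0) - emb_base a1 * yh)"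
        unfolding yh_def
        by (intro cong_in_diff cong_in_mult cong_in_refl E1s E1ops E1at(2)) (use y2E0 rhoE E01 in auto)
      then show ?thesis unfolding WE[symmetric] .
    qed
    have cV: "cong_in E1 (emb_base Q) V (emb_base D1 * w)"
    proof -
      have "cong_in E1 (emb_base Q) (V + 0) (V + tau)"
        by (intro cong_in_add cong_in_refl cong_in_sym[OF E1s ctau] E1s)
      moreover have "cong_in E1 (emb_base Q) Vh (emb_base D1 * w)"
        unfolding cong_in_def
      proof (intro bexI)
        show "Vh - emb_base D1 * w = emb_base Q * S1" by (simp add: Sw(2))
        show "S1 \<in> E1" using Sw(1) gen_mono[of "{p, yh}" "{w, p, yh}"] by (auto simp: E1_def)
      qed
      ultimately show ?thesis using cong_in_trans[OF E1s] by (simp add: Vh_def)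
    qed
    obtain s' t' e where "gen {s', t', p} = E1" "cong_in E1 (emb_base Q) s s'" "cong_in E1 (emb_base Q) t (emb_base e * t')"
      "\<And>l. l \<in> Z \<Longrightarrow> poly e l \<noteq> 0"
    proof (rule congruent_coordinates[of Z Q a1 n D1 ft w p yh W V s t hq rq a0 m eta k th g0 kap])
      show "\<And>l. l \<in> Z \<Longrightarrow> poly a1 l \<noteq> 0 \<and> poly n l \<noteq> 0 \<and> poly D1 l \<noteq> 0 \<and> specialize_xy l ft \<noteq> 0"
        using a1q nq D1Z by (auto simp: Z_def)
      show "s = hensel_iter (-1) (W - emb_y g0 * var_y ^ 2) (emb_y eta) (kap_at kap var_y) (Suc k) + emb_y ft * V"
        using Vj(1) by (simp add: S_def b_def)
      show "emb_y ft * t = W - emb_y g0 * var_y ^ 2 - s + emb_y eta * poly (kap_at kap var_y) s"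
        using eq0 by (simp add: b_def)
    qed (use Zf False Q_def yW0 VE stE0 E01 s1E t1E nz1 cy cW cV th in \<open>auto simp: s1_def t1_def E1_def\<close>)
    then show ?thesis by (rule fin)
  qed
qed

section \<open>Removing common roots, and the theorem\<close>

lemma ev2_base_const:
  "ev2 emb_base [:[:k:]:] a b = emb_base k" "ev2 emb_base [:0, [:k:]:] a b = emb_base k * b"
proof -
  have "ev2 emb_base [:[:k:]:] a b = evp emb_base [:k:] a"
    unfolding ev2_def by (rule evp_const[OF ring_hom_evp[OF ring_hom_emb_base]])
  then show 1: "ev2 emb_base [:[:k:]:] a b = emb_base k" by (simp add: evp_const[OF ring_hom_emb_base])
  have "ev2 emb_base [:0, [:k:]:] a b = evp emb_base 0 a + b * ev2 emb_base [:[:k:]:] a b"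
    unfolding ev2_def by (rule evp_pCons[OF ring_hom_evp[OF ring_hom_emb_base]])
  then show "ev2 emb_base [:0, [:k:]:] a b = emb_base k * b" by (simp add: 1)
qed

lemma ev2_pcompose: "ev2 emb_base (pcompose P [:0, [:k:]:]) a b = ev2 emb_base P a (emb_base k * b)"
proof -
  note h = ring_hom_ev2[OF ring_hom_emb_base, of a b]
  have "pcompose P [:0, [:k:]:] = evp (\<lambda>x. [:x:]) P [:0, [:k:]:]" by (simp add: pcompose_altdef evp_def)
  then have "ev2 emb_base (pcompose P [:0, [:k:]:]) a b = evp (\<lambda>x. ev2 emb_base [:x:] a b) P (ev2 emb_base [:0, [:k:]:] a b)"
    using evp_comp[OF ring_hom_const h, of P "[:0, [:k:]:]"] by simp
  also have "\<dots> = evp (\<lambda>c. evp emb_base c a) P (emb_base k * b)"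
    unfolding ev2_base_const by (simp add: ev2_def evp_const[OF ring_hom_evp[OF ring_hom_emb_base]])
  finally show ?thesis by (simp add: ev2_def)
qed

lemma emb_y_const: "emb_y [:k:] = emb_base k"
  by (simp add: emb_y_def emb_base_def)

text \<open>At a common root \<open>l\<close> of \<open>h\<close> and \<open>r\<close> outside \<open>q = 0\<close> the variable \<open>p\<close> restricts to
  \<open>q g0 y\<^sup>2 + a0 + a1 y\<close>, which is linear; so \<open>x - l\<close> divides \<open>g0\<close>. As \<open>\<kappa>(y, X)\<close> is a multiple of \<open>X\<^sup>2\<close>,
  \<open>\<kappa>(y, (x - l) X)\<close> is \<open>x - l\<close> times a polynomial of the same kind, so the whole bracket is divisible. Moving
  this factor into \<open>q\<close> lowers the degree of \<open>r\<close>.\<close>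

theorem residual_nonzero:
  fixes q h r a0 a1 :: "complex poly" and ft eta g0 :: "complex poly poly" and kap :: "complex poly poly poly"
  assumes nz: "q \<noteq> 0" "h \<noteq> 0" "r \<noteq> 0" "ft \<noteq> 0"
    and ka: "coeff kap 0 = 0" "coeff kap 1 = 0"
    and eta: "ft dvd eta ^ k"
    and res: "residual_x_variable p"
    and p: "p = emb_base q * (emb_base r * emb_y ft * var_u + emb_base h * var_z
       + emb_y eta * ev2 emb_base kap var_y (emb_base h * var_z) + emb_y g0 * var_y ^ 2)
       + emb_base a0 + emb_base a1 * var_y"
    and C1: "\<And>l. poly h l = 0 \<Longrightarrow> specialize_xy l ft \<noteq> 0"
    and C2: "\<And>l. poly h l = 0 \<Longrightarrow> poly q l \<noteq> 0 \<Longrightarrow> degree (specialize_xy l ft) = 0"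
    and C3: "\<And>l. poly r l = 0 \<Longrightarrow> poly q l \<noteq> 0 \<Longrightarrow> degree (specialize_xy l ft) = 0"
  shows "is_variable p"
  using assms
proof (induction "degree r" arbitrary: q h r g0 kap rule: less_induct)
  case less
  note nz = less.prems(1-4) and ka = less.prems(5,6) and p = less.prems(9)
    and C1 = less.prems(10) and C2 = less.prems(11) and C3 = less.prems(12)
  show ?case
  proof (cases "\<exists>l. poly q l \<noteq> 0 \<and> poly h l = 0 \<and> poly r l = 0")
    case False
    show ?thesis
      by (rule residual_no_common_root[OF nz ka eta res p C1 C2 C3]) (use False in auto)
  next
    case True
    then obtain l where l: "poly q l \<noteq> 0" "poly h l = 0" "poly r l = 0" by blast
    define G where "G = [:poly a0 l, poly a1 l:] + specialize_xy l g0 * [:0, 0, poly q l:]"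
    have spl: "specialize_x l p = evp emb_base G var_y"
    proof (rule pt3_eqI)
      fix y z u
      have "ev3 (at_x l) (ev2 emb_base kap var_y (emb_base h * var_z)) y z u = 0"
      proof -
        have "ev3 (at_x l) (ev2 emb_base kap var_y (emb_base h * var_z)) y z u = ev2 (at_x l) kap y 0"
          unfolding ev2_comp[OF ring_hom_emb_base ring_hom_at] by (simp add: at_atoms ring_homD[OF ring_hom_at] l)
        also have "\<dots> = evp (at_x l) (coeff kap 0) y"
          by (simp add: ev2_def evp_def[of "\<lambda>c. evp (at_x l) c y"] poly_0_coeff_0 coeff_map_poly)
        finally show ?thesis by (simp add: ka)
      qed
      then show "pt3 (specialize_x l p) y z u = pt3 (evp emb_base G var_y) y z u"
        unfolding pt3_specialize_x p evp_comp[OF ring_hom_emb_base ring_hom_pt3] G_def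
        by (simp add: ring_homD[OF ring_hom_at] at_atoms l pt3_simps evp_id algebra_simps power2_eq_square)
    qed
    then have "is_variable (evp emb_base G var_y)" using res by (metis residual_x_variable_def)
    then have dG: "degree G = 1" by (rule variable_univariate) simp
    have "specialize_xy l g0 = 0"
    proof (rule ccontr)
      assume n: "specialize_xy l g0 \<noteq> 0"
      then have ge: "degree (specialize_xy l g0 * [:0, 0, poly q l:]) \<ge> 2" using l by (subst degree_mult_eq) auto
      have "degree [:poly a0 l, poly a1 l:] \<le> 1" by simp
      then have "degree [:poly a0 l, poly a1 l:] < degree (specialize_xy l g0 * [:0, 0, poly q l:])" using ge by linarith
      then have "degree G = degree (specialize_xy l g0 * [:0, 0, poly q l:])" unfolding G_def by (rule degree_add_eq_right)
      then show False using ge dG by simp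
    qed
    then obtain g0' where g0: "g0 = [:[:-l, 1:]:] * g0'" using specialize_xy_0_dvd by (blast elim: dvdE)
    obtain h' where h: "h = [:-l, 1:] * h'" using l(2) poly_eq_0_iff_dvd by (metis dvdE)
    obtain r' where r: "r = [:-l, 1:] * r'" using l(3) poly_eq_0_iff_dvd by (metis dvdE)
    let ?pi = "[:-l, 1:]"
    have ck: "coeff (pcompose kap [:0, [:?pi:]:]) n = [:?pi:] ^ n * coeff kap n" for n by (rule coeff_pcompose_linear)
    have "[:[:?pi:]:] dvd pcompose kap [:0, [:?pi:]:]"
      unfolding const_poly_dvd_iff[of "[:?pi:]"] ck
    proof
      fix n show "[:?pi:] dvd [:?pi:] ^ n * coeff kap n"
        by (cases n) (simp_all add: ka(1) mult.assoc del: mult_pCons_left mult_pCons_right)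
    qed
    then obtain kap' where kap': "pcompose kap [:0, [:?pi:]:] = [:[:?pi:]:] * kap'" by (rule dvdE)
    have "[:?pi:] * coeff kap' n = [:?pi:] ^ n * coeff kap n" for n
    proof -
      have "coeff ([:[:?pi:]:] * kap') n = [:?pi:] * coeff kap' n"
        using coeff_smult[of "[:?pi:]" kap' n] by simp
      then show ?thesis using ck[of n] unfolding kap' by simp
    qed
    from this[of 0] this[of 1] have ka': "coeff kap' 0 = 0" "coeff kap' 1 = 0"
      unfolding ka by (metis mult_zero_right mult_eq_0_iff pCons_eq_0_iff one_neq_zero)+
    have kz: "ev2 emb_base kap var_y (emb_base h * var_z) = emb_base ?pi * ev2 emb_base kap' var_y (emb_base h' * var_z)"
    proof -
      have "ev2 emb_base kap var_y (emb_base ?pi * (emb_base h' * var_z)) = ev2 emb_base ([:[:?pi:]:] * kap') var_y (emb_base h' * var_z)"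
        unfolding kap'[symmetric] ev2_pcompose ..
      then show ?thesis
        unfolding h by (simp only: emb_base_simps(3) ring_homD(3)[OF ring_hom_ev2[OF ring_hom_emb_base]] ev2_base_const(1) mult.assoc)
    qed
    have p': "p = emb_base (q * ?pi) * (emb_base r' * emb_y ft * var_u + emb_base h' * var_z
       + emb_y eta * ev2 emb_base kap' var_y (emb_base h' * var_z) + emb_y g0' * var_y ^ 2)
       + emb_base a0 + emb_base a1 * var_y"
    proof -
      have "emb_y g0 = emb_base ?pi * emb_y g0'" unfolding g0 ring_homD(3)[OF ring_hom_emb_y] emb_y_const ..
      moreover have "emb_base h = emb_base ?pi * emb_base h'" "emb_base r = emb_base ?pi * emb_base r'"
        "emb_base (q * ?pi) = emb_base q * emb_base ?pi"
        unfolding h r by (rule emb_base_simps(3))+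
      ultimately show ?thesis unfolding p kz by (simp only: algebra_simps)
    qed
    have "?pi \<noteq> 0" by simp
    then have nz': "q * ?pi \<noteq> 0" "h' \<noteq> 0" "r' \<noteq> 0" using nz(1) nz(2)[unfolded h] nz(3)[unfolded r] by (metis mult_eq_0_iff)+
    have "degree r' < degree r" unfolding r using nz'(3) by (subst degree_mult_eq) auto
    then show ?thesis
    proof (rule less.hyps[OF _ nz' nz(4) ka' eta res p'])
      fix k
      { assume "poly h' k = 0"
        then have hk: "poly h k = 0" by (simp add: h)
        show "specialize_xy k ft \<noteq> 0" by (rule C1[OF hk])
        assume "poly (q * ?pi) k \<noteq> 0"
        then show "degree (specialize_xy k ft) = 0" by (intro C2[OF hk]) auto }
      { assume "poly r' k = 0" "poly (q * ?pi) k \<noteq> 0"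
        then show "degree (specialize_xy k ft) = 0" by (intro C3) (auto simp: r) }
    qed
  qed
qed

text \<open>No multiplicity exceeds the number of prime factors counted with multiplicity.\<close>

lemma dvd_red_poly_power:
  assumes "f \<noteq> 0" shows "f dvd red_poly f ^ size (prime_factorization f)"
proof -
  have "normalize (prod_mset (prime_factorization f)) = normalize f"
    using assms by (rule prod_mset_prime_factorization_weak)
  then have "f dvd prod_mset (prime_factorization f)" by (metis associatedD2 dvd_refl)
  also have "\<dots> = (\<Prod>p\<in>prime_factors f. p ^ count (prime_factorization f) p)"
    by (rule prod_mset_multiplicity)
  also have "\<dots> dvd (\<Prod>p\<in>prime_factors f. p ^ size (prime_factorization f))"
    by (intro prod_dvd_prod le_imp_power_dvd count_le_size)
  also have "\<dots> = red_poly f ^ size (prime_factorization f)" by (simp add: red_poly_def prod_power_distrib)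
  finally show ?thesis .
qed

lemma no_root_degree_0: "(\<And>y. poly (P :: complex poly) y \<noteq> 0) \<Longrightarrow> degree P = 0"
  using fundamental_theorem_of_algebra[of P] by (auto simp: constant_degree)

theorem proposition4p16:
  fixes p :: "complex poly poly poly poly"
    and f :: "complex poly poly" and g :: "complex poly poly poly"
    and q r a0 a1 :: "complex poly"
    and ft g0 g1 :: "complex poly poly"
    and g2 :: "complex poly poly poly"
  assumes p_form: "p = emb_y f * var_u + emb_yz g"
    and residual: "residual_x_variable p"
    and p_eq: "p = emb_base q *
          (emb_base r * emb_y ft * var_u + emb_y g0 * var_y ^ 2 + emb_y g1 * var_z
            + emb_y (red_poly ft) * emb_yz g2 * var_z ^ 2)
        + emb_base a0 + emb_base a1 * var_y"
    and ft_nonzero: "ft \<noteq> 0"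
    and zeros_finite: "finite (zero_set_xy ft \<inter> zero_set_xy g1)"
    and zeros_over_q: "zero_set_xy ft \<inter> zero_set_xy g1 \<subseteq> {x0. poly q x0 = 0} \<times> UNIV"
    and roots_r: "\<And>x0. poly r x0 = 0 \<Longrightarrow> \<exists>c. smult (poly q x0) (specialize_xy x0 ft) = [:c:]"
    and g1_in_Cx: "\<exists>h. g1 = [:h:]"
    and g2_in: "g2 * [:0, 1:] ^ 2 \<in> subalgebra_y_hz g1"
  shows "x_variable p"
proof -
  obtain h where g1: "g1 = [:h:]" using g1_in_Cx by blast
  obtain kap where kap: "g2 * [:0, 1:] ^ 2 = pcompose kap [:0, [:h:]:]"
    using g2_in unfolding subalgebra_y_hz_def g1 by blast
  have ck: "[:h:] ^ n * coeff kap n = coeff (g2 * [:0, 1:] ^ 2) n" for n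
    unfolding kap by (rule coeff_pcompose_linear[symmetric])
  have low: "coeff (g2 * [:0, 1:] ^ 2) n = 0" if "n < 2" for n
  proof -
    have "g2 * [:0, 1:] ^ 2 = monom 1 2 * g2" by (simp add: monom_altdef mult.commute)
    then show ?thesis using that by (simp only: coeff_monom_mult) simp
  qed
  have emg: "emb_yz g2 * var_z ^ 2 = emb_yz (g2 * [:0, 1:] ^ 2)"
    by (simp add: ring_homD[OF ring_hom_emb_yz]) (simp add: emb_yz_def var_z_def)
  have hz: "emb_yz (g2 * [:0, 1:] ^ 2) = ev2 emb_base kap var_y (emb_base h * var_z)"
    unfolding kap by (rule emb_yz_pcompose)
  have p: "p = emb_base q * (emb_base r * emb_y ft * var_u + emb_base h * var_z
       + emb_y (red_poly ft) * ev2 emb_base kap var_y (emb_base h * var_z) + emb_y g0 * var_y ^ 2)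
       + emb_base a0 + emb_base a1 * var_y"
    unfolding p_eq g1 emb_y_const hz[symmetric] emg[symmetric] by (simp add: mult.assoc add_ac)
  define G where "G = [:a0, a1:] + [:q:] * g0 * [:0, 0, 1:]"
  have emG: "emb_y G = emb_base a0 + emb_base a1 * var_y + emb_base q * emb_y g0 * var_y ^ 2"
  proof -
    have c: "emb_y (pCons k P) = emb_base k + var_y * emb_y P" for k P
      by (simp only: evp_emb_base[symmetric] evp_pCons[OF ring_hom_emb_base])
    have z: "emb_y 0 = 0" by (simp add: emb_y_def)
    show ?thesis unfolding G_def ring_homD(2,3)[OF ring_hom_emb_y] c z
      by (simp add: emb_base_simps power2_eq_square algebra_simps)
  qed
  have zft: "(l, y) \<in> zero_set_xy ft \<longleftrightarrow> poly (specialize_xy l ft) y = 0" for l y by (simp add: zero_set_xy_def)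
  have zg1: "(l, y) \<in> zero_set_xy g1 \<longleftrightarrow> poly h l = 0" for l y
    by (simp add: zero_set_xy_def g1 specialize_xy_simps)
  have C1: "specialize_xy l ft \<noteq> 0" if "poly h l = 0" for l
  proof
    assume "specialize_xy l ft = 0"
    then have "{l} \<times> (UNIV :: complex set) \<subseteq> zero_set_xy ft \<inter> zero_set_xy g1" using that by (auto simp: zft zg1)
    then have "finite ({l} \<times> (UNIV :: complex set))" using zeros_finite finite_subset by blast
    then show False using infinite_complex by (simp add: finite_cartesian_product_iff)
  qed
  have C2: "degree (specialize_xy l ft) = 0" if "poly h l = 0" "poly q l \<noteq> 0" for l
    by (rule no_root_degree_0) (use zeros_over_q that zft[of l] zg1[of l] in blast)
  have C3: "degree (specialize_xy l ft) = 0" if rl: "poly r l = 0" and ql: "poly q l \<noteq> 0" for l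
  proof -
    obtain c where "smult (poly q l) (specialize_xy l ft) = [:c:]" using roots_r[OF rl] by blast
    then have "degree (smult (poly q l) (specialize_xy l ft)) = 0" by simp
    then show ?thesis using ql by simp
  qed
  have "is_variable p"
  proof (cases "q = 0 \<or> h = 0")
    case True
    have "\<exists>c. p = emb_base c * var_u + emb_y G"
    proof (cases "q = 0")
      case True
      then show ?thesis unfolding p emG by (intro exI[of _ 0]) (simp add: emb_base_simps)
    next
      case False
      then have h0: "h = 0" using \<open>q = 0 \<or> h = 0\<close> by simp
      have "coeff (g2 * [:0, 1:] ^ 2) n = 0" for n
      proof (cases "n < 2")
        case False
        then show ?thesis using ck[of n] h0 by (simp add: zero_power)
      qed (rule low)
      then have "g2 * [:0, 1:] ^ 2 = 0" by (simp add: poly_eq_iff del: mult_eq_0_iff)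
      then have kz: "ev2 emb_base kap var_y (emb_base h * var_z) = 0" using hz by (simp add: emb_yz_def)
      have "coeff ft n = 0" if "n > 0" for n
      proof (rule poly_infinite_zero[OF poly_roots_finite[OF False]])
        fix l assume "l \<notin> {x. poly q x = 0}"
        then have "degree (specialize_xy l ft) = 0" using C2 h0 by simp
        then have "coeff (specialize_xy l ft) n = 0" using that by (intro coeff_eq_0) simp
        then show "poly (coeff ft n) l = 0" by (simp add: coeff_specialize_xy)
      qed
      then have "degree ft = 0" by (metis leading_coeff_0_iff degree_0 not_gr0)
      then obtain f0 where "ft = [:f0:]" by (rule degree_eq_zeroE)
      then have "emb_y ft = emb_base f0" by (simp add: emb_y_const)
      then have "p = emb_base (q * r * f0) * var_u + emb_y G"
        unfolding p emG kz by (simp add: h0 emb_base_simps algebra_simps)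
      then show ?thesis by blast
    qed
    then show ?thesis using residual_linear_in_u residual by blast
  next
    case False
    then have qh: "q \<noteq> 0" "h \<noteq> 0" by auto
    have ka: "coeff kap n = 0" if "n < 2" for n
    proof -
      have "[:h:] ^ n * coeff kap n = 0" using ck[of n] low[OF that] by simp
      then show ?thesis using qh by simp
    qed
    show ?thesis
    proof (cases "r = 0")
      case False
      show ?thesis
        by (rule residual_nonzero[OF qh False ft_nonzero _ _ dvd_red_poly_power[OF ft_nonzero] residual p C1 C2 C3])
          (auto intro: ka)
    next
      case True
      let ?E = "[:q:] * red_poly ft"
      let ?P = "g2 * [:0, 1:] ^ 2"
      define gg where "gg = [:G, [:q * h:]:] + smult ?E ?P"
      have cg: "coeff gg n = (if n = 0 then G else if n = 1 then [:q * h:] else 0) + ?E * coeff ?P n" for n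
        by (auto simp: gg_def coeff_pCons split: nat.splits)
      have "emb_yz [:G, [:q * h:]:] = emb_y G + emb_base (q * h) * var_z"
        by (simp add: emb_yz_def emb_y_def emb_base_def var_z_def)
      moreover have "emb_yz (smult ?E ?P) = emb_base q * emb_y (red_poly ft) * emb_yz ?P"
        by (simp add: emb_yz_def emb_y_def emb_base_def)
      ultimately have pg: "p = emb_yz gg"
        unfolding gg_def ring_homD(2)[OF ring_hom_emb_yz] emG p hz by (simp add: True emb_base_simps algebra_simps)
      show ?thesis
      proof (rule residual_plane[OF pg residual, of "q * h"])
        show "coeff gg 1 = [:q * h:]" using cg[of 1] low[of 1] by simp
        show "q * h \<noteq> 0" using qh by simp
        fix l j assume qhl: "poly (q * h) l = 0" and j: "1 \<le> (j::nat)"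
        have "specialize_xy l (?E * coeff ?P j) = 0"
        proof (cases "poly q l = 0")
          case True
          then show ?thesis by (simp add: specialize_xy_simps)
        next
          case False
          then have "poly h l = 0" using qhl by simp
          then have "specialize_xy l ([:h:] ^ j * coeff kap j) = 0"
            using j by (simp add: ring_homD(3,7)[OF ring_hom_specialize_xy] specialize_xy_simps zero_power)
          then show ?thesis unfolding ck ring_homD(3)[OF ring_hom_specialize_xy] by simp
        qed
        then show "specialize_xy l (coeff gg j) = 0"
        proof -
          assume 1: "specialize_xy l (?E * coeff ?P j) = 0"
          have "specialize_xy l [:q * h:] = 0" using qhl by (simp only: specialize_xy_simps) simp
          then show ?thesis unfolding cg ring_homD(2)[OF ring_hom_specialize_xy] 1 using j
            by (simp add: ring_homD(4)[OF ring_hom_specialize_xy])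
        qed
      qed
    qed
  qed
  then show ?thesis by (simp add: x_variable_def)
qed

end
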